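(* Let $\{Y_t\}_{t\ge0}$ be the stationary Lévy-driven Ornstein-Uhlenbeck process described in the context, with parameters $\mu=\mathbb{E}L_1$, $\sigma^2=\mathrm{Var}(L_1)$ and $\lambda>0$, let $d\ge 0$ be fixed, and let $\bar Y_\cdot$, $\hat\gamma_n(\cdot)$, $\hat\rho_n(\cdot)$, $\gamma(\cdot)$, $\rho(\cdot)$ be as in the context. Then, as $n\to\infty$, 1. $\bar{Y}_{\cdot}\to\mu$ almost surely; 2. $\frac1n\sum_{i=1}^n (Y_i-\bar Y_\cdot)^2\to\frac{\sigma^2}{2}$ almost surely; 3. $(\hat\gamma_n(1),\dots,\hat\gamma_n(d))\to(\gamma(1),\dots,\gamma(d))$ almost surely; 4. $(\hat\rho_n(1),\dots,\hat\rho_n(d))\to(\rho(1),\dots,\rho(d))$ almost surely.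
   Context: Setting: $\{L_t\}_{t\ge0}$ is a one-dimensional càdlàg Lévy process whose Lévy measure $F_L$ satisfies, for some constant $M>0$, $\int_{|x|>1}e^{vx}F_L(dx)<\infty$ for every real $|v|\le M$. Put $\mu=\mathbb{E}L_1$, $\sigma^2=\mathrm{Var}(L_1)$. For $\lambda>0$, the process $Y$ is $$Y_t=e^{-\lambda t}Y_0+e^{-\lambda t}\int_0^{\lambda t}e^{s}\,dL_s,\qquad t\ge0,$$ where $Y_0$ is independent of $\{L_t\}_{t\ge0}$ and has the same distribution as $\int_0^\infty e^{-s}dL_s$ (so $Y$ is strictly stationary). Theoretical quantities: for integers $h\ge0$, $\gamma(h)=\mathrm{cov}(Y_{t+h},Y_t)=\frac{\sigma^2}{2}e^{-\lambda h}$ and $\rho(h)=\mathrm{corr}(Y_{t+h},Y_t)=e^{-\lambda h}$. Empirical quantities, from the observations $Y_1,\dots,Y_n$ at integer times, for $h\in\{0,\dots,d\}$: $\bar Y_\cdot=\frac1n\sum_{i=1}^nY_i$, $\hat\gamma_n(h)=\frac1n\sum_{i=1}^{n-h}(Y_{i+h}-\bar Y_\cdot)(Y_i-\bar Y_\cdot)$, $\hat\rho_n(h)=\hat\gamma_n(h)/\hat\gamma_n(0)$. *)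

theory Defs
  imports "HOL-Probability.Probability"
begin

definition cadlag_path :: "(real \<Rightarrow> real) \<Rightarrow> bool" where
  "cadlag_path f \<longleftrightarrow>
     (\<forall>t\<ge>0. (f \<longlongrightarrow> f t) (at_right t)) \<and>
     (\<forall>t>0. \<exists>l. (f \<longlongrightarrow> l) (at_left t))"

definition tendsto_in_prob ::
  "'a measure \<Rightarrow> ('i \<Rightarrow> 'a \<Rightarrow> real) \<Rightarrow> ('a \<Rightarrow> real) \<Rightarrow> 'i filter \<Rightarrow> bool" where
  "tendsto_in_prob M X Z \<F> \<longleftrightarrow>
     (\<forall>\<epsilon>>0. ((\<lambda>i. measure M {\<omega> \<in> space M. \<epsilon> < \<bar>X i \<omega> - Z \<omega>\<bar>}) \<longlongrightarrow> 0) \<F>)"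

text \<open>Processes are indexed by type real; only the values at times \<open>t \<ge> 0\<close> matter.\<close>

definition levy_process :: "'a measure \<Rightarrow> (real \<Rightarrow> 'a \<Rightarrow> real) \<Rightarrow> bool" where
  "levy_process M L \<longleftrightarrow>
     prob_space M \<and>
     (\<forall>t\<ge>0. L t \<in> borel_measurable M) \<and>
     (AE \<omega> in M. L 0 \<omega> = 0) \<and>
     (\<forall>(n::nat) t. 0 \<le> t 0 \<and> (\<forall>i<n. t i \<le> t (Suc i)) \<longrightarrow>
        prob_space.indep_vars M (\<lambda>_. borel) (\<lambda>i \<omega>. L (t (Suc i)) \<omega> - L (t i) \<omega>) {..<n}) \<and>
     (\<forall>s\<ge>0. \<forall>t\<ge>0. distr M borel (\<lambda>\<omega>. L (s + t) \<omega> - L s \<omega>) = distr M borel (L t)) \<and>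
     (\<forall>t\<ge>0. tendsto_in_prob M L (L t) (at t within {0..})) \<and>
     (AE \<omega> in M. cadlag_path (\<lambda>t. L t \<omega>))"

text \<open>The Levy measure is the one in the Levy--Khintchine representation, with truncation
  function \<open>1\<^bsub>|x| \<le> 1\<^esub>\<close>; \<open>b\<close> is the drift and \<open>a\<close> the Gaussian variance.\<close>

definition levy_measure :: "'a measure \<Rightarrow> (real \<Rightarrow> 'a \<Rightarrow> real) \<Rightarrow> real measure \<Rightarrow> bool" where
  "levy_measure M L F \<longleftrightarrow>
     sets F = sets borel \<and>
     emeasure F {0} = 0 \<and>
     (\<integral>\<^sup>+x. ennreal (min 1 (x\<^sup>2)) \<partial>F) < \<infinity> \<and>
     (\<exists>b a :: real. 0 \<le> a \<and>
       (\<forall>t\<ge>0. \<forall>u::real. char (distr M borel (L t)) u =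
          exp (of_real t *
            (\<i> * of_real (b * u) - of_real (a * u\<^sup>2 / 2) +
             (CLINT x|F. exp (\<i> * of_real (u * x)) - 1
                - \<i> * of_real (u * x * indicator {-1..1} x))))))"

text \<open>For a continuous integrand the stochastic integral over \<open>[a,b]\<close> is the limit in
  probability of the left-endpoint Riemann sums, along every sequence of partitions
  \<open>a = p n 0 \<le> \<dots> \<le> p n (N n) = b\<close> whose mesh tends to 0. It is unique up to a.s. equality.\<close>

definition vanishing_partitions ::
  "real \<Rightarrow> real \<Rightarrow> (nat \<Rightarrow> nat) \<Rightarrow> (nat \<Rightarrow> nat \<Rightarrow> real) \<Rightarrow> bool" where
  "vanishing_partitions a b N p \<longleftrightarrow>
     (\<forall>n. p n 0 = a \<and> p n (N n) = b \<and> (\<forall>i<N n. p n i \<le> p n (Suc i))) \<and>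
     (\<forall>\<delta>>0. \<forall>\<^sub>F n in sequentially. \<forall>i<N n. p n (Suc i) - p n i < \<delta>)"

definition has_levy_integral ::
  "'a measure \<Rightarrow> (real \<Rightarrow> 'a \<Rightarrow> real) \<Rightarrow> (real \<Rightarrow> real) \<Rightarrow> real \<Rightarrow> real \<Rightarrow> ('a \<Rightarrow> real) \<Rightarrow> bool" where
  "has_levy_integral M L f a b I \<longleftrightarrow>
     I \<in> borel_measurable M \<and>
     (\<forall>N p. vanishing_partitions a b N p \<longrightarrow>
        tendsto_in_prob M
          (\<lambda>n \<omega>. \<Sum>i<N n. f (p n i) * (L (p n (Suc i)) \<omega> - L (p n i) \<omega>)) I sequentially)"

definition has_levy_integral_to_infinity ::
  "'a measure \<Rightarrow> (real \<Rightarrow> 'a \<Rightarrow> real) \<Rightarrow> (real \<Rightarrow> real) \<Rightarrow> ('a \<Rightarrow> real) \<Rightarrow> bool" where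
  "has_levy_integral_to_infinity M L f Z \<longleftrightarrow>
     Z \<in> borel_measurable M \<and>
     (\<exists>I. (\<forall>T\<ge>0. has_levy_integral M L f 0 T (I T)) \<and> tendsto_in_prob M I Z at_top)"

text \<open>Independence of \<open>Y 0\<close> and the whole process \<open>L\<close> is independence of the generated
  sigma-algebras.\<close>

definition stationary_levy_OU ::
  "'a measure \<Rightarrow> (real \<Rightarrow> 'a \<Rightarrow> real) \<Rightarrow> real \<Rightarrow> (real \<Rightarrow> 'a \<Rightarrow> real) \<Rightarrow> bool" where
  "stationary_levy_OU M L lam Y \<longleftrightarrow>
     (\<forall>t\<ge>0. Y t \<in> borel_measurable M) \<and>
     (\<forall>t\<ge>0. \<exists>I. has_levy_integral M L exp 0 (lam * t) I \<and>
        (AE \<omega> in M. Y t \<omega> = exp (- lam * t) * Y 0 \<omega> + exp (- lam * t) * I \<omega>)) \<and>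
     prob_space.indep_set M
       (sets (vimage_algebra (space M) (Y 0) borel))
       (sigma_sets (space M) (\<Union>t\<in>{0..}. sets (vimage_algebra (space M) (L t) borel))) \<and>
     (\<exists>Z. has_levy_integral_to_infinity M L (\<lambda>s. exp (- s)) Z \<and>
        distr M borel (Y 0) = distr M borel Z)"

definition covariance :: "'a measure \<Rightarrow> ('a \<Rightarrow> real) \<Rightarrow> ('a \<Rightarrow> real) \<Rightarrow> real" where
  "covariance M X Z =
     prob_space.expectation M (\<lambda>\<omega>. (X \<omega> - prob_space.expectation M X) * (Z \<omega> - prob_space.expectation M Z))"

definition correlation :: "'a measure \<Rightarrow> ('a \<Rightarrow> real) \<Rightarrow> ('a \<Rightarrow> real) \<Rightarrow> real" where
  "correlation M X Z =
     covariance M X Z / (sqrt (prob_space.variance M X) * sqrt (prob_space.variance M Z))"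

definition sample_mean :: "(nat \<Rightarrow> real) \<Rightarrow> nat \<Rightarrow> real" where
  "sample_mean y n = (1 / real n) * (\<Sum>i=1..n. y i)"

definition sample_autocov :: "(nat \<Rightarrow> real) \<Rightarrow> nat \<Rightarrow> nat \<Rightarrow> real" where
  "sample_autocov y n h =
     (1 / real n) * (\<Sum>i=1..n - h. (y (i + h) - sample_mean y n) * (y i - sample_mean y n))"

definition sample_autocorr :: "(nat \<Rightarrow> real) \<Rightarrow> nat \<Rightarrow> nat \<Rightarrow> real" where
  "sample_autocorr y n h = sample_autocov y n h / sample_autocov y n 0"

end

theory Submission
  imports Defs
begin

text \<open>On the integer grid the process is autoregressive: with \<open>\<theta> = exp (- \<lambda>)\<close> and
  \<open>y\<^sub>i = Y\<^sub>i - \<mu>\<close> one has \<open>y\<^sub>i\<^sub>+\<^sub>1 = \<theta> y\<^sub>i + \<epsilon>\<^sub>i\<^sub>+\<^sub>1\<close>, where \<open>y\<^sub>0, \<epsilon>\<^sub>1, \<epsilon>\<^sub>2, \<dots>\<close> are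
  independent and the \<open>\<epsilon>\<^sub>i\<close> are centred with equal variances and bounded fourth moments. Summing the
  recursion, its square and its product with \<open>y\<^sub>i\<^sub>-\<^sub>h\<close> reduces all the averages to averages of
  \<open>\<epsilon>\<^sub>i\<close>, \<open>\<epsilon>\<^sub>i\<^sup>2 - E \<epsilon>\<^sub>i\<^sup>2\<close> and \<open>y\<^sub>i \<epsilon>\<^sub>i\<^sub>+\<^sub>h\<^sub>+\<^sub>1\<close>, which are orthogonal and bounded in
  \<open>L\<^sup>2\<close>, so that the strong law for orthogonal sequences replaces the ergodic theorem. The fourth
  moments of \<open>L\<close> come from a fourth difference of its characteristic function at \<open>0\<close>; those of the
  integrals follow by Fatou's lemma from Riemann sums along nested dyadic partitions, which converge
  almost surely because they are Cauchy in \<open>L\<^sup>2\<close> at a geometric rate.\<close>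

subsection \<open>Second moments and the strong law for orthogonal sequences\<close>

text \<open>The moment hypothesis concerns the Levy measure, and the integrals are given only as
  limits in probability, so neither moments nor independence of the innovations can be read off;
  both are established for Riemann sums and carried over to the limit. Order four is forced by the
  squares: the strong law for orthogonal sequences asks for second moments of the centred squared
  innovations. The starting value enters with its second moment only, because the averages of
  squares of the autoregressive sequence come from solving the squared recursion instead of from a
  strong law of their own. The price is the boundary term, the last square divided by
  \<open>n\<close>, which has to tend to \<open>0\<close> almost surely. What has to be computed for
  the innovations is thus their means, their variances and a common bound on fourth moments; the
  scaling by \<open>exp (- lam * i)\<close> makes the last two uniform although the underlying
  integrals grow exponentially.\<close>

lemma power2_le_one_plus_power4: "(x::real)^2 \<le> 1 + x^4"
proof -
  have "x^4 = (x^2)^2" by simp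
  moreover have "0 \<le> (x^2 - 1)^2" by simp
  then have "2 * x^2 \<le> 1 + (x^2)^2" by (simp add: power2_diff)
  moreover have "0 \<le> x^2" by simp
  ultimately show ?thesis by linarith
qed

context prob_space
begin

lemma integrable_power2_of_power4:
  fixes X :: "'a \<Rightarrow> real"
  assumes [measurable]: "X \<in> borel_measurable M" and "integrable M (\<lambda>w. X w^4)"
  shows "integrable M (\<lambda>w. X w^2)"
proof (rule Bochner_Integration.integrable_bound)
  show "integrable M (\<lambda>w. 1 + X w^4)" using assms by simp
qed (use power2_le_one_plus_power4 in \<open>auto intro!: always_eventually\<close>)

lemma integrable_mult_of_power2:
  fixes X W :: "'a \<Rightarrow> real"
  assumes [measurable]: "X \<in> borel_measurable M" "W \<in> borel_measurable M"
    and "integrable M (\<lambda>w. X w^2)" "integrable M (\<lambda>w. W w^2)"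
  shows "integrable M (\<lambda>w. X w * W w)"
proof (rule Bochner_Integration.integrable_bound)
  show "integrable M (\<lambda>w. X w^2 + W w^2)" using assms by simp
  have "\<bar>x * y\<bar> \<le> x^2 + y^2" for x y :: real
  proof -
    have "0 \<le> (\<bar>x\<bar> - \<bar>y\<bar>)^2" by simp
    then have "2 * (\<bar>x\<bar> * \<bar>y\<bar>) \<le> x^2 + y^2" by (simp add: power2_diff)
    moreover have "0 \<le> \<bar>x\<bar> * \<bar>y\<bar>" by simp
    ultimately show ?thesis unfolding abs_mult by linarith
  qed
  then show "AE w in M. norm (X w * W w) \<le> norm (X w^2 + W w^2)"
    by (auto intro!: always_eventually)
qed auto

lemma integrable_of_power2:
  fixes X :: "'a \<Rightarrow> real"
  assumes "X \<in> borel_measurable M" "integrable M (\<lambda>w. X w^2)"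
  shows "integrable M X"
  using integrable_mult_of_power2[of X "\<lambda>_. 1"] assms by simp

lemma integrable_power2_add:
  fixes X W :: "'a \<Rightarrow> real"
  assumes [measurable]: "X \<in> borel_measurable M" "W \<in> borel_measurable M"
    and "integrable M (\<lambda>w. X w^2)" "integrable M (\<lambda>w. W w^2)"
  shows "integrable M (\<lambda>w. (X w + W w)^2)"
  using assms integrable_mult_of_power2[OF assms] by (simp add: power2_sum mult.assoc)

lemma integrable_power2_sum:
  fixes X :: "'i \<Rightarrow> 'a \<Rightarrow> real"
  assumes "\<And>i. i \<in> I \<Longrightarrow> X i \<in> borel_measurable M"
    and "\<And>i. i \<in> I \<Longrightarrow> integrable M (\<lambda>w. X i w^2)"
  shows "integrable M (\<lambda>w. (\<Sum>i\<in>I. X i w)^2)"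
  using assms
proof (induction I rule: infinite_finite_induct)
  case (insert x F)
  then show ?case by (simp add: integrable_power2_add)
qed auto

lemma expectation_sq_le:
  fixes X :: "'a \<Rightarrow> real"
  assumes [measurable]: "X \<in> borel_measurable M" and "integrable M (\<lambda>w. X w^2)"
  shows "(expectation X)^2 \<le> expectation (\<lambda>w. X w^2)"
  using variance_eq[OF integrable_of_power2[OF assms] assms(2)] variance_positive[of X] by simp

text \<open>By Tonelli the series of the \<open>f n\<close> has expectation at most the sum of the
  \<open>c n\<close>. It is therefore finite almost surely, and its terms tend to zero.\<close>

lemma AE_tendsto_zero_of_summable:
  fixes f :: "nat \<Rightarrow> 'a \<Rightarrow> real"
  assumes int: "\<And>n. integrable M (f n)" and nn: "\<And>n w. 0 \<le> f n w"
    and le: "\<And>n. expectation (f n) \<le> c n" and c: "summable c"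
  shows "AE w in M. (\<lambda>n. f n w) \<longlonglongrightarrow> 0"
proof -
  have [measurable]: "f n \<in> borel_measurable M" for n using int[of n] by simp
  have "(\<integral>\<^sup>+w. (\<Sum>n. ennreal (f n w)) \<partial>M) = (\<Sum>n. \<integral>\<^sup>+w. ennreal (f n w) \<partial>M)"
    by (rule nn_integral_suminf) auto
  also have "\<dots> = (\<Sum>n. ennreal (expectation (f n)))"
    by (intro suminf_cong nn_integral_eq_integral int AE_I2 nn)
  also have "\<dots> \<le> (\<Sum>n. ennreal (c n))"
    by (intro suminf_le ennreal_leI le summableI)
  also have "\<dots> < \<infinity>"
  proof -
    have c0: "0 \<le> c n" for n by (rule order_trans[OF Bochner_Integration.integral_nonneg le[of n]]) (rule nn)
    show ?thesis by (subst suminf_ennreal2[OF c0 c]) simp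
  qed
  finally have "(\<integral>\<^sup>+w. (\<Sum>n. ennreal (f n w)) \<partial>M) \<noteq> \<infinity>" by simp
  then have "AE w in M. (\<Sum>n. ennreal (f n w)) \<noteq> \<infinity>"
    by (rule nn_integral_PInf_AE[rotated]) measurable
  then show ?thesis
  proof eventually_elim
    case (elim w)
    then have "summable (\<lambda>n. f n w)" by (intro summable_suminf_not_top nn) simp
    then show ?case by (rule summable_LIMSEQ_zero)
  qed
qed

lemma orthogonal_sum_power2:
  fixes D :: "'i \<Rightarrow> 'a \<Rightarrow> real"
  assumes [measurable]: "\<And>i. i \<in> I \<Longrightarrow> D i \<in> borel_measurable M"
    and sq: "\<And>i. i \<in> I \<Longrightarrow> integrable M (\<lambda>w. (D i w)^2)"
    and orth: "\<And>i j. i \<in> I \<Longrightarrow> j \<in> I \<Longrightarrow> i \<noteq> j \<Longrightarrow> expectation (\<lambda>w. D i w * D j w) = 0"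
  shows "expectation (\<lambda>w. (\<Sum>i\<in>I. D i w)^2) = (\<Sum>i\<in>I. expectation (\<lambda>w. (D i w)^2))"
proof (cases "finite I")
  case fin: True
  have "expectation (\<lambda>w. (\<Sum>i\<in>I. D i w)^2) = expectation (\<lambda>w. \<Sum>i\<in>I. \<Sum>j\<in>I. D i w * D j w)"
    by (simp add: power2_eq_square sum_product)
  also have "\<dots> = (\<Sum>i\<in>I. \<Sum>j\<in>I. expectation (\<lambda>w. D i w * D j w))"
  proof -
    have "integrable M (\<lambda>w. D i w * D j w)" if "i \<in> I" "j \<in> I" for i j
      using sq that by (intro integrable_mult_of_power2) auto
    then show ?thesis by simp
  qed
  also have "\<dots> = (\<Sum>i\<in>I. \<Sum>j\<in>I. if j = i then expectation (\<lambda>w. D i w * D j w) else 0)"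
    using orth by (intro sum.cong refl) auto
  also have "\<dots> = (\<Sum>i\<in>I. expectation (\<lambda>w. (D i w)^2))"
    using fin by (simp add: sum.delta power2_eq_square)
  finally show ?thesis .
qed simp

text \<open>Chebyshev's inequality gives convergence along \<open>n\<^sup>2\<close>; between \<open>n\<^sup>2\<close> and \<open>(n + 1)\<^sup>2\<close> the partial
  sums move by at most \<open>G n\<close>, a sum of \<open>2 n + 1\<close> absolute values, with \<open>E (G n)\<^sup>2 = O(n\<^sup>2)\<close>.\<close>

lemma orthogonal_slln:
  fixes D :: "nat \<Rightarrow> 'a \<Rightarrow> real"
  assumes [measurable]: "\<And>i. D i \<in> borel_measurable M"
    and sq: "\<And>i. integrable M (\<lambda>w. (D i w)^2)"
    and C: "\<And>i. expectation (\<lambda>w. (D i w)^2) \<le> C"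
    and orth: "\<And>i j. i < j \<Longrightarrow> expectation (\<lambda>w. D i w * D j w) = 0"
  shows "AE w in M. (\<lambda>n. (\<Sum>i<n. D i w) / real n) \<longlonglongrightarrow> 0"
proof -
  have orth': "expectation (\<lambda>w. D i w * D j w) = 0" if "i \<noteq> j" for i j
    using orth[of i j] orth[of j i] that by (cases i j rule: linorder_cases) (auto simp: mult.commute)
  define S where "S = (\<lambda>n w. \<Sum>i<n. D i w)"
  define G where "G = (\<lambda>n w. \<Sum>i\<in>{n^2..<(Suc n)^2}. \<bar>D i w\<bar>)"
  have [measurable]: "S n \<in> borel_measurable M" "G n \<in> borel_measurable M" for n
    by (auto simp: S_def G_def)
  have intS: "integrable M (\<lambda>w. (S n w)^2)" for n
    unfolding S_def using sq by (intro integrable_power2_sum) auto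
  have intG: "integrable M (\<lambda>w. (G n w)^2)" for n
    unfolding G_def using sq by (intro integrable_power2_sum) auto
  have C0: "0 \<le> C" by (rule order_trans[OF Bochner_Integration.integral_nonneg C[of 0]]) simp
  have ES: "expectation (\<lambda>w. (S n w)^2) \<le> real n * C" for n
  proof -
    have "expectation (\<lambda>w. (S n w)^2) = (\<Sum>i<n. expectation (\<lambda>w. (D i w)^2))"
      unfolding S_def using sq orth' by (intro orthogonal_sum_power2) auto
    also have "\<dots> \<le> (\<Sum>i<n. C)" by (intro sum_mono C)
    finally show ?thesis by simp
  qed
  have EG: "expectation (\<lambda>w. (G n w)^2) \<le> (2 * real n + 1)^2 * C" for n
  proof -
    have card: "real (card {n^2..<(Suc n)^2}) = 2 * real n + 1"
      by (simp add: power2_eq_square)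
    have "(G n w)^2 \<le> (2 * real n + 1) * (\<Sum>i\<in>{n^2..<(Suc n)^2}. (D i w)^2)" for w
      using Cauchy_Schwarz_ineq_sum[of "\<lambda>_. 1" "\<lambda>i. \<bar>D i w\<bar>" "{n^2..<(Suc n)^2}"] card
      by (simp add: G_def)
    then have "expectation (\<lambda>w. (G n w)^2)
        \<le> expectation (\<lambda>w. (2 * real n + 1) * (\<Sum>i\<in>{n^2..<(Suc n)^2}. (D i w)^2))"
      using sq by (intro integral_mono intG integrable_mult_right Bochner_Integration.integrable_sum) auto
    also have "\<dots> = (2 * real n + 1) * (\<Sum>i\<in>{n^2..<(Suc n)^2}. expectation (\<lambda>w. (D i w)^2))"
      using sq by (simp add: Bochner_Integration.integral_sum)
    also have "\<dots> \<le> (2 * real n + 1) * (\<Sum>i\<in>{n^2..<(Suc n)^2}. C)"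
      by (intro mult_left_mono sum_mono C) auto
    finally show ?thesis using card by (simp add: power2_eq_square mult.assoc add.commute)
  qed
  \<comment> \<open>Both bounds are taken at \<open>m = n + 1\<close>, so that the denominator
    \<open>m^4\<close> never vanishes. With \<open>2 * m + 1 \<le> 3 * m\<close> the expectation is
    at most \<open>(m^2 + 9 * m^2) * C / m^4\<close>, which gives the factor \<open>10\<close>
    below.\<close>
  define Q where "Q = (\<lambda>n w. ((S ((Suc n)^2) w)^2 + (G (Suc n) w)^2) / real (Suc n)^4)"
  have "AE w in M. (\<lambda>n. Q n w) \<longlonglongrightarrow> 0"
  proof (rule AE_tendsto_zero_of_summable)
    show "summable (\<lambda>n. 10 * C * inverse (real (Suc n)^2))"
    proof (intro summable_mult)
      have "summable (\<lambda>n. inverse (real n^2))" by (rule inverse_power_summable) simp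
      then show "summable (\<lambda>n. inverse (real (Suc n)^2))" by (subst summable_Suc_iff)
    qed
    fix n
    define m where "m = Suc n"
    have m: "real m \<ge> 1" by (simp add: m_def)
    have "expectation (Q n) = (expectation (\<lambda>w. (S (m^2) w)^2) + expectation (\<lambda>w. (G m w)^2)) / real m^4"
      unfolding Q_def m_def using intS intG by simp
    also have "\<dots> \<le> (real (m^2) * C + (2 * real m + 1)^2 * C) / real m^4"
      using ES[of "m^2"] EG[of m] by (intro divide_right_mono add_mono) auto
    also have "\<dots> \<le> (real m^2 * C + (3 * real m)^2 * C) / real m^4"
      using m C0 by (intro divide_right_mono add_mono mult_right_mono power_mono) auto
    also have "\<dots> = 10 * C * inverse (real m^2)"
      using m by (simp add: field_simps power2_eq_square power4_eq_xxxx)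
    finally show "expectation (Q n) \<le> 10 * C * inverse (real (Suc n)^2)" by (simp add: m_def)
  qed (auto simp: Q_def intS intG)
  then show ?thesis
  proof eventually_elim
    case (elim w)
    \<comment> \<open>\<open>R m\<close> dominates the averages for every \<open>n \<ge> 1\<close>
      with \<open>m^2 \<le> n < (m + 1)^2\<close>, that is, with \<open>m\<close> the integer part
      of the square root of \<open>n\<close>. Its square is controlled through
      \<open>(x + y)^2 \<le> 2 * (x^2 + y^2)\<close>.\<close>
    define R where "R = (\<lambda>n. (\<bar>S (n^2) w\<bar> + G n w) / real n^2)"
    have "(\<lambda>n. sqrt (2 * Q n w)) \<longlonglongrightarrow> 0"
      using tendsto_real_sqrt[OF tendsto_mult_left[OF elim, of 2]] by simp
    moreover have "R (Suc n) \<le> sqrt (2 * Q n w)" for n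
    proof (rule real_le_rsqrt)
      have "(R (Suc n))^2 = (\<bar>S ((Suc n)^2) w\<bar> + G (Suc n) w)^2 / real (Suc n)^4"
        by (simp add: R_def power_divide flip: power_mult)
      also have "\<dots> \<le> 2 * ((S ((Suc n)^2) w)^2 + (G (Suc n) w)^2) / real (Suc n)^4"
        using arith_geo_mean[of 0] sum_squares_bound[of "\<bar>S ((Suc n)^2) w\<bar>" "G (Suc n) w"]
        by (intro divide_right_mono) (auto simp: power2_sum)
      finally show "(R (Suc n))^2 \<le> 2 * Q n w" by (simp add: Q_def)
    qed
    moreover have R0: "0 \<le> R n" for n by (auto simp: R_def G_def intro!: divide_nonneg_nonneg sum_nonneg)
    ultimately have "(\<lambda>n. R (Suc n)) \<longlonglongrightarrow> 0"
      by (intro tendsto_sandwich[of "\<lambda>_. 0" "\<lambda>n. R (Suc n)" sequentially "\<lambda>n. sqrt (2 * Q n w)" 0]) auto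
    then have "R \<longlonglongrightarrow> 0" by (rule LIMSEQ_imp_Suc)
    moreover have "filterlim (\<lambda>n::nat. nat \<lfloor>sqrt (real n)\<rfloor>) at_top sequentially"
      by (intro filterlim_compose[OF filterlim_nat_sequentially] filterlim_compose[OF filterlim_floor_sequentially]
           filterlim_compose[OF sqrt_at_top] filterlim_real_sequentially)
    ultimately have lim: "(\<lambda>n. R (nat \<lfloor>sqrt (real n)\<rfloor>)) \<longlonglongrightarrow> 0"
      by (rule filterlim_compose)
    have "norm ((\<Sum>i<n. D i w) / real n) \<le> R (nat \<lfloor>sqrt (real n)\<rfloor>)" if "n \<ge> 1" for n
    proof -
      define m where "m = nat \<lfloor>sqrt (real n)\<rfloor>"
      have m: "real m \<le> sqrt (real n)" "sqrt (real n) < real m + 1"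
        unfolding m_def by (auto simp: of_nat_nat)
      have m1: "m \<ge> 1" using that by (simp add: m_def le_nat_iff)
      have "(real m)^2 \<le> real n" using m(1) by (metis of_nat_0_le_iff real_sqrt_ge_0_iff power_mono real_sqrt_pow2)
      then have lo: "m^2 \<le> n" by (metis of_nat_le_iff of_nat_power)
      have "real n < (real m + 1)^2" using m(2) by (metis of_nat_0_le_iff power_strict_mono real_sqrt_ge_0_iff real_sqrt_pow2 zero_less_numeral)
      then have hi: "n < (Suc m)^2" by (metis of_nat_Suc of_nat_less_iff of_nat_power add.commute)
      have "{..<n} = {..<m^2} \<union> {m^2..<n}" using lo by auto
      then have "(\<Sum>i<n. D i w) = S (m^2) w + (\<Sum>i\<in>{m^2..<n}. D i w)"
        unfolding S_def by (simp add: sum.union_disjoint ivl_disj_int_one)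
      moreover have "\<bar>\<Sum>i\<in>{m^2..<n}. D i w\<bar> \<le> (\<Sum>i\<in>{m^2..<n}. \<bar>D i w\<bar>)" by (rule sum_abs)
      moreover have "(\<Sum>i\<in>{m^2..<n}. \<bar>D i w\<bar>) \<le> G m w"
        unfolding G_def using hi by (intro sum_mono2) auto
      ultimately have "\<bar>\<Sum>i<n. D i w\<bar> \<le> \<bar>S (m^2) w\<bar> + G m w" by linarith
      moreover have "real m^2 \<le> real n" using lo by (metis of_nat_le_iff of_nat_power)
      ultimately have "\<bar>\<Sum>i<n. D i w\<bar> / real n \<le> (\<bar>S (m^2) w\<bar> + G m w) / real m^2"
        using m1 by (intro frac_le) (auto simp: G_def intro!: add_nonneg_nonneg sum_nonneg)
      then show ?thesis using that by (simp add: R_def m_def)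
    qed
    then show ?case
      by (intro Lim_null_comparison[OF _ lim] eventually_sequentiallyI[of 1]) auto
  qed
qed

end

context prob_space
begin

subsection \<open>Limits in probability with a Cauchy rate\<close>

text \<open>Fatou's lemma for the Bochner integral. Integrability of the limit is a conclusion,
  which is how moments are obtained for variables known only as limits.\<close>

lemma expectation_AE_limit_le:
  fixes f :: "nat \<Rightarrow> 'a \<Rightarrow> real"
  assumes int: "\<And>n. integrable M (f n)" and nn: "\<And>n w. 0 \<le> f n w" "\<And>w. 0 \<le> g w"
    and [measurable]: "g \<in> borel_measurable M"
    and lim: "AE w in M. (\<lambda>n. f n w) \<longlonglongrightarrow> g w"
    and le: "\<forall>\<^sub>F n in sequentially. expectation (f n) \<le> c"
  shows "integrable M g" and "expectation g \<le> c"
proof -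
  have [measurable]: "f n \<in> borel_measurable M" for n using int[of n] by simp
  obtain n where "expectation (f n) \<le> c" using le by (auto simp: eventually_sequentially)
  then have c0: "0 \<le> c" by (rule order_trans[OF Bochner_Integration.integral_nonneg, rotated]) (rule nn)
  have "(\<integral>\<^sup>+w. ennreal (g w) \<partial>M) = (\<integral>\<^sup>+w. liminf (\<lambda>n. ennreal (f n w)) \<partial>M)"
    using lim
  proof (intro nn_integral_cong_AE, eventually_elim)
    case (elim w)
    from tendsto_ennrealI[OF elim(2)]
    have "(\<lambda>n. ennreal (f n w)) \<longlonglongrightarrow> ennreal (g w)" .
    then show ?case by (metis lim_imp_Liminf sequentially_bot)
  qed
  also have "\<dots> \<le> liminf (\<lambda>n. \<integral>\<^sup>+w. ennreal (f n w) \<partial>M)" by (rule nn_integral_liminf) measurable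
  also have "\<dots> = liminf (\<lambda>n. ennreal (expectation (f n)))"
    by (subst nn_integral_eq_integral) (auto intro: int nn)
  also have "\<dots> \<le> ennreal c"
    using le by (intro Liminf_le) (auto elim!: eventually_mono intro: ennreal_leI)
  finally have *: "(\<integral>\<^sup>+w. ennreal (g w) \<partial>M) \<le> ennreal c" .
  show g: "integrable M g"
    using * nn(2) by (intro integrableI_bounded) (auto simp: order_le_less_trans)
  show "expectation g \<le> c"
    using * c0 nn(2) g by (simp add: nn_integral_eq_integral)
qed

lemma prob_gt_le:
  fixes X :: "'a \<Rightarrow> real"
  assumes [measurable]: "X \<in> borel_measurable M" and "integrable M (\<lambda>w. X w^2)" and "0 < e"
  shows "prob {w\<in>space M. e < \<bar>X w\<bar>} \<le> expectation (\<lambda>w. X w^2) / e^2"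
proof -
  have "prob {w\<in>space M. e < \<bar>X w\<bar>} \<le> prob {w\<in>space M. e^2 \<le> X w^2}"
  proof (rule finite_measure_mono)
    show "{w\<in>space M. e < \<bar>X w\<bar>} \<subseteq> {w\<in>space M. e^2 \<le> X w^2}"
      using assms(3) by (auto simp: abs_le_square_iff[symmetric])
  qed measurable
  also have "\<dots> \<le> expectation (\<lambda>w. X w^2) / e^2"
    using assms by (intro integral_Markov_inequality_measure[where A="{}"]) auto
  finally show ?thesis .
qed

text \<open>Fixing \<open>n\<close> and letting \<open>m\<close> grow in the triangle inequality
  removes the unknown distance from \<open>X m\<close> to \<open>Z\<close>, so Chebyshev's bound
  holds for \<open>X n - Z\<close> itself. These bounds are summable, so Borel-Cantelli gives almost
  sure convergence of the whole sequence, and Fatou's lemma turns the Cauchy estimate into one for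
  the limit.\<close>

lemma tendsto_in_prob_L2_Cauchy:
  fixes X :: "nat \<Rightarrow> 'a \<Rightarrow> real"
  assumes [measurable]: "\<And>n. X n \<in> borel_measurable M" "Z \<in> borel_measurable M"
    and sq: "\<And>n. integrable M (\<lambda>w. X n w^2)"
    and prob: "tendsto_in_prob M X Z sequentially"
    and Cauchy: "\<And>n m. n \<le> m \<Longrightarrow> expectation (\<lambda>w. (X m w - X n w)^2) \<le> r n"
    and r: "summable r"
  shows "AE w in M. (\<lambda>n. X n w) \<longlonglongrightarrow> Z w"
    and "integrable M (\<lambda>w. Z w^2)"
    and "expectation (\<lambda>w. (Z w - X n w)^2) \<le> r n"
proof -
  have sqd: "integrable M (\<lambda>w. (X m w - X n w)^2)" for m n
    using integrable_power2_add[of "X m" "\<lambda>w. - X n w"] sq by simp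
  have small: "prob {w\<in>space M. 2 * e < \<bar>X n w - Z w\<bar>} \<le> r n / e^2" if "0 < e" for e n
  proof (rule tendsto_lowerbound)
    have "(\<lambda>m. r n / e^2 + prob {w\<in>space M. e < \<bar>X m w - Z w\<bar>}) \<longlonglongrightarrow> r n / e^2 + 0"
      using prob that unfolding tendsto_in_prob_def by (intro tendsto_add tendsto_const) auto
    then show "(\<lambda>m. r n / e^2 + prob {w\<in>space M. e < \<bar>X m w - Z w\<bar>}) \<longlonglongrightarrow> r n / e^2" by simp
    show "\<forall>\<^sub>F m in sequentially. prob {w\<in>space M. 2 * e < \<bar>X n w - Z w\<bar>}
        \<le> r n / e^2 + prob {w\<in>space M. e < \<bar>X m w - Z w\<bar>}"
    proof (rule eventually_sequentiallyI[of n])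
      fix m assume "n \<le> m"
      have "prob {w\<in>space M. 2 * e < \<bar>X n w - Z w\<bar>}
          \<le> prob ({w\<in>space M. e < \<bar>X m w - X n w\<bar>} \<union> {w\<in>space M. e < \<bar>X m w - Z w\<bar>})"
        by (intro finite_measure_mono) auto
      also have "\<dots> \<le> prob {w\<in>space M. e < \<bar>X m w - X n w\<bar>} + prob {w\<in>space M. e < \<bar>X m w - Z w\<bar>}"
        by (intro measure_Un_le) auto
      also have "prob {w\<in>space M. e < \<bar>X m w - X n w\<bar>} \<le> r n / e^2"
        using prob_gt_le[OF _ sqd that, of m n] Cauchy[OF \<open>n \<le> m\<close>] that
        by (force intro: order_trans divide_right_mono)
      finally show "prob {w\<in>space M. 2 * e < \<bar>X n w - Z w\<bar>}
          \<le> r n / e^2 + prob {w\<in>space M. e < \<bar>X m w - Z w\<bar>}" by simp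
    qed
  qed simp
  have ev: "AE w in M. \<forall>\<^sub>F n in sequentially. \<bar>X n w - Z w\<bar> \<le> 2 * e" if "0 < e" for e
  proof -
    have "AE w in M. \<forall>\<^sub>F n in sequentially. w \<in> space M - {w\<in>space M. 2 * e < \<bar>X n w - Z w\<bar>}"
    proof (rule borel_cantelli_AE1)
      show "summable (\<lambda>n. prob {w\<in>space M. 2 * e < \<bar>X n w - Z w\<bar>})"
        using small[OF that] by (intro summable_comparison_test'[OF summable_divide[OF r, of "e^2"]]) auto
    qed (auto simp: emeasure_eq_measure)
    then show ?thesis by eventually_elim (auto elim!: eventually_mono)
  qed
  have "AE w in M. \<forall>k. \<forall>\<^sub>F n in sequentially. \<bar>X n w - Z w\<bar> \<le> 2 * inverse (real (Suc k))"
    by (subst AE_all_countable) (intro allI ev, simp)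
  then show AE: "AE w in M. (\<lambda>n. X n w) \<longlonglongrightarrow> Z w"
  proof eventually_elim
    case (elim w)
    show ?case
    proof (rule tendstoI)
      fix e :: real assume "0 < e"
      then obtain k where "inverse (real (Suc k)) < e / 2" using reals_Archimedean[of "e/2"] by auto
      then show "\<forall>\<^sub>F n in sequentially. dist (X n w) (Z w) < e"
        using elim[rule_format, of k] by (auto elim!: eventually_mono simp: dist_real_def)
    qed
  qed
  have lim: "AE w in M. (\<lambda>m. (X m w - X n w)^2) \<longlonglongrightarrow> (Z w - X n w)^2" for n
    using AE by eventually_elim (intro tendsto_intros)
  have evc: "\<forall>\<^sub>F m in sequentially. expectation (\<lambda>w. (X m w - X n w)^2) \<le> r n" for n
    using Cauchy by (intro eventually_sequentiallyI[of n])
  note F = expectation_AE_limit_le[where f="\<lambda>m w. (X m w - X n w)^2" and g="\<lambda>w. (Z w - X n w)^2" for n]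
  show "expectation (\<lambda>w. (Z w - X n w)^2) \<le> r n"
    by (rule F(2)[OF sqd _ _ _ lim evc]) auto
  have "integrable M (\<lambda>w. (Z w - X 0 w)^2)"
    by (rule F(1)[OF sqd _ _ _ lim evc]) auto
  then show "integrable M (\<lambda>w. Z w^2)"
    using integrable_power2_add[of "\<lambda>w. Z w - X 0 w" "X 0"] sq by simp
qed

lemma L2_limit_moments:
  fixes X :: "nat \<Rightarrow> 'a \<Rightarrow> real"
  assumes [measurable]: "\<And>n. X n \<in> borel_measurable M" "Z \<in> borel_measurable M"
    and sq: "\<And>n. integrable M (\<lambda>w. X n w^2)" "integrable M (\<lambda>w. Z w^2)"
    and lim: "(\<lambda>n. expectation (\<lambda>w. (Z w - X n w)^2)) \<longlonglongrightarrow> 0"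
  shows "(\<lambda>n. expectation (X n)) \<longlonglongrightarrow> expectation Z"
    and "(\<lambda>n. expectation (\<lambda>w. X n w^2)) \<longlonglongrightarrow> expectation (\<lambda>w. Z w^2)"
proof -
  note [simp] = integrable_of_power2[OF assms(1) sq(1)] integrable_of_power2[OF assms(2) sq(2)]
  define D where "D = (\<lambda>n w. Z w - X n w)"
  have [measurable]: "D n \<in> borel_measurable M" for n by (simp add: D_def)
  have D2: "integrable M (\<lambda>w. (D n w)^2)" for n
    using integrable_power2_add[of Z "\<lambda>w. - X n w"] sq by (simp add: D_def)
  have lim': "(\<lambda>n. sqrt (expectation (\<lambda>w. (D n w)^2))) \<longlonglongrightarrow> 0"
    using tendsto_real_sqrt[OF lim] by (simp add: D_def)
  have "(\<lambda>n. expectation (X n) - expectation Z) \<longlonglongrightarrow> 0"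
  proof (rule Lim_null_comparison[OF always_eventually lim'], intro allI)
    fix n
    have "(expectation (X n) - expectation Z)^2 = (expectation (D n))^2"
      by (simp add: D_def power2_commute)
    also have "\<dots> \<le> expectation (\<lambda>w. (D n w)^2)" by (intro expectation_sq_le D2) simp
    finally show "norm (expectation (X n) - expectation Z) \<le> sqrt (expectation (\<lambda>w. (D n w)^2))"
      by (simp add: real_le_rsqrt)
  qed
  then show "(\<lambda>n. expectation (X n)) \<longlonglongrightarrow> expectation Z" by (simp add: LIM_zero_iff)
  \<comment> \<open>The summand \<open>1 / (n + 1)\<close> keeps \<open>e n\<close> positive, so
    that it can be the weight in \<open>2 * |z * d| \<le> e * z^2 + d^2 / e\<close>, used here in
    place of the Cauchy-Schwarz inequality. As the second moment of \<open>D n\<close> is at most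
    \<open>(e n)^2\<close>, the last term contributes at most \<open>e n\<close>.\<close>
  define e where "e = (\<lambda>n. sqrt (expectation (\<lambda>w. (D n w)^2)) + inverse (real (Suc n)))"
  have e: "e n > 0" for n by (auto simp: e_def intro!: add_nonneg_pos)
  have "e \<longlonglongrightarrow> 0 + 0" unfolding e_def by (intro tendsto_add lim' LIMSEQ_inverse_real_of_nat)
  then have elim: "(\<lambda>n. e n * (expectation (\<lambda>w. Z w^2) + 1) + expectation (\<lambda>w. (D n w)^2)) \<longlonglongrightarrow> 0"
    using lim by (auto intro!: tendsto_eq_intros simp: D_def)
  have "(\<lambda>n. expectation (\<lambda>w. X n w^2) - expectation (\<lambda>w. Z w^2)) \<longlonglongrightarrow> 0"
  proof (rule Lim_null_comparison[OF always_eventually elim], intro allI)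
    fix n
    have ZD: "integrable M (\<lambda>w. Z w * D n w)" using sq D2 by (intro integrable_mult_of_power2) auto
    have "expectation (\<lambda>w. X n w^2) = expectation (\<lambda>w. Z w^2 - 2 * (Z w * D n w) + (D n w)^2)"
      by (intro Bochner_Integration.integral_cong) (auto simp: D_def power2_eq_square algebra_simps)
    also have "\<dots> = expectation (\<lambda>w. Z w^2) - 2 * expectation (\<lambda>w. Z w * D n w) + expectation (\<lambda>w. (D n w)^2)"
      using sq D2 ZD by simp
    finally have 1: "expectation (\<lambda>w. X n w^2) - expectation (\<lambda>w. Z w^2)
      = expectation (\<lambda>w. (D n w)^2) - expectation (\<lambda>w. 2 * (Z w * D n w))" by simp
    have AG: "\<bar>2 * (z * d)\<bar> \<le> e n * z^2 + d^2 / e n" for z d :: real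
    proof -
      have "0 \<le> (e n * \<bar>z\<bar> - \<bar>d\<bar>)^2 / e n" using e[of n] by simp
      also have "\<dots> = e n * z^2 + d^2 / e n - 2 * \<bar>z\<bar> * \<bar>d\<bar>"
        using e[of n] by (simp add: power2_diff field_simps power2_eq_square)
      finally show ?thesis by (simp add: abs_mult)
    qed
    have "\<bar>expectation (\<lambda>w. 2 * (Z w * D n w))\<bar> \<le> expectation (\<lambda>w. \<bar>2 * (Z w * D n w)\<bar>)"
      by (rule integral_abs_bound)
    also have "\<dots> \<le> expectation (\<lambda>w. e n * Z w^2 + (D n w)^2 / e n)"
      using sq D2 ZD AG by (intro integral_mono) auto
    also have "\<dots> = e n * expectation (\<lambda>w. Z w^2) + expectation (\<lambda>w. (D n w)^2) / e n"
      using sq D2 by simp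
    also have "expectation (\<lambda>w. (D n w)^2) / e n \<le> e n"
    proof -
      have nn: "0 \<le> expectation (\<lambda>w. (D n w)^2)" by (intro Bochner_Integration.integral_nonneg) simp
      have "(sqrt (expectation (\<lambda>w. (D n w)^2)))^2 \<le> (e n)^2"
        unfolding e_def using nn by (intro power_mono) auto
      then show ?thesis using e[of n] nn by (simp add: field_simps power2_eq_square)
    qed
    finally have *: "\<bar>expectation (\<lambda>w. 2 * (Z w * D n w))\<bar> \<le> e n * expectation (\<lambda>w. Z w^2) + e n"
      by simp
    have "0 \<le> expectation (\<lambda>w. (D n w)^2)" by (intro Bochner_Integration.integral_nonneg) simp
    then have "\<bar>expectation (\<lambda>w. (D n w)^2) - expectation (\<lambda>w. 2 * (Z w * D n w))\<bar>
        \<le> e n * (expectation (\<lambda>w. Z w^2) + 1) + expectation (\<lambda>w. (D n w)^2)"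
      using * unfolding distrib_left by linarith
    then show "norm (expectation (\<lambda>w. X n w^2) - expectation (\<lambda>w. Z w^2))
        \<le> e n * (expectation (\<lambda>w. Z w^2) + 1) + expectation (\<lambda>w. (D n w)^2)"
      unfolding 1 by simp
  qed
  then show "(\<lambda>n. expectation (\<lambda>w. X n w^2)) \<longlonglongrightarrow> expectation (\<lambda>w. Z w^2)" by (simp add: LIM_zero_iff)
qed

end

subsection \<open>Limits and moments of independent variables\<close>

lemma closed_indicator_limit:
  fixes A :: "real set"
  assumes "closed A"
  obtains g :: "nat \<Rightarrow> real \<Rightarrow> real" where "\<And>m. continuous_on UNIV (g m)"
    "\<And>m x. 0 \<le> g m x" "\<And>m x. g m x \<le> 1" "\<And>x. (\<lambda>m. g m x) \<longlonglongrightarrow> indicator A x"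
\<comment> \<open>\<open>infdist\<close> to the empty set is \<open>0\<close>, so for empty
  \<open>A\<close> the formula used below would converge to \<open>1\<close> instead of
  \<open>0\<close>.\<close>
proof (cases "A = {}")
  case True
  show ?thesis by (rule that[of "\<lambda>_ _. 0"]) (auto simp: True)
next
  case False
  show ?thesis
  proof (rule that[of "\<lambda>m x. max 0 (1 - real m * infdist x A)"])
    fix x
    show "(\<lambda>m. max 0 (1 - real m * infdist x A)) \<longlonglongrightarrow> indicator A x"
    proof (cases "x \<in> A")
      case False
      then have d: "infdist x A > 0"
        using in_closed_iff_infdist_zero[OF assms \<open>A \<noteq> {}\<close>, of x] infdist_nonneg[of x A] by linarith
      have "\<forall>\<^sub>F m in sequentially. 1 / infdist x A < real m"
        using filterlim_real_sequentially by (simp add: filterlim_at_top_dense)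
      then have "\<forall>\<^sub>F m in sequentially. max 0 (1 - real m * infdist x A) = 0"
        by eventually_elim (use d in \<open>simp add: field_simps max_def\<close>)
      then show ?thesis using False by (simp add: tendsto_eventually)
    qed auto
  qed (auto intro!: continuous_intros simp: infdist_nonneg)
qed

context prob_space
begin

text \<open>The product formula survives almost sure limits for bounded continuous functions, by
  dominated convergence, but not directly for indicators. These are therefore approached by
  continuous functions in a second limit. Closed sets suffice, being an intersection-stable
  generator of the Borel sets.\<close>

lemma indep_vars_AE_limit:
  fixes X :: "nat \<Rightarrow> 'i \<Rightarrow> 'a \<Rightarrow> real"
  assumes indep: "\<And>n. indep_vars (\<lambda>_. borel) (X n) I"
    and Z: "\<And>i. i \<in> I \<Longrightarrow> Z i \<in> borel_measurable M"
    and lim: "\<And>i. i \<in> I \<Longrightarrow> AE w in M. (\<lambda>n. X n i w) \<longlonglongrightarrow> Z i w"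
  shows "indep_vars (\<lambda>_. borel) Z I"
proof -
  have X: "X n i \<in> borel_measurable M" if "i \<in> I" for n i
    using indep[of n] that by (auto simp: indep_vars_def)
  have fin: "indep_vars (\<lambda>_. borel) Z J" if J: "J \<subseteq> I" "J \<noteq> {}" "finite J" for J
  proof (subst indep_vars_finite[where E="\<lambda>_. Collect closed"])
    show "\<forall>A\<in>Pi J (\<lambda>_. Collect closed).
        prob (\<Inter>j\<in>J. Z j -` A j \<inter> space M) = (\<Prod>j\<in>J. prob (Z j -` A j \<inter> space M))"
    proof
      fix A :: "'i \<Rightarrow> real set" assume A: "A \<in> Pi J (\<lambda>_. Collect closed)"
      have "\<exists>g :: nat \<Rightarrow> real \<Rightarrow> real. (\<forall>m. continuous_on UNIV (g m)) \<and>
          (\<forall>m x. 0 \<le> g m x) \<and> (\<forall>m x. g m x \<le> 1) \<and> (\<forall>x. (\<lambda>m. g m x) \<longlonglongrightarrow> indicator (A j) x)"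
        if "j \<in> J" for j
        using closed_indicator_limit[of "A j"] A that by (smt (verit) Pi_mem mem_Collect_eq)
      then obtain g :: "'i \<Rightarrow> nat \<Rightarrow> real \<Rightarrow> real" where
        g: "\<And>j m. j \<in> J \<Longrightarrow> continuous_on UNIV (g j m)" "\<And>j m x. j \<in> J \<Longrightarrow> 0 \<le> g j m x"
          "\<And>j m x. j \<in> J \<Longrightarrow> g j m x \<le> 1" "\<And>j x. j \<in> J \<Longrightarrow> (\<lambda>m. g j m x) \<longlonglongrightarrow> indicator (A j) x"
        by metis
      have gm: "g j m \<in> borel_measurable borel" if "j \<in> J" for j m
        using g(1)[OF that] by (intro borel_measurable_continuous_onI) auto
      have XJ: "X n j \<in> borel_measurable M" "Z j \<in> borel_measurable M" if "j \<in> J" for n j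
        using X Z J that by auto
      have gX: "(\<lambda>w. g j m (X n j w)) \<in> borel_measurable M" "(\<lambda>w. g j m (Z j w)) \<in> borel_measurable M"
        if "j \<in> J" for j m n
        using XJ[OF that] gm[OF that] by measurable
      have bnd: "norm (\<Prod>j\<in>J. f j) \<le> 1" if "\<And>j. j \<in> J \<Longrightarrow> 0 \<le> f j \<and> f j \<le> 1" for f :: "'i \<Rightarrow> real"
        using that by (auto simp: abs_prod intro!: prod_le_1)
      have 1: "expectation (\<lambda>w. \<Prod>j\<in>J. g j m (X n j w)) = (\<Prod>j\<in>J. expectation (\<lambda>w. g j m (X n j w)))" for m n
      proof (rule indep_vars_lebesgue_integral[OF J(3)])
        show "indep_vars (\<lambda>_. borel) (\<lambda>j w. g j m (X n j w)) J"
          by (rule indep_vars_compose2[OF indep_vars_subset[OF indep J(1)]]) (rule gm)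
        show "integrable M (\<lambda>w. g j m (X n j w))" if "j \<in> J" for j
          using gX[OF that] g[OF that] by (intro integrable_const_bound[of _ 1]) auto
      qed
      have 2: "expectation (\<lambda>w. \<Prod>j\<in>J. g j m (Z j w)) = (\<Prod>j\<in>J. expectation (\<lambda>w. g j m (Z j w)))" for m
      proof -
        have l: "AE w in M. (\<lambda>n. g j m (X n j w)) \<longlonglongrightarrow> g j m (Z j w)" if "j \<in> J" for j
        proof -
          have cont: "isCont (g j m) x" for x
            using g(1)[OF that] by (simp add: continuous_on_eq_continuous_at)
          have "AE w in M. (\<lambda>n. X n j w) \<longlonglongrightarrow> Z j w" using lim that J(1) by auto
          then show ?thesis by eventually_elim (rule isCont_tendsto_compose[OF cont])
        qed
        have "AE w in M. \<forall>j\<in>J. (\<lambda>n. g j m (X n j w)) \<longlonglongrightarrow> g j m (Z j w)"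
          using l J(3) by (simp add: AE_finite_all)
        then have "AE w in M. (\<lambda>n. \<Prod>j\<in>J. g j m (X n j w)) \<longlonglongrightarrow> (\<Prod>j\<in>J. g j m (Z j w))"
          by eventually_elim (auto intro!: tendsto_prod)
        then have "(\<lambda>n. expectation (\<lambda>w. \<Prod>j\<in>J. g j m (X n j w))) \<longlonglongrightarrow> expectation (\<lambda>w. \<Prod>j\<in>J. g j m (Z j w))"
          using g bnd gX by (intro integral_dominated_convergence[where w="\<lambda>_. 1"]) (auto intro!: borel_measurable_prod)
        moreover have "(\<lambda>n. \<Prod>j\<in>J. expectation (\<lambda>w. g j m (X n j w))) \<longlonglongrightarrow> (\<Prod>j\<in>J. expectation (\<lambda>w. g j m (Z j w)))"
          using g l gX by (intro tendsto_prod integral_dominated_convergence[where w="\<lambda>_. 1"]) auto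
        ultimately show ?thesis unfolding 1 by (rule LIMSEQ_unique)
      qed
      have "(\<lambda>m. expectation (\<lambda>w. \<Prod>j\<in>J. g j m (Z j w))) \<longlonglongrightarrow> expectation (\<lambda>w. \<Prod>j\<in>J. indicat_real (A j) (Z j w))"
      proof (rule integral_dominated_convergence[where w="\<lambda>_. 1"])
        show "AE w in M. (\<lambda>m. \<Prod>j\<in>J. g j m (Z j w)) \<longlonglongrightarrow> (\<Prod>j\<in>J. indicat_real (A j) (Z j w))"
          by (intro AE_I2 tendsto_prod g(4))
        show "(\<lambda>w. \<Prod>j\<in>J. indicator (A j) (Z j w) :: real) \<in> borel_measurable M"
        proof (rule borel_measurable_prod)
          fix j assume "j \<in> J"
          then have "A j \<in> sets borel" using A by (auto intro: borel_closed)
          then show "(\<lambda>w. indicator (A j) (Z j w) :: real) \<in> borel_measurable M"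
            using XJ(2)[OF \<open>j \<in> J\<close>] by measurable
        qed
      qed (use g bnd gX in \<open>auto intro!: borel_measurable_prod\<close>)
      moreover have "(\<lambda>m. \<Prod>j\<in>J. expectation (\<lambda>w. g j m (Z j w))) \<longlonglongrightarrow> (\<Prod>j\<in>J. expectation (\<lambda>w. indicat_real (A j) (Z j w)))"
      proof (intro tendsto_prod integral_dominated_convergence[where w="\<lambda>_. 1"])
        fix j assume "j \<in> J"
        then have "A j \<in> sets borel" using A by (auto intro: borel_closed)
        then show "(\<lambda>w. indicator (A j) (Z j w) :: real) \<in> borel_measurable M"
          using XJ(2)[OF \<open>j \<in> J\<close>] by measurable
      qed (use g gX in auto)
      ultimately have "expectation (\<lambda>w. \<Prod>j\<in>J. indicat_real (A j) (Z j w)) = (\<Prod>j\<in>J. expectation (\<lambda>w. indicat_real (A j) (Z j w)))"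
        unfolding 2 by (rule LIMSEQ_unique)
      moreover have "expectation (\<lambda>w. indicat_real (A j) (Z j w)) = prob (Z j -` A j \<inter> space M)" if "j \<in> J" for j
      proof -
        have "expectation (\<lambda>w. indicat_real (A j) (Z j w)) = expectation (indicator (Z j -` A j \<inter> space M))"
          by (intro Bochner_Integration.integral_cong) (auto simp: indicator_def)
        then show ?thesis by simp
      qed
      moreover have "expectation (\<lambda>w. \<Prod>j\<in>J. indicat_real (A j) (Z j w)) = prob (\<Inter>j\<in>J. Z j -` A j \<inter> space M)"
      proof -
        have "(\<Prod>j\<in>J. indicator (A j) (Z j w) :: real) = indicator (\<Inter>j\<in>J. Z j -` A j \<inter> space M) w"
          if "w \<in> space M" for w
          using J that by (auto simp: indicator_def prod.If_cases intro!: prod.neutral)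
        then have "expectation (\<lambda>w. \<Prod>j\<in>J. indicat_real (A j) (Z j w)) = expectation (indicator (\<Inter>j\<in>J. Z j -` A j \<inter> space M))"
          by (intro Bochner_Integration.integral_cong) auto
        also have "\<dots> = prob (\<Inter>j\<in>J. Z j -` A j \<inter> space M)"
          using J by (simp add: Int_absorb2 subset_eq)
        finally show ?thesis .
      qed
      ultimately show "prob (\<Inter>j\<in>J. Z j -` A j \<inter> space M) = (\<Prod>j\<in>J. prob (Z j -` A j \<inter> space M))"
        by simp
    qed
  qed (use J Z in \<open>auto simp: Int_stable_def borel_eq_closed sets_measure_of_conv\<close>)
  show ?thesis
    unfolding indep_vars_def2
  proof (intro conjI ballI Z)
    show "indep_sets (\<lambda>i. {Z i -` A \<inter> space M |A. A \<in> sets borel}) I"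
      using fin by (subst indep_sets_finite_index_sets) (auto simp: indep_vars_def2)
  qed
qed

text \<open>When \<open>(X k + S)^4\<close> is expanded, the terms with an odd power have mean zero
  and \<open>6 * E X^2 * E S^2\<close> remains. Dropping it gives the lower bound; the upper bound
  absorbs it into the square of the sum of second moments, whence the factor \<open>3\<close>. The
  lower bound compares the fourth moment of an increment with those of its pieces, the upper one
  controls Riemann sums.\<close>

lemma indep_sum_power4:
  fixes X :: "'i \<Rightarrow> 'a \<Rightarrow> real"
  assumes "finite I" and "indep_vars (\<lambda>_. borel) X I"
    and "\<And>i. i \<in> I \<Longrightarrow> integrable M (\<lambda>w. X i w^4)"
    and "\<And>i. i \<in> I \<Longrightarrow> expectation (X i) = 0"
  shows "integrable M (\<lambda>w. (\<Sum>i\<in>I. X i w)^4)"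
    and "expectation (\<lambda>w. \<Sum>i\<in>I. X i w) = 0"
    and "expectation (\<lambda>w. (\<Sum>i\<in>I. X i w)^2) = (\<Sum>i\<in>I. expectation (\<lambda>w. X i w^2))"
    and "(\<Sum>i\<in>I. expectation (\<lambda>w. X i w^4)) \<le> expectation (\<lambda>w. (\<Sum>i\<in>I. X i w)^4)"
    and "expectation (\<lambda>w. (\<Sum>i\<in>I. X i w)^4)
      \<le> (\<Sum>i\<in>I. expectation (\<lambda>w. X i w^4)) + 3 * (\<Sum>i\<in>I. expectation (\<lambda>w. X i w^2))^2"
proof -
  have "integrable M (\<lambda>w. (\<Sum>i\<in>I. X i w)^4) \<and>
    expectation (\<lambda>w. \<Sum>i\<in>I. X i w) = 0 \<and>
    expectation (\<lambda>w. (\<Sum>i\<in>I. X i w)^2) = (\<Sum>i\<in>I. expectation (\<lambda>w. X i w^2)) \<and>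
    (\<Sum>i\<in>I. expectation (\<lambda>w. X i w^4)) \<le> expectation (\<lambda>w. (\<Sum>i\<in>I. X i w)^4) \<and>
    expectation (\<lambda>w. (\<Sum>i\<in>I. X i w)^4)
      \<le> (\<Sum>i\<in>I. expectation (\<lambda>w. X i w^4)) + 3 * (\<Sum>i\<in>I. expectation (\<lambda>w. X i w^2))^2"
    using assms
  proof (induction I rule: finite_induct)
    case (insert k I)
    define S where "S = (\<lambda>w. \<Sum>i\<in>I. X i w)"
    have IH: "integrable M (\<lambda>w. S w^4)" "expectation S = 0"
      "expectation (\<lambda>w. S w^2) = (\<Sum>i\<in>I. expectation (\<lambda>w. X i w^2))"
      "(\<Sum>i\<in>I. expectation (\<lambda>w. X i w^4)) \<le> expectation (\<lambda>w. S w^4)"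
      "expectation (\<lambda>w. S w^4)
        \<le> (\<Sum>i\<in>I. expectation (\<lambda>w. X i w^4)) + 3 * (\<Sum>i\<in>I. expectation (\<lambda>w. X i w^2))^2"
      using insert.IH[OF indep_vars_subset[OF insert.prems(1)]] insert.prems(2,3) by (auto simp: S_def)
    have rv: "X k \<in> borel_measurable M" "S \<in> borel_measurable M"
      using insert.prems(1) unfolding S_def by (auto simp: indep_vars_def intro!: borel_measurable_sum)
    note [measurable] = rv
    have ind: "indep_var borel (X k) borel S"
      unfolding S_def using insert by (intro indep_vars_sum) auto
    have int: "integrable M W \<and> integrable M (\<lambda>w. W w^2) \<and> integrable M (\<lambda>w. W w^3)"
      if [measurable]: "W \<in> borel_measurable M" and W: "integrable M (\<lambda>w. W w^4)" for W :: "'a \<Rightarrow> real"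
    proof -
      have W2: "integrable M (\<lambda>w. W w^2)" using integrable_power2_of_power4[OF that] .
      have "W w^3 = W w * W w^2" for w by (simp add: power3_eq_cube power2_eq_square)
      then show ?thesis
        using W W2 integrable_of_power2[OF that(1) W2] integrable_mult_of_power2[of W "\<lambda>w. W w^2"]
        by (simp flip: power_mult)
    qed
    note intX = int[OF rv(1) insert.prems(2)[of k]] and intS = int[OF rv(2) IH(1)]
    have prod: "integrable M (\<lambda>w. X k w^a * S w^b) \<and>
        expectation (\<lambda>w. X k w^a * S w^b) = expectation (\<lambda>w. X k w^a) * expectation (\<lambda>w. S w^b)"
      if "a \<in> {1,2,3}" "b \<in> {1,2,3}" for a b
    proof -
      have "indep_var borel ((\<lambda>x. x^a) \<circ> X k) borel ((\<lambda>x. x^b) \<circ> S)"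
        by (intro indep_var_compose[OF ind]) auto
      then have "indep_var borel (\<lambda>w. X k w^a) borel (\<lambda>w. S w^b)" by (simp add: comp_def)
      moreover have "integrable M (\<lambda>w. X k w^a)" "integrable M (\<lambda>w. S w^b)"
        using that intX intS by auto
      ultimately show ?thesis using indep_var_integrable indep_var_lebesgue_integral by blast
    qed
    have EX0: "expectation (X k) = 0" using insert.prems(3) by simp
    have X4: "integrable M (\<lambda>w. X k w^4)" using insert.prems(2) by simp
    have eq4: "(X k w + S w)^4 = X k w^4 + 4 * (X k w^3 * S w^1) + 6 * (X k w^2 * S w^2)
        + 4 * (X k w^1 * S w^3) + S w^4" for w
      by (simp add: power4_eq_xxxx power3_eq_cube power2_eq_square algebra_simps)
    have eq2: "(X k w + S w)^2 = X k w^2 + 2 * (X k w^1 * S w^1) + S w^2" for w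
      by (simp add: power2_sum)
    note P = prod[of 3 1, simplified] prod[of 2 2, simplified] prod[of 1 3, simplified] prod[of 1 1, simplified]
    have i4: "integrable M (\<lambda>w. (X k w + S w)^4)"
      unfolding eq4 using X4 IH(1) P by simp
    have e4: "expectation (\<lambda>w. (X k w + S w)^4) = expectation (\<lambda>w. X k w^4)
        + 6 * (expectation (\<lambda>w. X k w^2) * expectation (\<lambda>w. S w^2)) + expectation (\<lambda>w. S w^4)"
      unfolding eq4 using X4 IH(1) P EX0 IH(2) by simp
    have e2: "expectation (\<lambda>w. (X k w + S w)^2) = expectation (\<lambda>w. X k w^2) + expectation (\<lambda>w. S w^2)"
      unfolding eq2 using intX intS P EX0 IH(2) by simp
    have e1: "expectation (\<lambda>w. X k w + S w) = 0"
      using intX intS EX0 IH(2) by simp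
    have nn: "0 \<le> expectation (\<lambda>w. X k w^2)" "0 \<le> expectation (\<lambda>w. S w^2)"
      by (auto intro!: Bochner_Integration.integral_nonneg)
    have "(\<Sum>i\<in>insert k I. expectation (\<lambda>w. X i w^4)) \<le> expectation (\<lambda>w. (X k w + S w)^4)"
    proof -
      have "0 \<le> 6 * (expectation (\<lambda>w. X k w^2) * expectation (\<lambda>w. S w^2))" using nn by simp
      then show ?thesis using IH(4) unfolding e4 sum.insert[OF insert.hyps] by linarith
    qed
    moreover have "expectation (\<lambda>w. (X k w + S w)^4)
      \<le> (\<Sum>i\<in>insert k I. expectation (\<lambda>w. X i w^4)) + 3 * (\<Sum>i\<in>insert k I. expectation (\<lambda>w. X i w^2))^2"
    proof -
      have "0 \<le> 3 * (expectation (\<lambda>w. X k w^2))^2" by simp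
      then show ?thesis using IH(5) unfolding e4 IH(3) sum.insert[OF insert.hyps] power2_sum distrib_left
        by linarith
    qed
    ultimately show ?case
      using i4 e1 e2 IH(3) insert.hyps by (simp add: S_def)
  qed auto
  then show "integrable M (\<lambda>w. (\<Sum>i\<in>I. X i w)^4)"
    and "expectation (\<lambda>w. \<Sum>i\<in>I. X i w) = 0"
    and "expectation (\<lambda>w. (\<Sum>i\<in>I. X i w)^2) = (\<Sum>i\<in>I. expectation (\<lambda>w. X i w^2))"
    and "(\<Sum>i\<in>I. expectation (\<lambda>w. X i w^4)) \<le> expectation (\<lambda>w. (\<Sum>i\<in>I. X i w)^4)"
    and "expectation (\<lambda>w. (\<Sum>i\<in>I. X i w)^4)
      \<le> (\<Sum>i\<in>I. expectation (\<lambda>w. X i w^4)) + 3 * (\<Sum>i\<in>I. expectation (\<lambda>w. X i w^2))^2"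
    by blast+
qed

end

subsection \<open>Fourth moments from the Levy--Khintchine formula\<close>

lemma power4_add_le: "(x + y)^4 \<le> 8 * (x^4 + y^4)" for x y :: real
proof -
  have "(x + y)^2 \<le> 2 * (x^2 + y^2)" using sum_squares_bound[of x y] by (simp add: power2_sum)
  then have "((x + y)^2)^2 \<le> (2 * (x^2 + y^2))^2" by (intro power_mono) auto
  also have "\<dots> \<le> 4 * (2 * ((x^2)^2 + (y^2)^2))"
    using sum_squares_bound[of "x^2" "y^2"] by (simp add: power_mult_distrib power2_sum)
  finally show ?thesis by (simp flip: power_mult)
qed

text \<open>The right-hand side times \<open>1 + x + x^2 / 2\<close>, a lower bound of
  \<open>exp x\<close>, is \<open>1 + x^4 / 4\<close>.\<close>

lemma exp_minus_le_quadratic: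
  fixes x :: real
  assumes "0 \<le> x"
  shows "exp (- x) \<le> 1 - x + x^2 / 2"
proof -
  have "1 + x + x^2 / 2 \<le> exp x" by (rule exp_lower_Taylor_quadratic[OF assms])
  moreover have "1 \<le> (1 - x + x^2 / 2) * (1 + x + x^2 / 2)"
  proof -
    have "(1 - x + x^2 / 2) * (1 + x + x^2 / 2) = 1 + (x^2)^2 / 4"
      by (simp add: algebra_simps power2_eq_square)
    then show ?thesis by simp
  qed
  moreover have "0 \<le> 1 - x + x^2 / 2"
  proof -
    have "0 \<le> (x - 1)^2" by simp
    then show ?thesis by (simp add: power2_diff)
  qed
  ultimately have "1 \<le> (1 - x + x^2 / 2) * exp x"
    by (meson mult_left_mono order_trans)
  then show ?thesis by (simp add: exp_minus field_simps)
qed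

lemma power4_le_exp:
  fixes z :: real
  assumes "0 \<le> z"
  shows "z^4 \<le> 256 * exp z"
proof -
  have "z / 4 \<le> exp (z / 4)" using exp_ge_add_one_self[of "z/4"] by linarith
  then have "(z / 4)^4 \<le> exp (z / 4)^4" using assms by (intro power_mono) auto
  also have "exp (z / 4)^4 = exp z" by (simp flip: exp_of_nat_mult)
  finally show ?thesis by (simp add: power_divide)
qed

text \<open>This order is enough because the phase of the characteristic function will enter
  squared, and \<open>x^2\<close> is integrable with respect to the Levy measure.\<close>

lemma abs_sin_minus_le: "\<bar>sin x - x\<bar> \<le> x^2 / 2" for x :: real
proof -
  have "\<bar>Im (iexp x - (\<Sum>k\<le>1. (\<i> * x)^k / fact k))\<bar> \<le> \<bar>x\<bar>^(Suc 1) / fact (Suc 1)"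
    by (rule order_trans[OF abs_Im_le_cmod iexp_approx1])
  then show ?thesis by (simp add: Im_exp numeral_2_eq_2)
qed

lemma one_minus_cos_le: "1 - cos x \<le> x^2 / 2" for x :: real
proof -
  have "\<bar>Re (iexp x - (\<Sum>k\<le>1. (\<i> * x)^k / fact k))\<bar> \<le> \<bar>x\<bar>^(Suc 1) / fact (Suc 1)"
    by (rule order_trans[OF abs_Re_le_cmod iexp_approx1])
  then show ?thesis by (simp add: Re_exp numeral_2_eq_2)
qed

text \<open>The left-hand side is the fourth power of
  \<open>exp (i x / 2) - exp (- i x / 2)\<close>, so its expectation at \<open>x = h * X\<close> is
  a fourth central difference of the characteristic function at \<open>0\<close>.\<close>

lemma cos_fourth_difference: "(2 - 2 * cos x)^2 = 6 - 8 * cos x + 2 * cos (2 * x)" for x :: real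
  unfolding cos_double_cos by (simp add: power2_eq_square algebra_simps)

text \<open>Since \<open>2 - 2 * cos (h * y) = (2 * sin (h * y / 2))^2\<close>, the integrand
  divided by \<open>h^4\<close> tends to \<open>X^4\<close> as \<open>h\<close> tends to
  \<open>0\<close>, and Fatou's lemma applies along \<open>h = 1 / (n + 1)\<close>.\<close>

lemma (in prob_space) integrable_power4_of_cos:
  fixes X :: "'a \<Rightarrow> real"
  assumes [measurable]: "X \<in> borel_measurable M"
    and le: "\<And>h. 0 < h \<Longrightarrow> h \<le> 1 \<Longrightarrow> expectation (\<lambda>w. (2 - 2 * cos (h * X w))^2) \<le> C * h^4"
  shows "integrable M (\<lambda>w. X w^4)"
proof (rule expectation_AE_limit_le(1)[where f="\<lambda>n w. (2 - 2 * cos (inverse (real (Suc n)) * X w))^2 / inverse (real (Suc n))^4"])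
  have bnd: "(2 - 2 * cos x)^2 \<le> 4^2" for x :: real
  proof (intro power_mono)
    show "2 - 2 * cos x \<le> 4" using cos_ge_minus_one[of x] by linarith
  qed simp
  show int: "integrable M (\<lambda>w. (2 - 2 * cos (inverse (real (Suc n)) * X w))^2 / inverse (real (Suc n))^4)" for n
    by (intro integrable_divide integrable_const_bound[of _ "4^2"]) (use bnd in auto)
  show "\<forall>\<^sub>F n in sequentially. expectation (\<lambda>w. (2 - 2 * cos (inverse (real (Suc n)) * X w))^2 / inverse (real (Suc n))^4) \<le> C"
  proof (intro always_eventually allI)
    fix n
    have "expectation (\<lambda>w. (2 - 2 * cos (inverse (real (Suc n)) * X w))^2) \<le> C * inverse (real (Suc n))^4"
      by (rule le) (auto simp: field_simps)
    then show "expectation (\<lambda>w. (2 - 2 * cos (inverse (real (Suc n)) * X w))^2 / inverse (real (Suc n))^4) \<le> C"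
      by (simp add: divide_le_eq del: of_nat_Suc)
  qed
  have "(\<lambda>n. (2 - 2 * cos (inverse (real (Suc n)) * y))^2 / inverse (real (Suc n))^4) \<longlonglongrightarrow> y^4" for y :: real
  proof -
    have "((\<lambda>h. sin (h * (y / 2))) has_field_derivative y / 2) (at 0)"
      by (auto intro!: derivative_eq_intros)
    then have d: "((\<lambda>h. sin (h * (y / 2)) / h) \<longlongrightarrow> y / 2) (at 0)"
      by (simp add: DERIV_def)
    have "filterlim (\<lambda>n. inverse (real (Suc n))) (at 0) sequentially"
      using LIMSEQ_inverse_real_of_nat by (auto simp: filterlim_at intro!: always_eventually)
    then have "(\<lambda>n. (2 * (sin (inverse (real (Suc n)) * (y / 2)) / inverse (real (Suc n))))^4) \<longlonglongrightarrow> (2 * (y / 2))^4"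
      by (rule tendsto_power[OF tendsto_mult_left[OF filterlim_compose[OF d]]])
    moreover have "(2 * (sin (h * (y / 2)) / h))^4 = (2 - 2 * cos (h * y))^2 / h^4" for h :: real
    proof -
      have "cos (h * y) = 1 - 2 * sin (h * (y / 2))^2" using cos_double_sin[of "h * (y / 2)"] by simp
      then have "(2 - 2 * cos (h * y))^2 = (2 * sin (h * (y / 2)))^4"
        by (simp add: power_mult_distrib flip: power_mult)
      then show ?thesis by (simp add: power_divide)
    qed
    ultimately show ?thesis by simp
  qed
  then show "AE w in M. (\<lambda>n. (2 - 2 * cos (inverse (real (Suc n)) * X w))^2 / inverse (real (Suc n))^4) \<longlonglongrightarrow> X w^4"
    by simp
qed auto

lemma levy_measure_integrable_powers:
  assumes F: "sets F = sets borel" "(\<integral>\<^sup>+x. ennreal (min 1 (x\<^sup>2)) \<partial>F) < \<infinity>"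
    and K: "K > 0"
    and exp_moments: "\<And>v::real. \<bar>v\<bar> \<le> K \<Longrightarrow> (\<integral>\<^sup>+x\<in>{x. \<bar>x\<bar> > 1}. ennreal (exp (v * x)) \<partial>F) < \<infinity>"
  shows "integrable F (\<lambda>x. x^4)" and "integrable F (\<lambda>x. x^2)"
proof -
  have [measurable_cong]: "sets F = sets borel" by (rule F)
  \<comment> \<open>\<open>power4_le_exp\<close> at \<open>K * |x|\<close> gives
    \<open>x^4 \<le> c * exp (K * |x|)\<close>. In \<open>B\<close> the exponentials of both signs
    are added to dominate the one with \<open>|x|\<close>, and \<open>min 1 (x^2)\<close> takes over
    for \<open>|x| \<le> 1\<close>.\<close>
  define c where "c = 256 / K^4"
  have c: "c > 0" using K by (simp add: c_def)
  define B where "B = (\<lambda>x::real. min 1 (x^2) + c * (exp (K * x) * indicator {x. \<bar>x\<bar> > 1} x + exp (- K * x) * indicator {x. \<bar>x\<bar> > 1} x))"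
  have [measurable]: "B \<in> borel_measurable F" by (simp add: B_def)
  have B0: "0 \<le> B x" for x using c by (auto simp: B_def)
  have "(\<integral>\<^sup>+x. ennreal (B x) \<partial>F) = (\<integral>\<^sup>+x. ennreal (min 1 (x^2)) + ennreal c *
      (ennreal (exp (K * x)) * indicator {x. \<bar>x\<bar> > 1} x + ennreal (exp (- K * x)) * indicator {x. \<bar>x\<bar> > 1} x) \<partial>F)"
    using c by (intro nn_integral_cong) (simp add: B_def indicator_def ennreal_plus ennreal_mult)
  also have "\<dots> = (\<integral>\<^sup>+x. ennreal (min 1 (x^2)) \<partial>F) + ennreal c * ((\<integral>\<^sup>+x\<in>{x. \<bar>x\<bar> > 1}. ennreal (exp (K * x)) \<partial>F)
      + (\<integral>\<^sup>+x\<in>{x. \<bar>x\<bar> > 1}. ennreal (exp (- K * x)) \<partial>F))"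
    by (simp add: nn_integral_add nn_integral_cmult)
  also have "\<dots> < \<infinity>"
    using F(2) exp_moments[of K] exp_moments[of "- K"] K by (simp add: ennreal_mult_less_top)
  finally have B: "integrable F B" using B0 by (intro integrableI_bounded) auto
  have le: "x^4 \<le> B x \<and> x^2 \<le> B x" for x
  proof (cases "\<bar>x\<bar> \<le> 1")
    case True
    then have x2: "x^2 \<le> 1" by (simp add: abs_square_le_1)
    then have "x^2 * x^2 \<le> x^2 * 1" by (intro mult_left_mono) auto
    then have "x^4 \<le> x^2" by (simp flip: power_add)
    then show ?thesis using True x2 by (simp add: B_def)
  next
    case False
    have "(K * \<bar>x\<bar>)^4 \<le> 256 * exp (K * \<bar>x\<bar>)" using K by (intro power4_le_exp) auto
    then have "x^4 \<le> c * exp (K * \<bar>x\<bar>)" using K by (simp add: c_def power_mult_distrib field_simps)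
    also have "\<dots> \<le> c * (exp (K * x) + exp (- K * x))"
      using c by (intro mult_left_mono) (auto simp: abs_if)
    also have "\<dots> \<le> B x" using False by (simp add: B_def)
    finally have 4: "x^4 \<le> B x" .
    have x2: "1 \<le> x^2" using False abs_square_le_1[of x] by linarith
    then have "x^2 * 1 \<le> x^2 * x^2" by (intro mult_left_mono) auto
    then have "x^2 \<le> x^4" by (simp flip: power_add)
    then show ?thesis using 4 by simp
  qed
  show "integrable F (\<lambda>x. x^4)" "integrable F (\<lambda>x. x^2)"
    using le by (auto intro!: Bochner_Integration.integrable_bound[OF B] simp: B0)
qed

text \<open>The variable is centred at \<open>\<beta>\<close> so that the imaginary part \<open>t * J u\<close> of its cumulant is \<open>O(u\<^sup>2)\<close>;
  the real part \<open>- t * \<kappa> u\<close> satisfies \<open>\<kappa> (2 * h) = 4 * \<kappa> h + O(h\<^sup>4)\<close>, which makes the fourth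
  difference \<open>6 - 8 * E cos (h * Y) + 2 * E cos (2 * h * Y)\<close> of order \<open>h\<^sup>4\<close>.\<close>

lemma levy_power4_integrable:
  fixes L :: "real \<Rightarrow> 'a \<Rightarrow> real"
  assumes L: "levy_process M L" and F: "levy_measure M L F" and K: "K > 0"
    and exp_moments: "\<And>v::real. \<bar>v\<bar> \<le> K \<Longrightarrow> (\<integral>\<^sup>+x\<in>{x. \<bar>x\<bar> > 1}. ennreal (exp (v * x)) \<partial>F) < \<infinity>"
    and t: "t \<ge> 0"
  shows "integrable M (\<lambda>w. L t w^4)"
proof -
  interpret prob_space M using L by (simp add: levy_process_def)
  have X[measurable]: "L t \<in> borel_measurable M" using L t by (simp add: levy_process_def)
  have setsF[measurable_cong]: "sets F = sets borel" using F by (simp add: levy_measure_def)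
  have min: "(\<integral>\<^sup>+x. ennreal (min 1 (x\<^sup>2)) \<partial>F) < \<infinity>" using F by (simp add: levy_measure_def)
  obtain b a where a: "0 \<le> a" and chr: "\<And>u. char (distr M borel (L t)) u =
          exp (of_real t * (\<i> * of_real (b * u) - of_real (a * u\<^sup>2 / 2) +
             (CLINT x|F. exp (\<i> * of_real (u * x)) - 1 - \<i> * of_real (u * x * indicator {-1..1} x))))"
    using F t unfolding levy_measure_def by blast
  note F4 = levy_measure_integrable_powers[OF setsF min K exp_moments]
  have tail: "integrable F (\<lambda>x. x * indicator {x. \<bar>x\<bar> > 1} x)"
  proof (rule Bochner_Integration.integrable_bound[OF F4(2)])
    have "\<bar>x\<bar> \<le> x^2" if "1 < \<bar>x\<bar>" for x :: real
      using mult_left_mono[of 1 "\<bar>x\<bar>" "\<bar>x\<bar>"] that by (simp add: power2_eq_square)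
    then show "AE x in F. norm (x * indicator {x. \<bar>x\<bar> > 1} x) \<le> norm (x^2)"
      by (auto simp: indicator_def)
    have "(\<lambda>x::real. x * indicator {x. \<bar>x\<bar> > 1} x) \<in> borel_measurable borel" by measurable
    then show "(\<lambda>x. x * indicator {x. \<bar>x\<bar> > 1} x) \<in> borel_measurable F"
      using measurable_cong_sets[OF setsF refl] by blast
  qed
  \<comment> \<open>Large jumps have a finite first moment, so the compensator \<open>u * x\<close>
    can be used on the whole line instead of on \<open>[-1, 1]\<close>. The difference is a drift
    \<open>m\<close>, the integral of \<open>x\<close> over \<open>|x| > 1\<close>, and the new
    integrand \<open>k u\<close> is of order \<open>u^2\<close>.\<close>
  define k where "k = (\<lambda>u x::real. iexp (u * x) - 1 - \<i> * of_real (u * x))"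
  have kle: "cmod (k u x) \<le> u^2 * x^2 / 2" for u x
  proof -
    have "k u x = iexp (u * x) - (\<Sum>j\<le>1. (\<i> * of_real (u * x))^j / fact j)" by (simp add: k_def)
    then have "cmod (k u x) \<le> \<bar>u * x\<bar>^(Suc 1) / fact (Suc 1)" by (simp only: iexp_approx1)
    also have "\<dots> = u^2 * x^2 / 2" by (simp add: power2_eq_square algebra_simps)
    finally show ?thesis .
  qed
  have kint: "integrable F (k u)" for u
  proof (rule Bochner_Integration.integrable_bound)
    show "integrable F (\<lambda>x. u^2 * x^2 / 2)" using F4(2) by simp
    show "k u \<in> borel_measurable F" unfolding k_def by measurable
    have "norm (u^2 * x^2 / 2) = u^2 * x^2 / 2" for x :: real by simp
    then show "AE x in F. norm (k u x) \<le> norm (u^2 * x^2 / 2)" using kle[of u] by (simp only: AE_I2)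
  qed
  have Rek: "Re (k u x) = - (1 - cos (u * x))" and Imk: "Im (k u x) = sin (u * x) - u * x" for u x
    by (auto simp: k_def Re_exp Im_exp)
  define \<kappa> where "\<kappa> = (\<lambda>u. a * u^2 / 2 + (\<integral>x. 1 - cos (u * x) \<partial>F))"
  define J where "J = (\<lambda>u. \<integral>x. sin (u * x) - u * x \<partial>F)"
  have cosint: "integrable F (\<lambda>x. 1 - cos (u * x))" for u
    using integrable_minus[OF integrable_Re[OF kint[of u]]] by (simp add: Rek)
  have sinint: "integrable F (\<lambda>x. sin (u * x) - u * x)" for u
    using integrable_Im[OF kint[of u]] by (simp add: Imk)
  have intk: "(CLINT x|F. k u x) = Complex (- (\<integral>x. 1 - cos (u * x) \<partial>F)) (J u)" for u
  proof (rule complex_eqI)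
    show "Re (CLINT x|F. k u x) = Re (Complex (- (\<integral>x. 1 - cos (u * x) \<partial>F)) (J u))"
      using integral_Re[OF kint[of u]] by (simp add: Rek cosint flip: Bochner_Integration.integral_minus)
    show "Im (CLINT x|F. k u x) = Im (Complex (- (\<integral>x. 1 - cos (u * x) \<partial>F)) (J u))"
      using integral_Im[OF kint[of u]] by (simp add: Imk J_def)
  qed
  define m where "m = (\<integral>x. x * indicator {x. \<bar>x\<bar> > 1} x \<partial>F)"
  define \<beta> where "\<beta> = t * (b + m)"
  have cl: "(CLINT x|F. exp (\<i> * of_real (u * x)) - 1 - \<i> * of_real (u * x * indicator {-1..1} x))
      = (CLINT x|F. k u x) + \<i> * of_real (u * m)" for u
  proof -
    have "(CLINT x|F. exp (\<i> * of_real (u * x)) - 1 - \<i> * of_real (u * x * indicator {-1..1} x))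
      = (CLINT x|F. k u x + \<i> * of_real u * of_real (x * indicator {x. \<bar>x\<bar> > 1} x))"
      by (intro Bochner_Integration.integral_cong) (auto simp: k_def indicator_def)
    also have "\<dots> = (CLINT x|F. k u x) + \<i> * of_real u * of_real m"
    proof -
      have tc: "integrable F (\<lambda>x. complex_of_real (x * indicator {x. \<bar>x\<bar> > 1} x))"
        using tail by (rule integrable_of_real)
      have "(CLINT x|F. \<i> * of_real u * of_real (x * indicator {x. \<bar>x\<bar> > 1} x)) = \<i> * of_real u * of_real m"
        unfolding m_def integral_mult_right_zero integral_complex_of_real by (rule refl)
      then show ?thesis
        by (subst Bochner_Integration.integral_add[OF kint integrable_mult_right[OF tc]]) (rule arg_cong2[of _ _ _ _ "(+)", OF refl])
    qed
    finally show ?thesis by (simp add: mult.assoc)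
  qed
  define Y where "Y = (\<lambda>w. L t w - \<beta>)"
  have [measurable]: "Y \<in> borel_measurable M" by (simp add: Y_def)
  have Ecos: "expectation (\<lambda>w. cos (u * Y w)) = exp (- t * \<kappa> u) * cos (t * J u)" for u
  proof -
    have "(CLINT w|M. iexp (u * Y w)) = (CLINT w|M. iexp (- u * \<beta>) * iexp (u * L t w))"
      by (intro Bochner_Integration.integral_cong) (auto simp: Y_def algebra_simps simp flip: exp_add)
    also have "\<dots> = iexp (- u * \<beta>) * char (distr M borel (L t)) u"
      by (simp add: char_def integral_distr)
    also have "\<dots> = exp (Complex (- t * \<kappa> u) (t * J u))"
      unfolding chr cl intk exp_add[symmetric]
      by (rule arg_cong[where f=exp]) (auto simp: complex_eq_iff \<beta>_def \<kappa>_def algebra_simps)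
    finally have eq: "(CLINT w|M. iexp (u * Y w)) = exp (Complex (- t * \<kappa> u) (t * J u))" .
    have "integrable M (\<lambda>w. iexp (u * Y w))" by (rule integrable_const_bound[of _ 1]) auto
    from integral_Re[OF this] show ?thesis unfolding eq by (simp add: Re_exp)
  qed
  define c2 c4 where "c2 = (\<integral>x. x^2 \<partial>F)" and "c4 = (\<integral>x. x^4 \<partial>F)"
  have c0: "0 \<le> c2" "0 \<le> c4" by (auto simp: c2_def c4_def)
  \<comment> \<open>The three summands come from \<open>16 * s^2\<close>,
    \<open>4 * (t * J h)^2\<close> and \<open>2 * z * exp (t * c4 / 2)\<close>. These are what is
    left of the fourth difference once the constants \<open>6 - 8 + 2\<close> and the terms linear
    in \<open>s\<close> have cancelled.\<close>
  define C where "C = 16 * (t * (a + c2) / 2)^2 + 4 * (t * c2 / 2)^2 + t * c4 * exp (t * c4 / 2)"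
  have "integrable M (\<lambda>w. Y w^4)"
  proof (rule integrable_power4_of_cos)
    fix h :: real assume h: "0 < h" "h \<le> 1"
    define s where "s = t * \<kappa> h"
    define z where "z = t * c4 * h^4 / 2"
    have s0: "0 \<le> s"
      unfolding s_def \<kappa>_def using t a cosint[of h]
      by (intro mult_nonneg_nonneg add_nonneg_nonneg Bochner_Integration.integral_nonneg) auto
    have hx: "(h * x)^2 / 2 = h^2 / 2 * x^2" for x by (simp add: power_mult_distrib)
    have "(\<integral>x. 1 - cos (h * x) \<partial>F) \<le> (\<integral>x. h^2 / 2 * x^2 \<partial>F)"
      by (intro integral_mono cosint integrable_mult_right F4(2) one_minus_cos_le[of "h * x" for x, unfolded hx])
    then have "\<kappa> h \<le> (a + c2) / 2 * h^2" by (simp add: \<kappa>_def c2_def field_simps)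
    then have s1: "s \<le> t * (a + c2) / 2 * h^2" unfolding s_def using t by (metis mult.assoc mult_left_mono times_divide_eq_right)
    have "\<bar>J h\<bar> \<le> (\<integral>x. \<bar>sin (h * x) - h * x\<bar> \<partial>F)" unfolding J_def by (rule integral_abs_bound)
    also have "\<dots> \<le> (\<integral>x. h^2 / 2 * x^2 \<partial>F)"
      by (intro integral_mono integrable_abs sinint integrable_mult_right F4(2) abs_sin_minus_le[of "h * x" for x, unfolded hx])
    finally have "\<bar>J h\<bar> \<le> c2 / 2 * h^2" by (simp add: c2_def field_simps)
    then have "\<bar>t * J h\<bar> \<le> t * c2 / 2 * h^2" unfolding abs_mult using t by (metis abs_of_nonneg mult.assoc mult_left_mono times_divide_eq_right)
    then have J1: "(t * J h)^2 \<le> (t * c2 / 2 * h^2)^2" by (metis abs_ge_zero power2_abs power_mono)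
    \<comment> \<open>In \<open>4 * \<kappa> h - \<kappa> (2 * h)\<close> the Gaussian part cancels,
      and the jump part becomes the integral of \<open>2 * (1 - cos (h * x))^2\<close>, which is of
      fourth order in \<open>h\<close>.\<close>
    have "4 * (\<integral>x. 1 - cos (h * x) \<partial>F) - (\<integral>x. 1 - cos (2 * h * x) \<partial>F)
        = (\<integral>x. 4 * (1 - cos (h * x)) - (1 - cos (2 * h * x)) \<partial>F)"
      unfolding Bochner_Integration.integral_diff[OF integrable_mult_right[OF cosint] cosint]
        integral_mult_right_zero by (rule refl)
    also have "\<dots> \<le> (\<integral>x. h^4 / 2 * x^4 \<partial>F)"
    proof (intro integral_mono integrable_mult_right F4(1))
      fix x
      have "4 * (1 - cos (h * x)) - (1 - cos (2 * h * x)) = 2 * (1 - cos (h * x))^2"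
        using cos_double_cos[of "h * x"] by (simp add: power2_eq_square algebra_simps)
      also have "\<dots> \<le> 2 * ((h * x)^2 / 2)^2"
        using one_minus_cos_le[of "h * x"] by (intro mult_left_mono power_mono) auto
      also have "\<dots> = h^4 / 2 * x^4"
        by (simp add: power_mult_distrib power_divide flip: power_mult)
      finally show "4 * (1 - cos (h * x)) - (1 - cos (2 * h * x)) \<le> h^4 / 2 * x^4" .
    qed (intro Bochner_Integration.integrable_diff integrable_mult_right cosint)
    finally have "4 * \<kappa> h - \<kappa> (2 * h) \<le> c4 * h^4 / 2"
      by (simp add: \<kappa>_def c4_def power_mult_distrib mult.commute)
    then have "t * (4 * \<kappa> h - \<kappa> (2 * h)) \<le> t * (c4 * h^4 / 2)" using t by (rule mult_left_mono)
    then have k2: "- t * \<kappa> (2 * h) \<le> - (4 * s) + z" by (simp add: s_def z_def algebra_simps)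
    \<comment> \<open>Here \<open>h \<le> 1\<close> is what bounds \<open>exp z\<close> uniformly in
      \<open>h\<close>, so that \<open>exp z\<close> exceeds \<open>1\<close> by at most a constant
      times \<open>h^4\<close>.\<close>
    have h4: "h^4 \<le> 1" using h by (simp add: power_le_one)
    have z0: "0 \<le> z" using t c0 by (simp add: z_def)
    have z1: "z \<le> t * c4 / 2"
      using mult_left_mono[OF h4, of "t * c4 / 2"] t c0 by (simp add: z_def)
    have "1 - z \<le> exp (- z)" using exp_ge_add_one_self[of "- z"] by simp
    then have "exp z * (1 - z) \<le> exp z * exp (- z)" by (intro mult_left_mono) auto
    then have "exp z \<le> 1 + z * exp z" by (simp add: algebra_simps flip: exp_add)
    also have "\<dots> \<le> 1 + z * exp (t * c4 / 2)" using z0 z1 by (intro add_left_mono mult_left_mono) auto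
    finally have ez: "exp z \<le> 1 + z * exp (t * c4 / 2)" .
    have "expectation (\<lambda>w. cos (2 * h * Y w)) \<le> exp (- t * \<kappa> (2 * h)) * 1"
      unfolding Ecos by (intro mult_left_mono) auto
    also have "\<dots> \<le> exp (- (4 * s)) * exp z" using k2 by (simp flip: exp_add)
    also have "\<dots> \<le> exp (- (4 * s)) * (1 + z * exp (t * c4 / 2))" using ez by (intro mult_left_mono) auto
    also have "\<dots> = exp (- (4 * s)) + exp (- (4 * s)) * (z * exp (t * c4 / 2))" by (simp add: algebra_simps)
    also have "\<dots> \<le> exp (- (4 * s)) + 1 * (z * exp (t * c4 / 2))"
      using s0 z0 by (intro add_left_mono mult_right_mono) auto
    also have "exp (- (4 * s)) \<le> 1 - 4 * s + (4 * s)^2 / 2" using s0 by (intro exp_minus_le_quadratic) auto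
    finally have E2: "expectation (\<lambda>w. cos (2 * h * Y w)) \<le> 1 - 4 * s + 8 * s^2 + z * exp (t * c4 / 2)"
      by (simp add: power_mult_distrib)
    \<comment> \<open>At \<open>2 * h\<close> an upper bound was wanted, where the cosine of the
      phase is simply at most \<open>1\<close>. At \<open>h\<close> a lower bound is wanted, and the
      phase costs \<open>(t * J h)^2 / 2\<close>, of order \<open>h^4\<close> because
      \<open>J h\<close> is of order \<open>h^2\<close>.\<close>
    have "exp (- s) * (1 - cos (t * J h)) \<le> 1 * ((t * J h)^2 / 2)"
      using s0 one_minus_cos_le[of "t * J h"] by (intro mult_mono) auto
    moreover have "1 - s \<le> exp (- s)" using exp_ge_add_one_self[of "- s"] by simp
    ultimately have E1: "1 - s - (t * J h)^2 / 2 \<le> expectation (\<lambda>w. cos (h * Y w))"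
      unfolding Ecos by (simp add: s_def algebra_simps)
    have ci: "integrable M (\<lambda>w. cos (u * Y w))" for u by (rule integrable_const_bound[of _ 1]) auto
    have "expectation (\<lambda>w. (2 - 2 * cos (h * Y w))^2)
        = expectation (\<lambda>w. 6 - 8 * cos (h * Y w) + 2 * cos (2 * h * Y w))"
      by (simp add: cos_fourth_difference mult.assoc)
    also have "\<dots> = 6 - 8 * expectation (\<lambda>w. cos (h * Y w)) + 2 * expectation (\<lambda>w. cos (2 * h * Y w))"
      using ci[of h] ci[of "2 * h"] by (simp add: prob_space)
    also have "\<dots> \<le> 16 * s^2 + 4 * (t * J h)^2 + 2 * z * exp (t * c4 / 2)"
      using E1 E2 by simp
    also have "\<dots> \<le> 16 * (t * (a + c2) / 2 * h^2)^2 + 4 * (t * c2 / 2 * h^2)^2 + 2 * z * exp (t * c4 / 2)"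
      using power_mono[OF s1 s0, of 2] J1 by linarith
    also have "\<dots> = C * h^4"
    proof -
      have "(q * h^2)^2 = q^2 * h^4" for q by (simp add: power_mult_distrib flip: power_mult)
      from this[of "t * (a + c2) / 2"] this[of "t * c2 / 2"] show ?thesis
        unfolding C_def z_def distrib_right by simp
    qed
    finally show "expectation (\<lambda>w. (2 - 2 * cos (h * Y w))^2) \<le> C * h^4" .
  qed simp
  then have "integrable M (\<lambda>w. 8 * (Y w^4 + \<beta>^4))" by simp
  then show ?thesis
  proof (rule Bochner_Integration.integrable_bound)
    from power4_add_le[of "Y w" \<beta> for w]
    show "AE w in M. norm (L t w^4) \<le> norm (8 * (Y w^4 + \<beta>^4))"
      by (simp add: Y_def)
  qed simp
qed

subsection \<open>Moments of Levy increments\<close>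

lemma additive_of_nat_mult:
  fixes g :: "real \<Rightarrow> real"
  assumes add: "\<And>s t. 0 \<le> s \<Longrightarrow> 0 \<le> t \<Longrightarrow> g (s + t) = g s + g t" and "0 \<le> x"
  shows "g (real k * x) = real k * g x"
proof (induction k)
  case 0
  show ?case using add[of 0 0] by simp
next
  case (Suc k)
  have "g (real (Suc k) * x) = g (real k * x + x)" by (simp add: algebra_simps)
  also have "\<dots> = g (real k * x) + g x" using assms(2) by (intro add) auto
  finally show ?case using Suc by (simp add: algebra_simps)
qed

text \<open>The defect \<open>f x = g x - x * g 1\<close> is additive and vanishes at
  \<open>1\<close>, hence at all multiples of \<open>1 / (n + 1)\<close>. Subtracting the largest
  such multiple below \<open>t\<close> does not change its value, so a nonzero \<open>f t\<close>
  would be attained at arbitrarily small arguments, against the limit at \<open>0\<close>.\<close>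

lemma additive_linear:
  fixes g :: "real \<Rightarrow> real"
  assumes add: "\<And>s t. 0 \<le> s \<Longrightarrow> 0 \<le> t \<Longrightarrow> g (s + t) = g s + g t"
    and lim: "(g \<longlongrightarrow> 0) (at_right 0)" and t: "0 \<le> t"
  shows "g t = t * g 1"
proof (rule ccontr)
  define f where "f = (\<lambda>x. g x - x * g 1)"
  assume "g t \<noteq> t * g 1"
  then have e: "\<bar>f t\<bar> > 0" by (simp add: f_def)
  have fadd: "f (s + t) = f s + f t" if "0 \<le> s" "0 \<le> t" for s t
    using add[OF that] by (simp add: f_def algebra_simps)
  have "((\<lambda>x. g x - x * g 1) \<longlongrightarrow> 0 - 0 * g 1) (at_right 0)"
    by (intro tendsto_intros lim)
  then have "\<forall>\<^sub>F y in at_right 0. \<bar>f y\<bar> < \<bar>f t\<bar>"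
    using order_tendstoD(2)[OF tendsto_rabs, of f 0 "at_right 0" "\<bar>f t\<bar>"] e by (simp add: f_def)
  then obtain b where b: "b > 0" "\<And>y. 0 < y \<Longrightarrow> y < b \<Longrightarrow> \<bar>f y\<bar> < \<bar>f t\<bar>"
    by (auto simp: eventually_at_right_field)
  obtain n where n: "inverse (real (Suc n)) < b" using reals_Archimedean[OF b(1)] by auto
  define k where "k = nat \<lfloor>t * real (Suc n)\<rfloor>"
  have k: "real k \<le> t * real (Suc n)" "t * real (Suc n) < real k + 1"
    using t by (auto simp: k_def of_nat_nat)
  define y where "y = t - real k * inverse (real (Suc n))"
  have y: "0 \<le> y" "y < b"
    using k n by (auto simp: y_def field_simps)
  have "f (real (Suc n) * inverse (real (Suc n))) = real (Suc n) * f (inverse (real (Suc n)))"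
    by (intro additive_of_nat_mult fadd) auto
  then have "f (inverse (real (Suc n))) = 0" by (simp add: f_def)
  then have "f (real k * inverse (real (Suc n))) = 0"
    using additive_of_nat_mult[of f, OF fadd, of "inverse (real (Suc n))" k] by simp
  moreover have "f t = f (real k * inverse (real (Suc n))) + f y"
    using fadd[of "real k * inverse (real (Suc n))" y] y by (simp add: y_def)
  ultimately have "f t = f y" by simp
  moreover have "f 0 = 0" using fadd[of 0 0] by simp
  ultimately show False using b(2)[of y] y e by (cases "y = 0") auto
qed

text \<open>Nonnegativity makes \<open>g\<close> monotone, so \<open>n * g y \<le> g 1\<close> as
  soon as \<open>n * y \<le> 1\<close>, and continuity at \<open>0\<close> follows. Variances fall
  under this lemma; means have no fixed sign and need stochastic continuity.\<close>

lemma additive_nonneg_linear: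
  fixes g :: "real \<Rightarrow> real"
  assumes add: "\<And>s t. 0 \<le> s \<Longrightarrow> 0 \<le> t \<Longrightarrow> g (s + t) = g s + g t"
    and nn: "\<And>t. 0 \<le> t \<Longrightarrow> 0 \<le> g t" and t: "0 \<le> t"
  shows "g t = t * g 1"
proof (rule additive_linear[OF add _ t])
  have le: "real n * g y \<le> g 1" if "0 \<le> y" "real n * y \<le> 1" for n y
    using add[of "real n * y" "1 - real n * y"] nn[of "1 - real n * y"] that
      additive_of_nat_mult[of g, OF add, of y n] by simp
  show "(g \<longlongrightarrow> 0) (at_right 0)"
  proof (rule tendstoI)
    fix e :: real assume "0 < e"
    obtain n where n1: "g 1 < real n * e"
      using reals_Archimedean3[OF \<open>0 < e\<close>] by blast
    with nn[of 1] have n: "g 1 < real n * e" "n > 0" by (cases n, auto)+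
    have "\<bar>g y\<bar> < e" if y: "0 < y" "y < 1 / real n" for y
    proof -
      have "real n * g y \<le> g 1" using y n by (intro le) (auto simp: field_simps)
      then have "real n * g y < real n * e" using n(1) by (rule order_le_less_trans)
      then have "g y < e" by (rule mult_left_less_imp_less) simp
      then show ?thesis using nn[of y] y by simp
    qed
    then show "\<forall>\<^sub>F y in at_right 0. dist (g y) 0 < e"
      unfolding eventually_at_right_field using n by (intro exI[of _ "1 / real n"]) auto
  qed
qed

text \<open>The interface between the two halves of the argument: the Levy measure and the
  characteristic function do not appear from here to the final theorem, only their consequence for
  fourth moments.\<close>

locale levy_power4 = prob_space M for M :: "'a measure" +
  fixes L :: "real \<Rightarrow> 'a \<Rightarrow> real"
  assumes levy: "levy_process M L"
    and L4: "\<And>t. 0 \<le> t \<Longrightarrow> integrable M (\<lambda>w. L t w^4)"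
begin

lemma L_measurable[measurable]: "0 \<le> t \<Longrightarrow> L t \<in> borel_measurable M"
  using levy by (simp add: levy_process_def)

lemma L_0: "AE w in M. L 0 w = 0"
  using levy by (simp add: levy_process_def)

lemma L_integrable_power2: "0 \<le> t \<Longrightarrow> integrable M (\<lambda>w. L t w^2)"
  by (rule integrable_power2_of_power4[OF L_measurable L4])

lemma L_integrable: "0 \<le> t \<Longrightarrow> integrable M (L t)"
  by (rule integrable_of_power2[OF L_measurable L_integrable_power2])

lemma incr_distr:
  assumes "0 \<le> s" "s \<le> t"
  shows "distr M borel (\<lambda>w. L t w - L s w) = distr M borel (L (t - s))"
proof -
  have "\<forall>s\<ge>0. \<forall>t\<ge>0. distr M borel (\<lambda>w. L (s + t) w - L s w) = distr M borel (L t)"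
    using levy unfolding levy_process_def by (elim conjE)
  from this[rule_format, of s "t - s"] assms show ?thesis by simp
qed

lemma incr_expectation:
  fixes f :: "real \<Rightarrow> real"
  assumes st: "0 \<le> s" "s \<le> t" and [measurable]: "f \<in> borel_measurable borel"
  shows "expectation (\<lambda>w. f (L t w - L s w)) = expectation (\<lambda>w. f (L (t - s) w))"
    and "integrable M (\<lambda>w. f (L t w - L s w)) \<longleftrightarrow> integrable M (\<lambda>w. f (L (t - s) w))"
proof -
  have [measurable]: "L s \<in> borel_measurable M" "L t \<in> borel_measurable M" "L (t - s) \<in> borel_measurable M"
    using st by auto
  have "expectation (\<lambda>w. f (L t w - L s w)) = integral\<^sup>L (distr M borel (\<lambda>w. L t w - L s w)) f"
    by (subst integral_distr) auto
  also have "\<dots> = integral\<^sup>L (distr M borel (L (t - s))) f" by (simp add: incr_distr st)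
  also have "\<dots> = expectation (\<lambda>w. f (L (t - s) w))" by (subst integral_distr) auto
  finally show "expectation (\<lambda>w. f (L t w - L s w)) = expectation (\<lambda>w. f (L (t - s) w))" .
  have "integrable M (\<lambda>w. f (L t w - L s w)) \<longleftrightarrow> integrable (distr M borel (\<lambda>w. L t w - L s w)) f"
    by (subst integrable_distr_eq) auto
  also have "\<dots> \<longleftrightarrow> integrable (distr M borel (L (t - s))) f" by (simp add: incr_distr st)
  also have "\<dots> \<longleftrightarrow> integrable M (\<lambda>w. f (L (t - s) w))"
    by (subst integrable_distr_eq) auto
  finally show "integrable M (\<lambda>w. f (L t w - L s w)) \<longleftrightarrow> integrable M (\<lambda>w. f (L (t - s) w))" .
qed

text \<open>Independence of an infinite family is a matter of its finite subfamilies, each of which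
  lies in some \<open>{..<n}\<close>, where the definition of a Levy process applies.\<close>

lemma incr_indep:
  assumes "0 \<le> p 0" "\<And>i. p i \<le> p (Suc i)"
  shows "indep_vars (\<lambda>_. borel) (\<lambda>i w. L (p (Suc i)) w - L (p i) w) (UNIV :: nat set)"
  unfolding indep_vars_def2
proof (intro conjI ballI)
  have pm: "mono p" using assms(2) by (simp add: mono_iff_le_Suc)
  have p0: "0 \<le> p i" for i using monoD[OF pm, of 0 i] assms(1) by simp
  show "(\<lambda>w. L (p (Suc i)) w - L (p i) w) \<in> borel_measurable M" for i
    using p0 by (intro borel_measurable_diff L_measurable) auto
  show "indep_sets (\<lambda>i. {(\<lambda>w. L (p (Suc i)) w - L (p i) w) -` A \<inter> space M |A. A \<in> sets borel}) UNIV"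
  proof (subst indep_sets_finite_index_sets, intro allI impI)
    fix J :: "nat set" assume J: "finite J"
    obtain n where n: "J \<subseteq> {..<n}" using J finite_nat_iff_bounded by blast
    have "\<forall>(n::nat) t. 0 \<le> t 0 \<and> (\<forall>i<n. t i \<le> t (Suc i)) \<longrightarrow>
        indep_vars (\<lambda>_. borel) (\<lambda>i w. L (t (Suc i)) w - L (t i) w) {..<n}"
      using levy unfolding levy_process_def by (elim conjE)
    from this[rule_format, of p n]
    have "indep_vars (\<lambda>_. borel) (\<lambda>i w. L (p (Suc i)) w - L (p i) w) {..<n}"
      using assms by simp
    then have "indep_vars (\<lambda>_. borel) (\<lambda>i w. L (p (Suc i)) w - L (p i) w) J"
      by (rule indep_vars_subset[OF _ n])
    then show "indep_sets (\<lambda>i. {(\<lambda>w. L (p (Suc i)) w - L (p i) w) -` A \<inter> space M |A. A \<in> sets borel}) J"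
      by (simp add: indep_vars_def2)
  qed
qed

lemma incr_integrable_power4:
  assumes "0 \<le> s" "s \<le> t"
  shows "integrable M (\<lambda>w. (L t w - L s w - c)^4)"
proof -
  have [measurable]: "L (t - s) \<in> borel_measurable M" using assms by auto
  have "integrable M (\<lambda>w. 8 * (L (t - s) w^4 + c^4))" using L4[of "t - s"] assms by simp
  then have "integrable M (\<lambda>w. (L (t - s) w - c)^4)"
  proof (rule Bochner_Integration.integrable_bound)
    show "AE w in M. norm ((L (t - s) w - c)^4) \<le> norm (8 * (L (t - s) w^4 + c^4))"
      using power4_add_le[of "L (t - s) w" "- c" for w] by simp
  qed measurable
  then show ?thesis
    using incr_expectation(2)[OF assms, of "\<lambda>x. (x - c)^4"] by simp
qed

lemma mean_additive:
  assumes "0 \<le> s" "0 \<le> t"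
  shows "expectation (L (s + t)) = expectation (L s) + expectation (L t)"
  using incr_expectation(1)[of s "s + t" "\<lambda>x. x"] assms L_integrable by simp

lemma centred_incr:
  assumes p: "0 \<le> p 0" "\<And>i::nat. p i \<le> p (Suc i)"
  defines "C \<equiv> (\<lambda>i w. L (p (Suc i)) w - L (p i) w - expectation (L (p (Suc i) - p i)))"
  shows "indep_vars (\<lambda>_. borel) C UNIV" and "integrable M (\<lambda>w. C i w^4)" and "expectation (C i) = 0"
    and "expectation (\<lambda>w. C i w^2) = variance (L (p (Suc i) - p i))"
    and "expectation (\<lambda>w. C i w^4) = expectation (\<lambda>w. (L (p (Suc i) - p i) w - expectation (L (p (Suc i) - p i)))^4)"
proof -
  have pm: "mono p" using p(2) by (simp add: mono_iff_le_Suc)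
  have p0: "0 \<le> p i" for i using monoD[OF pm, of 0 i] p(1) by simp
  show "indep_vars (\<lambda>_. borel) C UNIV"
    unfolding C_def by (rule indep_vars_compose2[OF incr_indep[OF p], where Y="\<lambda>i x. x - expectation (L (p (Suc i) - p i))"]) auto
  show "integrable M (\<lambda>w. C i w^4)"
    unfolding C_def using p p0 by (intro incr_integrable_power4) auto
  have "expectation (C i) = expectation (\<lambda>w. L (p (Suc i) - p i) w - expectation (L (p (Suc i) - p i)))"
    unfolding C_def using incr_expectation(1)[OF p0 p(2), of "\<lambda>x. x - expectation (L (p (Suc i) - p i))"] by simp
  then show "expectation (C i) = 0"
    using L_integrable[of "p (Suc i) - p i"] p(2)[of i] by (simp add: prob_space)
  show "expectation (\<lambda>w. C i w^2) = variance (L (p (Suc i) - p i))"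
    unfolding C_def using incr_expectation(1)[OF p0 p(2), of "\<lambda>x. (x - expectation (L (p (Suc i) - p i)))^2"] by simp
  show "expectation (\<lambda>w. C i w^4) = expectation (\<lambda>w. (L (p (Suc i) - p i) w - expectation (L (p (Suc i) - p i)))^4)"
    unfolding C_def using incr_expectation(1)[OF p0 p(2), of "\<lambda>x. (x - expectation (L (p (Suc i) - p i)))^4"] by simp
qed

text \<open>The equality is only almost sure because \<open>L 0\<close> vanishes only almost surely.
  The means telescope by additivity alone; their linearity in time is proved later.\<close>

lemma sum_centred_incr:
  assumes "p 0 = 0" "\<And>i::nat. p i \<le> p (Suc i)"
  shows "AE w in M. (\<Sum>i<n. L (p (Suc i)) w - L (p i) w - expectation (L (p (Suc i) - p i)))
    = L (p n) w - expectation (L (p n))"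
proof -
  have pm: "mono p" using assms(2) by (simp add: mono_iff_le_Suc)
  have p0: "0 \<le> p i" for i using monoD[OF pm, of 0 i] assms(1) by simp
  have "expectation (L 0) = 0"
    using mean_additive[of 0 0] by simp
  moreover have "expectation (L (p (Suc i) - p i)) = expectation (L (p (Suc i))) - expectation (L (p i))" for i
    using mean_additive[of "p i" "p (Suc i) - p i"] p0 assms(2)[of i] by simp
  ultimately have "(\<Sum>i<n. expectation (L (p (Suc i) - p i))) = expectation (L (p n))"
    by (simp add: sum_lessThan_telescope[of "\<lambda>i. expectation (L (p i))"] assms(1))
  then have *: "(\<Sum>i<n. L (p (Suc i)) w - L (p i) w - expectation (L (p (Suc i) - p i)))
    = L (p n) w - L 0 w - expectation (L (p n))" for w
    unfolding sum_subtractf[of "\<lambda>i. L (p (Suc i)) w - L (p i) w"] sum_lessThan_telescope[of "\<lambda>i. L (p i) w"]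
    by (simp add: assms(1))
  from L_0 show ?thesis unfolding * by eventually_elim simp
qed

lemma variance_additive:
  assumes "0 \<le> s" "0 \<le> t"
  shows "variance (L (s + t)) = variance (L s) + variance (L t)"
proof -
  \<comment> \<open>\<open>centred_incr\<close> takes an infinite grid, so the partition
    \<open>0, s, s + t\<close> is continued as a constant.\<close>
  define p where "p = (\<lambda>i::nat. if i = 0 then 0 else if i = 1 then s else s + t)"
  have p: "p 0 = 0" "\<And>i. p i \<le> p (Suc i)" using assms by (auto simp: p_def)
  note C = centred_incr[of p, OF eq_refl[OF p(1)[symmetric]] p(2)]
  let ?C = "\<lambda>i w. L (p (Suc i)) w - L (p i) w - expectation (L (p (Suc i) - p i))"
  have "variance (L (p 2)) = expectation (\<lambda>w. (\<Sum>i<2. ?C i w)^2)"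
  proof (rule integral_cong_AE)
    show "AE w in M. (L (p 2) w - expectation (L (p 2)))^2 = (\<Sum>i<2. ?C i w)^2"
      using sum_centred_incr[OF p, of 2] by eventually_elim simp
    have [measurable]: "L (p i) \<in> borel_measurable M" for i using assms by (auto simp: p_def)
    show "(\<lambda>w. (L (p 2) w - expectation (L (p 2)))^2) \<in> borel_measurable M"
      "(\<lambda>w. (\<Sum>i<2. ?C i w)^2) \<in> borel_measurable M" by measurable
  qed
  also have "\<dots> = (\<Sum>i<2. expectation (\<lambda>w. (?C i w)^2))"
    by (intro indep_sum_power4(3) indep_vars_subset[OF C(1)] C(2,3)) auto
  also have "\<dots> = (\<Sum>i<2. variance (L (p (Suc i) - p i)))"
    by (intro sum.cong refl C(4))
  finally show ?thesis by (simp add: p_def numeral_2_eq_2)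
qed

lemma variance_linear: "0 \<le> t \<Longrightarrow> variance (L t) = t * variance (L 1)"
  by (rule additive_nonneg_linear[of "\<lambda>t. variance (L t)", OF variance_additive variance_positive])

text \<open>The mean is continuous at \<open>0\<close>: by stochastic continuity \<open>L t\<close> is small and, its variance being
  linear in \<open>t\<close>, also close to its mean, both with probability above \<open>1/2\<close>.\<close>

lemma mean_linear:
  assumes t: "0 \<le> t"
  shows "expectation (L t) = t * expectation (L 1)"
proof (rule additive_linear[of "\<lambda>t. expectation (L t)", OF mean_additive _ t])
  show "((\<lambda>t. expectation (L t)) \<longlongrightarrow> 0) (at_right 0)"
  proof (rule tendstoI)
    fix e :: real assume e: "0 < e"
    define v where "v = variance (L 1)"
    have "tendsto_in_prob M L (L 0) (at 0 within {0..})"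
      using levy by (simp add: levy_process_def)
    then have "((\<lambda>t. prob {w \<in> space M. e / 3 < \<bar>L t w - L 0 w\<bar>}) \<longlongrightarrow> 0) (at 0 within {0..})"
      using e by (auto simp: tendsto_in_prob_def dest: spec[of _ "e / 3"])
    then have "((\<lambda>t. prob {w \<in> space M. e / 3 < \<bar>L t w - L 0 w\<bar>}) \<longlongrightarrow> 0) (at_right 0)"
      by (rule tendsto_within_subset) auto
    then have "\<forall>\<^sub>F t in at_right 0. prob {w \<in> space M. e / 3 < \<bar>L t w - L 0 w\<bar>} < 1/2"
      by (rule order_tendstoD) simp
    moreover have "((\<lambda>t. t * v / (e/3)^2) \<longlongrightarrow> 0 * v / (e/3)^2) (at_right 0)"
      by (intro tendsto_intros) (use e in auto)
    then have "\<forall>\<^sub>F t in at_right 0. t * v / (e/3)^2 < 1/2"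
      by (rule order_tendstoD) simp
    moreover have "\<forall>\<^sub>F t in at_right (0::real). 0 < t" by (simp add: eventually_at_right_less)
    ultimately show "\<forall>\<^sub>F t in at_right 0. dist (expectation (L t)) 0 < e"
    proof eventually_elim
      case (elim t)
      then have [measurable]: "L t \<in> borel_measurable M" "L 0 \<in> borel_measurable M" by auto
      define A where "A = {w \<in> space M. e / 3 < \<bar>L t w - L 0 w\<bar>}"
      define B where "B = {w \<in> space M. e / 3 < \<bar>L t w - expectation (L t)\<bar>}"
      define N where "N = {w \<in> space M. L 0 w \<noteq> 0}"
      have [measurable]: "A \<in> events" "B \<in> events" "N \<in> events" by (auto simp: A_def B_def N_def)
      have "prob B \<le> variance (L t) / (e/3)^2"
        unfolding B_def
      proof (rule prob_gt_le)
        show "integrable M (\<lambda>w. (L t w - expectation (L t))^2)"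
          using L_integrable[of t] L_integrable_power2[of t] elim by (simp add: power2_diff)
      qed (use e in auto)
      also have "variance (L t) = t * v" using variance_linear[of t] elim by (simp add: v_def)
      finally have "prob B < 1/2" using elim(2) by (rule order_le_less_trans)
      moreover have "prob A < 1/2" using elim by (simp add: A_def)
      moreover have "prob N = 0"
        using L_0 by (simp add: N_def prob_eq_0)
      moreover have "prob (A \<union> B \<union> N) \<le> prob A + prob B + prob N"
        using measure_Un_le[of "A \<union> B" M N] measure_Un_le[of A M B] by simp
      \<comment> \<open>The three exceptional events do not fill the space, so some \<open>w\<close>
        avoids them all. There \<open>L 0 w = 0\<close>, and both \<open>L t w\<close> and its
        distance to the mean are at most \<open>e / 3\<close> in absolute value, so the mean is at
        most \<open>2 * e / 3\<close> in absolute value.\<close>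
      ultimately have "prob (A \<union> B \<union> N) < prob (space M)" by (simp add: prob_space)
      then have "A \<union> B \<union> N \<noteq> space M" by auto
      then have "A \<union> B \<union> N \<subset> space M" by (auto simp: A_def B_def N_def)
      then obtain w where wit: "w \<in> space M" "w \<notin> A \<union> B \<union> N" by blast
      then have "\<bar>L t w\<bar> \<le> e / 3" "\<bar>L t w - expectation (L t)\<bar> \<le> e / 3"
        by (auto simp: A_def B_def N_def)
      then show ?case using e unfolding dist_real_def by linarith
    qed
  qed
qed

text \<open>By the lower bound in \<open>indep_sum_power4\<close>, an increment over a time
  \<open>T / n\<close> has a centred fourth moment of order \<open>1 / n\<close>. This keeps the
  fourth moments of Riemann sums bounded while their mesh shrinks.\<close>

lemma fourth_moment_subdivide:
  assumes T: "0 \<le> T" and n: "n > 0"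
  shows "real n * expectation (\<lambda>w. (L (T / real n) w - expectation (L (T / real n)))^4)
    \<le> expectation (\<lambda>w. (L T w - expectation (L T))^4)"
proof -
  define p where "p = (\<lambda>i::nat. real i * (T / real n))"
  have p: "p 0 = 0" "\<And>i. p i \<le> p (Suc i)" using T by (auto simp: p_def intro!: mult_right_mono divide_right_mono)
  have d: "p (Suc i) - p i = T / real n" for i by (simp add: p_def field_simps flip: add_divide_distrib)
  have pn: "p n = T" using n by (simp add: p_def)
  note C = centred_incr[of p, OF eq_refl[OF p(1)[symmetric]] p(2)]
  let ?C = "\<lambda>i w. L (p (Suc i)) w - L (p i) w - expectation (L (p (Suc i) - p i))"
  have "real n * expectation (\<lambda>w. (L (T / real n) w - expectation (L (T / real n)))^4)
    = (\<Sum>i<n. expectation (\<lambda>w. ?C i w^4))"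
    using C(5) by (simp add: d)
  also have "\<dots> \<le> expectation (\<lambda>w. (\<Sum>i<n. ?C i w)^4)"
    by (intro indep_sum_power4(4) indep_vars_subset[OF C(1)] C(2,3)) auto
  also have "\<dots> = expectation (\<lambda>w. (L T w - expectation (L T))^4)"
  proof (rule integral_cong_AE)
    have "0 \<le> p i" for i using T by (simp add: p_def)
    then have [measurable]: "L (p i) \<in> borel_measurable M" for i by auto
    have [measurable]: "L T \<in> borel_measurable M" using T by auto
    show "AE w in M. (\<Sum>i<n. ?C i w)^4 = (L T w - expectation (L T))^4"
      using sum_centred_incr[OF p, of n] unfolding pn by eventually_elim simp
    show "(\<lambda>w. (\<Sum>i<n. ?C i w)^4) \<in> borel_measurable M" by measurable
    show "(\<lambda>w. (L T w - expectation (L T))^4) \<in> borel_measurable M" by measurable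
  qed
  finally show ?thesis .
qed

abbreviation m4 :: "real \<Rightarrow> real" where
  "m4 t \<equiv> expectation (\<lambda>w. (L t w - expectation (L t))^4)"

text \<open>The weights and the index set are left free because the formulas serve for Riemann sums,
  for differences of Riemann sums on nested grids and for single blocks. After centring, everything
  is a sum of independent variables with mean zero.\<close>

lemma weighted_incr:
  fixes p a :: "nat \<Rightarrow> real"
  assumes p: "0 \<le> p 0" "\<And>i. p i \<le> p (Suc i)" and I: "finite I"
  defines "W \<equiv> (\<lambda>w. \<Sum>k\<in>I. a k * (L (p (Suc k)) w - L (p k) w))"
    and "e \<equiv> expectation (L 1) * (\<Sum>k\<in>I. a k * (p (Suc k) - p k))"
  shows "W \<in> borel_measurable M" and "expectation W = e" and "integrable M (\<lambda>w. (W w - e)^4)"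
    and "integrable M (\<lambda>w. W w^2)"
    and "expectation (\<lambda>w. (W w - e)^2) = variance (L 1) * (\<Sum>k\<in>I. (a k)^2 * (p (Suc k) - p k))"
    and "expectation (\<lambda>w. W w^2) = variance (L 1) * (\<Sum>k\<in>I. (a k)^2 * (p (Suc k) - p k)) + e^2"
    and "expectation (\<lambda>w. (W w - e)^4) \<le> (\<Sum>k\<in>I. (a k)^4 * m4 (p (Suc k) - p k))
      + 3 * (variance (L 1) * (\<Sum>k\<in>I. (a k)^2 * (p (Suc k) - p k)))^2"
proof -
  have pm: "mono p" using p(2) by (simp add: mono_iff_le_Suc)
  have p0: "0 \<le> p i" for i using monoD[OF pm, of 0 i] p(1) by simp
  have [measurable]: "L (p i) \<in> borel_measurable M" for i using p0 by simp
  note C = centred_incr[of p, OF p]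
  let ?C = "\<lambda>i w. L (p (Suc i)) w - L (p i) w - expectation (L (p (Suc i) - p i))"
  let ?X = "\<lambda>i w. a i * ?C i w"
  have m: "expectation (L (p (Suc i) - p i)) = (p (Suc i) - p i) * expectation (L 1)" for i
    using p(2)[of i] by (intro mean_linear) simp
  have v: "variance (L (p (Suc i) - p i)) = (p (Suc i) - p i) * variance (L 1)" for i
    using p(2)[of i] by (intro variance_linear) simp
  have Ww: "W w - e = (\<Sum>i\<in>I. ?X i w)" for w
    unfolding W_def e_def m by (simp add: right_diff_distrib sum_subtractf sum_distrib_left mult_ac)
  have ind: "indep_vars (\<lambda>_. borel) ?X I"
    by (rule indep_vars_compose2[OF indep_vars_subset[OF C(1)], where Y="\<lambda>i x. a i * x"]) auto
  have X4: "integrable M (\<lambda>w. (?X i w)^4)" for i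
    unfolding power_mult_distrib by (intro integrable_mult_right C(2))
  have X0: "expectation (?X i) = 0" for i using C(3)[of i] by simp
  have E2: "expectation (\<lambda>w. (?X i w)^2) = (a i)^2 * ((p (Suc i) - p i) * variance (L 1))" for i
    unfolding power_mult_distrib using C(4)[of i] v[of i] by simp
  have E4: "expectation (\<lambda>w. (?X i w)^4) = (a i)^4 * m4 (p (Suc i) - p i)" for i
    unfolding power_mult_distrib using C(5)[of i] by simp
  note S = indep_sum_power4[OF I ind X4 X0]
  show Wm[measurable]: "W \<in> borel_measurable M" unfolding W_def by measurable
  show i4: "integrable M (\<lambda>w. (W w - e)^4)" unfolding Ww by (rule S(1))
  have i2: "integrable M (\<lambda>w. (W w - e)^2)" by (rule integrable_power2_of_power4[OF _ i4]) measurable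
  have i1: "integrable M (\<lambda>w. W w - e)" by (rule integrable_of_power2[OF _ i2]) measurable
  have "integrable M (\<lambda>w. (W w - e) + e)" by (intro Bochner_Integration.integrable_add i1 integrable_const)
  then have iW: "integrable M W" by simp
  have "expectation (\<lambda>w. W w - e) = 0" unfolding Ww by (rule S(2))
  then show eW: "expectation W = e" using iW by (simp add: prob_space)
  have sq: "W w^2 = (W w - e)^2 + 2 * e * (W w - e) + e^2" for w
    by (simp add: power2_eq_square algebra_simps)
  show "integrable M (\<lambda>w. W w^2)"
    unfolding sq by (intro Bochner_Integration.integrable_add integrable_mult_right i2 i1 integrable_const)
  show e2: "expectation (\<lambda>w. (W w - e)^2) = variance (L 1) * (\<Sum>k\<in>I. (a k)^2 * (p (Suc k) - p k))"
    unfolding Ww S(3) E2 by (simp add: sum_distrib_left mult_ac)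
  have "expectation (\<lambda>w. W w^2) = expectation (\<lambda>w. (W w - e)^2) + 2 * e * expectation (\<lambda>w. W w - e) + e^2"
    unfolding sq using i1 i2 by (simp add: prob_space)
  then show "expectation (\<lambda>w. W w^2) = variance (L 1) * (\<Sum>k\<in>I. (a k)^2 * (p (Suc k) - p k)) + e^2"
    using e2 \<open>expectation (\<lambda>w. W w - e) = 0\<close> by simp
  show "expectation (\<lambda>w. (W w - e)^4) \<le> (\<Sum>k\<in>I. (a k)^4 * m4 (p (Suc k) - p k))
      + 3 * (variance (L 1) * (\<Sum>k\<in>I. (a k)^2 * (p (Suc k) - p k)))^2"
    using S(5) unfolding Ww[symmetric] E4 E2 by (simp add: sum_distrib_left mult_ac)
qed

end

subsection \<open>Levy integrals along dyadic partitions\<close>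

text \<open>Splits each interval \<open>[t j, t (j + 1)]\<close> into \<open>2^n\<close> pieces of equal length, so that the
  grids are nested and every \<open>t j\<close> is a grid point.\<close>

definition dyadic_grid :: "(nat \<Rightarrow> real) \<Rightarrow> nat \<Rightarrow> nat \<Rightarrow> real" where
  "dyadic_grid t n k = t (k div 2^n) + real (k mod 2^n) / 2^n * (t (Suc (k div 2^n)) - t (k div 2^n))"

lemma dyadic_grid_mult: "dyadic_grid t n (j * 2^n) = t j"
  by (simp add: dyadic_grid_def)

lemma dyadic_grid_0: "dyadic_grid t n 0 = t 0"
  by (simp add: dyadic_grid_def)

lemma dyadic_grid_add:
  assumes "i < 2^n"
  shows "dyadic_grid t n (j * 2^n + i) = t j + real i / 2^n * (t (Suc j) - t j)"
  using assms by (simp add: dyadic_grid_def)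

lemma dyadic_grid_Suc:
  "dyadic_grid t n (Suc k) - dyadic_grid t n k = (t (Suc (k div 2^n)) - t (k div 2^n)) / 2^n"
proof (cases "Suc (k mod 2^n) = 2^n")
  case True
  then have "real (k mod 2^n) = 2^n - 1"
    by (metis add.commute add_diff_cancel_left' of_nat_Suc of_nat_numeral of_nat_power)
  then have r: "real (k mod 2^n) / 2^n = 1 - 1 / 2^n" by (simp add: diff_divide_distrib)
  show ?thesis using True unfolding dyadic_grid_def r
    by (simp add: div_Suc mod_Suc diff_divide_distrib algebra_simps)
next
  case False
  then show ?thesis by (simp add: dyadic_grid_def div_Suc mod_Suc field_simps)
qed

lemma dyadic_grid_refine: "dyadic_grid t (n + q) (k * 2^q) = dyadic_grid t n k"
proof -
  have "(k * 2^q) div (2::nat)^(n + q) = k div 2^n" by (simp add: power_add)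
  moreover have "(k * 2^q) mod (2::nat)^(n + q) = (k mod 2^n) * 2^q"
    by (simp add: power_add mod_mult_mult2)
  ultimately show ?thesis by (simp add: dyadic_grid_def power_add)
qed

text \<open>The left Riemann sum of an exponential over equal cells is geometric. It equals the
  integral times \<open>x / (exp x - 1)\<close> with \<open>x = c * d / 2^n\<close>, and this factor
  tends to \<open>1\<close>.\<close>

lemma sum_exp_dyadic:
  fixes c d :: real
  assumes "c \<noteq> 0"
  shows "(\<lambda>n. \<Sum>i<2^n. exp (c * (a + real i / 2^n * d)) * (d / 2^n)) \<longlonglongrightarrow> (exp (c * (a + d)) - exp (c * a)) / c"
proof (cases "d = 0")
  case False
  define x where "x = (\<lambda>n::nat. c * d / 2^n)"
  have x0: "x n \<noteq> 0" for n using False assms by (simp add: x_def)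
  have "(\<lambda>n. c * d * (1/2)^n) \<longlonglongrightarrow> c * d * 0" by (intro tendsto_mult_left LIMSEQ_power_zero) simp
  then have "x \<longlonglongrightarrow> 0" by (simp add: x_def[abs_def] power_divide)
  then have xlim: "filterlim x (at 0) sequentially" using x0 by (auto simp: filterlim_at)
  have "((\<lambda>h. (exp h - 1) / h) \<longlongrightarrow> 1) (at (0::real))"
    using DERIV_exp[of 0] by (simp add: DERIV_def)
  from filterlim_compose[OF this xlim]
  have "(\<lambda>n. 1 / ((exp (x n) - 1) / x n)) \<longlonglongrightarrow> 1 / 1" by (intro tendsto_divide tendsto_const) auto
  then have lim: "(\<lambda>n. (exp (c * (a + d)) - exp (c * a)) / c * (x n / (exp (x n) - 1))) \<longlonglongrightarrow> (exp (c * (a + d)) - exp (c * a)) / c * 1"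
    by (intro tendsto_mult_left) simp
  have "(\<Sum>i<2^n. exp (c * (a + real i / 2^n * d)) * (d / 2^n))
      = (exp (c * (a + d)) - exp (c * a)) / c * (x n / (exp (x n) - 1))" for n
  proof -
    have "exp (c * (a + real i / 2^n * d)) * (d / 2^n) = exp (c * a) * (d / 2^n) * exp (x n)^i" for i
    proof -
      have "exp (c * (a + real i / 2^n * d)) = exp (c * a) * exp (real i * x n)"
        by (simp add: x_def algebra_simps flip: exp_add)
      then show ?thesis by (simp add: exp_of_nat_mult)
    qed
    then have "(\<Sum>i<2^n. exp (c * (a + real i / 2^n * d)) * (d / 2^n)) = exp (c * a) * (d / 2^n) * (\<Sum>i<2^n. exp (x n)^i)"
      by (simp only: sum_distrib_left)
    also have "(\<Sum>i<2^n. exp (x n)^i) = (exp (x n)^(2^n) - 1) / (exp (x n) - 1)"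
      using x0 by (intro geometric_sum) simp
    also have "exp (x n)^(2^n) = exp (c * d)" by (simp add: x_def flip: exp_of_nat_mult)
    finally have eq: "(\<Sum>i<2^n. exp (c * (a + real i / 2^n * d)) * (d / 2^n))
        = exp (c * a) * (d / 2^n) * ((exp (c * d) - 1) / (exp (x n) - 1))" .
    have dx: "d / 2^n = x n / c" using assms by (simp add: x_def)
    show ?thesis unfolding eq unfolding dx
      by (simp add: exp_add distrib_left diff_divide_distrib algebra_simps)
  qed
  then show ?thesis using lim by simp
qed simp

text \<open>Puts the starting value in front of the sequence of Levy increments. \<open>N\<close>
  stands for the sigma-algebra generated by the process, so the independence in \<open>WN\<close>
  covers all events of the \<open>V i\<close> jointly. In the proof \<open>J'\<close> collects the
  indices of those events, shifted down by one.\<close>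

lemma (in prob_space) indep_vars_case_nat:
  fixes W :: "'a \<Rightarrow> real" and V :: "nat \<Rightarrow> 'a \<Rightarrow> real"
  assumes W: "W \<in> borel_measurable M" and V: "indep_vars (\<lambda>_. borel) V UNIV"
    and N: "space N = space M" "\<And>i. V i \<in> borel_measurable N"
    and WN: "indep_set (sets (vimage_algebra (space M) W borel)) (sets N)"
  shows "indep_vars (\<lambda>_. borel) (case_nat W V) UNIV"
  unfolding indep_vars_def2
proof (intro conjI ballI)
  show rv: "case_nat W V i \<in> borel_measurable M" for i
    using W V by (cases i) (auto simp: indep_vars_def2)
  let ?F = "\<lambda>i. {case_nat W V i -` A \<inter> space M |A. A \<in> sets borel}"
  show "indep_sets ?F UNIV"
  proof (rule indep_setsI)
    show "?F i \<subseteq> events" for i using measurable_sets[OF rv[of i]] by auto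
    fix A :: "nat \<Rightarrow> 'a set" and J :: "nat set"
    assume J: "J \<noteq> {}" "finite J" and A: "\<forall>j\<in>J. A j \<in> ?F j"
    define J' where "J' = {i. Suc i \<in> J}"
    have J': "finite J'" using finite_vimageI[OF J(2), of Suc] by (simp add: J'_def vimage_def)
    have AV: "A (Suc i) \<in> {V i -` B \<inter> space M |B. B \<in> sets borel}" if "i \<in> J'" for i
      using A that by (force simp: J'_def)
    have V': "prob (\<Inter>i\<in>J'. A (Suc i)) = (\<Prod>i\<in>J'. prob (A (Suc i)))" if "J' \<noteq> {}"
      using V that J' AV unfolding indep_vars_def2
      by (intro indep_setsD[where F="\<lambda>i. {V i -` A \<inter> space M |A. A \<in> sets borel}" and I=UNIV]) auto
    show "prob (\<Inter>j\<in>J. A j) = (\<Prod>j\<in>J. prob (A j))"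
    proof (cases "0 \<in> J")
      case False
      then have "J = Suc ` J'" unfolding J'_def by (auto simp: image_iff) (metis not0_implies_Suc)
      then show ?thesis using V' J by (auto simp: prod.reindex)
    next
      case True
      then have JJ: "J = insert 0 (Suc ` J')" unfolding J'_def by (auto simp: image_iff) (metis not0_implies_Suc)
      show ?thesis
      proof (cases "J' = {}")
        case True
        then show ?thesis by (simp add: JJ)
      next
        case False
        have A0: "A 0 \<in> sets (vimage_algebra (space M) W borel)"
          using A True by (auto simp: in_vimage_algebra)
        have "A (Suc i) \<in> sets N" if "i \<in> J'" for i
          using AV[OF that] measurable_sets[OF N(2)[of i]] N(1) by auto
        then have "(\<Inter>i\<in>J'. A (Suc i)) \<in> sets N" using J' False by (intro sets.finite_INT) auto
        then have "prob (A 0 \<inter> (\<Inter>i\<in>J'. A (Suc i))) = prob (A 0) * prob (\<Inter>i\<in>J'. A (Suc i))"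
          by (rule indep_setD[OF WN A0])
        then show ?thesis using V'[OF False] J' by (simp add: JJ prod.reindex)
      qed
    qed
  qed
qed

lemma abs_exp_diff_le:
  fixes c :: real
  assumes "0 \<le> x" "x \<le> y" "y \<le> T"
  shows "\<bar>exp (c * y) - exp (c * x)\<bar> \<le> \<bar>c\<bar> * exp (\<bar>c\<bar> * T) * (y - x)"
proof -
  have "norm (exp (c * y) - exp (c * x)) \<le> \<bar>c\<bar> * exp (\<bar>c\<bar> * T) * norm (y - x)"
  proof (rule field_differentiable_bound[of "{x..y}"])
    show "((\<lambda>z. exp (c * z)) has_field_derivative c * exp (c * z)) (at z within {x..y})" for z
      by (auto intro!: derivative_eq_intros)
    fix z assume z: "z \<in> {x..y}"
    have "c * z \<le> \<bar>c * z\<bar>" by simp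
    also have "\<dots> \<le> \<bar>c\<bar> * T" unfolding abs_mult using z assms by (intro mult_left_mono) auto
    finally show "norm (c * exp (c * z)) \<le> \<bar>c\<bar> * exp (\<bar>c\<bar> * T)"
      by (auto simp: abs_mult intro!: mult_left_mono)
  qed (use assms in auto)
  then show ?thesis using assms by simp
qed

context levy_power4
begin

lemma L_measurable_generated:
  assumes "0 \<le> t"
  shows "L t \<in> borel_measurable (sigma (space M) (\<Union>t\<in>{0..}. sets (vimage_algebra (space M) (L t) borel)))"
proof (rule measurableI)
  let ?E = "\<Union>t\<in>{0..}. sets (vimage_algebra (space M) (L t) borel)"
  have E: "?E \<subseteq> Pow (space M)" using sets.space_closed[of "vimage_algebra (space M) (L t) borel" for t] by fastforce
  fix A :: "real set" assume "A \<in> sets borel"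
  then have "L t -` A \<inter> space M \<in> sets (vimage_algebra (space M) (L t) borel)" by (rule in_vimage_algebra)
  then show "L t -` A \<inter> space (sigma (space M) ?E) \<in> sets (sigma (space M) ?E)"
    using E assms by (auto simp: space_measure_of_conv intro!: sigma_sets.Basic)
qed simp

section \<open>Integrals of \<open>exp (c * s)\<close> over the consecutive blocks from
  \<open>t j\<close> to \<open>t (Suc j)\<close>\<close>

context
  fixes t :: "nat \<Rightarrow> real" and c :: real and I :: "nat \<Rightarrow> 'a \<Rightarrow> real"
  assumes t0: "t 0 = 0" and tS: "\<And>j. t j \<le> t (Suc j)" and c: "c \<noteq> 0"
    and I: "\<And>j. has_levy_integral M L (\<lambda>s. exp (c * s)) 0 (t j) (I j)"
begin

private definition p :: "nat \<Rightarrow> nat \<Rightarrow> real" where "p = dyadic_grid t"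

private definition incr :: "nat \<Rightarrow> nat \<Rightarrow> 'a \<Rightarrow> real" where
  "incr n k w = exp (c * p n k) * (L (p n (Suc k)) w - L (p n k) w)"

text \<open>All endpoints \<open>t j\<close> share one grid, so the \<open>S n j\<close> are initial
  parts of a single sum and the blocks \<open>B n j\<close> for different \<open>j\<close> use
  disjoint sets of increments. The independence of the blocks rests on this.\<close>

private definition S :: "nat \<Rightarrow> nat \<Rightarrow> 'a \<Rightarrow> real" where
  "S n j w = (\<Sum>k<j * 2^n. incr n k w)"

private definition B :: "nat \<Rightarrow> nat \<Rightarrow> 'a \<Rightarrow> real" where
  "B n j w = (\<Sum>k\<in>{j * 2^n..<Suc j * 2^n}. incr n k w)"

private lemma t_mono: "i \<le> j \<Longrightarrow> t i \<le> t j"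
  using tS by (simp add: lift_Suc_mono_le)

private lemma t_nonneg: "0 \<le> t j"
  using t_mono[of 0 j] t0 by simp

private lemma p0: "p n 0 = 0"
  by (simp add: p_def dyadic_grid_0 t0)

private lemma pS: "p n k \<le> p n (Suc k)"
proof -
  have "0 \<le> (t (Suc (k div 2^n)) - t (k div 2^n)) / 2^n" using tS[of "k div 2^n"] by simp
  then show ?thesis unfolding p_def using dyadic_grid_Suc[of t n k] by linarith
qed

private lemma p_mono: "i \<le> k \<Longrightarrow> p n i \<le> p n k"
  using pS by (simp add: lift_Suc_mono_le)

private lemma p_nonneg: "0 \<le> p n k"
  using p_mono[of 0 k n] p0 by simp

private lemma p_le: "k \<le> j * 2^n \<Longrightarrow> p n k \<le> t j"
  using p_mono[of k "j * 2^n" n] by (simp add: p_def dyadic_grid_mult)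

private lemma p_diff_le:
  assumes "k < j * 2^n"
  shows "p n (Suc k) - p n k \<le> t j / 2^n"
proof -
  have "k div 2^n < j" using assms by (simp add: less_mult_imp_div_less)
  then have "t (Suc (k div 2^n)) \<le> t j" by (intro t_mono) simp
  then show ?thesis unfolding p_def dyadic_grid_Suc using t_nonneg[of "k div 2^n"]
    by (intro divide_right_mono) auto
qed

private lemma L_p_measurable[measurable]: "L (p n k) \<in> borel_measurable M"
  by (intro L_measurable p_nonneg)

private lemma S_measurable[measurable]: "S n j \<in> borel_measurable M"
  unfolding S_def incr_def by measurable

private lemma I_measurable[measurable]: "I j \<in> borel_measurable M"
  using I by (simp add: has_levy_integral_def)

private lemma S_tendsto: "tendsto_in_prob M (\<lambda>n. S n j) (I j) sequentially"
proof -
  have vp: "vanishing_partitions 0 (t j) (\<lambda>n. j * 2^n) p"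
    unfolding vanishing_partitions_def
  proof (intro conjI allI impI)
    show "p n (j * 2^n) = t j" for n by (simp add: p_def dyadic_grid_mult)
    fix \<delta> :: real assume "\<delta> > 0"
    have "(\<lambda>n. t j * (1/2)^n) \<longlonglongrightarrow> t j * 0" by (intro tendsto_mult_left LIMSEQ_power_zero) simp
    then have "(\<lambda>n. t j / 2^n) \<longlonglongrightarrow> 0" by (simp add: power_divide)
    then have "\<forall>\<^sub>F n in sequentially. t j / 2^n < \<delta>" using \<open>\<delta> > 0\<close> by (rule order_tendstoD)
    then show "\<forall>\<^sub>F n in sequentially. \<forall>i<j * 2^n. p n (Suc i) - p n i < \<delta>"
      by eventually_elim (use p_diff_le in \<open>auto intro: order_le_less_trans\<close>)
  qed (use p0 pS in auto)
  have "\<forall>N p. vanishing_partitions 0 (t j) N p \<longrightarrow> tendsto_in_prob M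
      (\<lambda>n w. \<Sum>i<N n. exp (c * p n i) * (L (p n (Suc i)) w - L (p n i) w)) (I j) sequentially"
    using I[of j] by (simp add: has_levy_integral_def)
  from this[rule_format, OF vp] show ?thesis unfolding S_def incr_def .
qed

text \<open>The base of the first square bounds the variation of \<open>exp (c * s)\<close> over a
  cell of level \<open>n\<close>: a Lipschitz constant on \<open>[0, t j]\<close> times the mesh.
  The other factor is the second moment of \<open>L (t j)\<close>. The squared mesh makes the rate
  geometric with ratio \<open>1/4\<close>.\<close>

private definition r :: "nat \<Rightarrow> nat \<Rightarrow> real" where
  "r j n = (\<bar>c\<bar> * exp (\<bar>c\<bar> * t j) * (t j / 2^n))^2 * (variance (L 1) * t j + (expectation (L 1) * t j)^2)"

private lemma summable_r: "summable (r j)"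
proof -
  have sq: "(1 / 2^n)^2 = (1/4::real)^n" for n
    by (simp add: power2_eq_square power_one_over flip: power_mult_distrib)
  have "r j n = (\<bar>c\<bar> * exp (\<bar>c\<bar> * t j) * t j)^2 * (variance (L 1) * t j + (expectation (L 1) * t j)^2) * (1/4)^n" for n
  proof -
    have "r j n = (\<bar>c\<bar> * exp (\<bar>c\<bar> * t j) * t j * (1 / 2^n))^2 * (variance (L 1) * t j + (expectation (L 1) * t j)^2)"
      by (simp add: r_def)
    then show ?thesis
      unfolding power_mult_distrib[of "\<bar>c\<bar> * exp (\<bar>c\<bar> * t j) * t j" "1 / 2^n"] sq by (simp only: mult_ac)
  qed
  moreover have "summable (\<lambda>n. (1/4::real)^n)" by (rule summable_geometric) simp
  ultimately show ?thesis by (subst summable_cong[OF always_eventually]) (auto intro: summable_mult)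
qed

text \<open>Cell \<open>k\<close> of the finer grid lies in cell \<open>k div 2^q\<close> of the
  coarser one. Telescoping each coarse increment over its fine cells writes both sums with the same
  increments, so that only the weights differ.\<close>

private lemma S_diff:
  "S (n + q) j w - S n j w
    = (\<Sum>k<j * 2^(n + q). (exp (c * p (n + q) k) - exp (c * p n (k div 2^q))) * (L (p (n + q) (Suc k)) w - L (p (n + q) k) w))"
proof -
  let ?m = "n + q"
  let ?h = "\<lambda>k. exp (c * p n (k div 2^q)) * (L (p ?m (Suc k)) w - L (p ?m k) w)"
  have "S n j w = (\<Sum>k<j * 2^n. sum ?h {k * 2^q..<k * 2^q + 2^q})"
    unfolding S_def
  proof (rule sum.cong[OF refl])
    fix k
    have "sum ?h {k * 2^q..<k * 2^q + 2^q}
      = (\<Sum>i\<in>{k * 2^q..<k * 2^q + 2^q}. exp (c * p n k) * (L (p ?m (Suc i)) w - L (p ?m i) w))"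
    proof (rule sum.cong[OF refl])
      fix i assume i: "i \<in> {k * 2^q..<k * 2^q + 2^q}"
      have "i div 2^q = k" using i by (intro div_nat_eqI) (auto simp: algebra_simps)
      then show "?h i = exp (c * p n k) * (L (p ?m (Suc i)) w - L (p ?m i) w)" by simp
    qed
    also have "\<dots> = exp (c * p n k) * (\<Sum>i\<in>{k * 2^q..<k * 2^q + 2^q}. L (p ?m (Suc i)) w - L (p ?m i) w)"
      by (rule sum_distrib_left[symmetric])
    also have "(\<Sum>i\<in>{k * 2^q..<k * 2^q + 2^q}. L (p ?m (Suc i)) w - L (p ?m i) w)
      = L (p ?m (k * 2^q + 2^q)) w - L (p ?m (k * 2^q)) w"
      by (rule sum_Suc_diff') simp
    also have "L (p ?m (k * 2^q + 2^q)) w = L (p n (Suc k)) w"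
      using dyadic_grid_refine[of t n q "Suc k"] by (simp add: p_def add.commute)
    also have "L (p ?m (k * 2^q)) w = L (p n k) w" by (simp add: p_def dyadic_grid_refine)
    finally show "incr n k w = sum ?h {k * 2^q..<k * 2^q + 2^q}" unfolding incr_def by (rule sym)
  qed
  also have "\<dots> = sum ?h {..<j * 2^n * 2^q}" by (rule sum.nat_group)
  finally have "S n j w = sum ?h {..<j * 2^?m}" by (simp add: power_add mult.assoc)
  then show ?thesis
    unfolding S_def incr_def by (simp add: left_diff_distrib sum_subtractf)
qed

private lemma S_Cauchy:
  assumes "n \<le> m"
  shows "expectation (\<lambda>w. (S m j w - S n j w)^2) \<le> r j n"
proof -
  obtain q where m: "m = n + q" using assms le_Suc_ex by blast
  define a where "a = (\<lambda>k. exp (c * p (n + q) k) - exp (c * p n (k div 2^q)))"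
  define A where "A = \<bar>c\<bar> * exp (\<bar>c\<bar> * t j) * (t j / 2^n)"
  define \<delta> where "\<delta> = (\<lambda>k. p m (Suc k) - p m k)"
  have A0: "0 \<le> A" using t_nonneg by (simp add: A_def)
  have d0: "0 \<le> \<delta> k" for k using pS by (simp add: \<delta>_def)
  have a: "\<bar>a k\<bar> \<le> A" if k: "k < j * 2^m" for k
  proof -
    let ?k = "k div 2^q"
    have k': "?k < j * 2^n" using k by (simp add: m power_add less_mult_imp_div_less mult.assoc)
    have lo: "p n ?k \<le> p (n + q) k"
      using p_mono[of "?k * 2^q" k "n + q"] by (simp add: p_def dyadic_grid_refine)
    have "k < Suc ?k * 2^q" using div_less_iff_less_mult[of "2^q" k "Suc ?k"] by simp
    then have "p (n + q) k \<le> p (n + q) (Suc ?k * 2^q)" by (intro p_mono) simp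
    then have hi: "p (n + q) k \<le> p n (Suc ?k)" by (simp add: p_def dyadic_grid_refine del: mult_Suc)
    have "\<bar>a k\<bar> \<le> \<bar>c\<bar> * exp (\<bar>c\<bar> * t j) * (p (n + q) k - p n ?k)"
      unfolding a_def using lo hi p_nonneg p_le[of k j m] k m by (intro abs_exp_diff_le) auto
    also have "\<dots> \<le> A"
      unfolding A_def using hi p_diff_le[OF k'] by (intro mult_left_mono) auto
    finally show ?thesis .
  qed
  have sum\<delta>: "(\<Sum>k<j * 2^m. \<delta> k) = t j"
    unfolding \<delta>_def by (simp add: sum_lessThan_telescope p0 p_def dyadic_grid_mult t0 dyadic_grid_0)
  have "expectation (\<lambda>w. (S m j w - S n j w)^2)
    = variance (L 1) * (\<Sum>k<j * 2^m. (a k)^2 * \<delta> k) + (expectation (L 1) * (\<Sum>k<j * 2^m. a k * \<delta> k))^2"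
  proof -
    have "S m j w - S n j w = (\<Sum>k<j * 2^m. a k * (L (p m (Suc k)) w - L (p m k) w))" for w
      unfolding m S_diff a_def by (rule refl)
    then show ?thesis
      unfolding \<delta>_def using weighted_incr(6)[of "p m" "{..<j * 2^m}" a, OF eq_refl[OF p0[symmetric]] pS] by simp
  qed
  also have "\<dots> \<le> variance (L 1) * (A^2 * t j) + (\<bar>expectation (L 1)\<bar> * (A * t j))^2"
  proof (intro add_mono mult_left_mono variance_positive)
    have "(\<Sum>k<j * 2^m. (a k)^2 * \<delta> k) \<le> (\<Sum>k<j * 2^m. A^2 * \<delta> k)"
    proof (intro sum_mono mult_right_mono d0)
      fix k assume "k \<in> {..<j * 2^m}"
      then show "(a k)^2 \<le> A^2" using a[of k] A0 by (simp add: abs_le_square_iff[symmetric])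
    qed
    then show "(\<Sum>k<j * 2^m. (a k)^2 * \<delta> k) \<le> A^2 * t j" by (simp add: sum\<delta> flip: sum_distrib_left)
    have "\<bar>\<Sum>k<j * 2^m. a k * \<delta> k\<bar> \<le> (\<Sum>k<j * 2^m. \<bar>a k * \<delta> k\<bar>)" by (rule sum_abs)
    also have "\<dots> \<le> (\<Sum>k<j * 2^m. A * \<delta> k)"
      using a d0 by (intro sum_mono) (auto simp: abs_mult intro!: mult_right_mono)
    also have "\<dots> = A * t j" by (simp add: sum\<delta> flip: sum_distrib_left)
    finally show "(expectation (L 1) * (\<Sum>k<j * 2^m. a k * \<delta> k))^2 \<le> (\<bar>expectation (L 1)\<bar> * (A * t j))^2"
      by (subst abs_le_square_iff[symmetric]) (use A0 t_nonneg in \<open>auto simp: abs_mult intro!: mult_left_mono\<close>)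
  qed
  also have "\<dots> = r j n"
    unfolding r_def A_def[symmetric] by (simp add: power_mult_distrib algebra_simps)
  finally show ?thesis .
qed

private lemma S_integrable: "integrable M (\<lambda>w. (S n j w)^2)"
  unfolding S_def incr_def by (rule weighted_incr(4)[OF eq_refl[OF p0[symmetric]] pS]) simp

private lemma S_limit:
  "AE w in M. (\<lambda>n. S n j w) \<longlonglongrightarrow> I j w" "integrable M (\<lambda>w. (I j w)^2)"
  "expectation (\<lambda>w. (I j w - S n j w)^2) \<le> r j n"
  using tendsto_in_prob_L2_Cauchy[OF S_measurable I_measurable S_integrable S_tendsto S_Cauchy summable_r]
  by auto

text \<open>\<open>I 0\<close> is an arbitrary version of the integral over a degenerate interval;
  the Riemann sums \<open>S n 0\<close> are empty.\<close>

lemma levy_integral_0: "AE w in M. I 0 w = 0"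
  using S_limit(1)[of 0] by eventually_elim (simp add: S_def LIMSEQ_const_iff)

private lemma B_eq: "B n j w = S n (Suc j) w - S n j w"
proof -
  have "{..<Suc j * 2^n} = {..<j * 2^n} \<union> {j * 2^n..<Suc j * 2^n}" by auto
  then have "S n (Suc j) w = S n j w + B n j w"
    unfolding S_def B_def by (simp only: sum.union_disjoint[OF finite_lessThan finite_atLeastLessThan ivl_disj_int_one(2)])
  then show ?thesis by simp
qed

private lemma B_measurable[measurable]: "B n j \<in> borel_measurable M"
  unfolding B_def incr_def by measurable

private lemma B_limit: "AE w in M. (\<lambda>n. B n j w) \<longlonglongrightarrow> I (Suc j) w - I j w"
  unfolding B_eq using S_limit(1)[of j] S_limit(1)[of "Suc j"]
  by eventually_elim (rule tendsto_diff)

text \<open>At each level \<open>n\<close> the blocks are functions of disjoint groups of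
  independent increments, with \<open>W\<close> as one more group. Independence then passes to the
  almost sure limits.\<close>

lemma levy_blocks_indep:
  assumes W: "W \<in> borel_measurable M"
    and WL: "indep_set (sets (vimage_algebra (space M) W borel))
       (sigma_sets (space M) (\<Union>t\<in>{0..}. sets (vimage_algebra (space M) (L t) borel)))"
  shows "indep_vars (\<lambda>_. borel) (case_nat W (\<lambda>j w. I (Suc j) w - I j w)) UNIV"
proof (rule indep_vars_AE_limit[where X="\<lambda>n. case_nat W (B n)"])
  fix n
  let ?V = "\<lambda>k w. L (p n (Suc k)) w - L (p n k) w"
  let ?N = "sigma (space M) (\<Union>t\<in>{0..}. sets (vimage_algebra (space M) (L t) borel))"
  have E: "(\<Union>t\<in>{0..}. sets (vimage_algebra (space M) (L t) borel)) \<subseteq> Pow (space M)"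
    using sets.space_closed[of "vimage_algebra (space M) (L t) borel" for t] by fastforce
  have ind: "indep_vars (\<lambda>_. borel) (case_nat W ?V) UNIV"
  proof (rule indep_vars_case_nat[OF W, where N="?N"])
    show "indep_vars (\<lambda>_. borel) ?V UNIV" by (rule incr_indep[of "p n", OF eq_refl[OF p0[symmetric]] pS])
    show "?V k \<in> borel_measurable ?N" for k
      by (intro borel_measurable_diff L_measurable_generated p_nonneg)
    show "space ?N = space M" by (simp add: space_measure_of_conv)
    show "indep_set (sets (vimage_algebra (space M) W borel)) (sets ?N)"
      using WL E by simp
  qed
  \<comment> \<open>\<open>case_nat\<close> puts \<open>W\<close> at index \<open>0\<close>, so
    increment \<open>k\<close> sits at index \<open>Suc k\<close>. \<open>K\<close> lists the
    coordinates that each variable reads, and \<open>Y\<close> recombines them into \<open>W\<close>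
    and the blocks.\<close>
  define K where "K = (\<lambda>j. case j of 0 \<Rightarrow> {0} | Suc i \<Rightarrow> Suc ` {i * 2^n..<Suc i * 2^n})"
  define Y where "Y = (\<lambda>j g. case j of 0 \<Rightarrow> g 0 :: real | Suc i \<Rightarrow> (\<Sum>k\<in>{i * 2^n..<Suc i * 2^n}. exp (c * p n k) * g (Suc k)))"
  have disj: "disjoint_family_on K UNIV"
  proof -
    have "i = j" if "k \<in> {i * 2^n..<Suc i * 2^n}" "k \<in> {j * 2^n..<Suc j * 2^n}" for i j k :: nat
    proof -
      have "k div 2^n = i" "k div 2^n = j" using that by (auto intro!: div_nat_eqI simp: algebra_simps)
      then show ?thesis by simp
    qed
    then have blk: "{i * 2^n..<Suc i * 2^n} \<inter> {j * 2^n..<Suc j * 2^n} = {}" if "i \<noteq> j" for i j :: nat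
      using that by blast
    have "K i \<inter> K j = {}" if "i \<noteq> j" for i j
    proof (cases "i = 0 \<or> j = 0")
      case True
      then show ?thesis using that by (auto simp: K_def split: nat.split)
    next
      case False
      then obtain i' j' where ij: "i = Suc i'" "j = Suc j'" by (metis not0_implies_Suc)
      have "K i \<inter> K j = Suc ` ({i' * 2^n..<Suc i' * 2^n} \<inter> {j' * 2^n..<Suc j' * 2^n})"
        unfolding K_def ij by (simp only: nat.case image_Int[OF inj_Suc])
      also have "\<dots> = {}" using blk[of i' j'] that ij by (simp only: image_empty)
      finally show ?thesis .
    qed
    then show ?thesis unfolding disjoint_family_on_def by blast
  qed
  have Y: "Y j \<in> borel_measurable (PiM (K j) (\<lambda>_. borel))" for j
  proof (cases j)
    case 0
    then show ?thesis by (auto simp: Y_def K_def)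
  next
    case (Suc i)
    have "(\<lambda>g. exp (c * p n k) * g (Suc k)) \<in> borel_measurable (PiM (K j) (\<lambda>_. borel))"
      if "k \<in> {i * 2^n..<Suc i * 2^n}" for k
      using that Suc by (intro borel_measurable_times borel_measurable_const measurable_component_singleton) (auto simp: K_def)
    then show ?thesis unfolding Y_def Suc by (simp only: nat.case borel_measurable_sum)
  qed
  have "indep_vars (\<lambda>_. borel) (\<lambda>j w. Y j (restrict (\<lambda>i. case_nat W ?V i w) (K j))) UNIV"
    by (rule indep_vars_compose2[OF indep_vars_restrict[OF ind _ disj] Y]) simp
  also have "(\<lambda>j w. Y j (restrict (\<lambda>i. case_nat W ?V i w) (K j))) = case_nat W (B n)"
  proof (intro ext)
    fix j w
    show "Y j (restrict (\<lambda>i. case_nat W ?V i w) (K j)) = case_nat W (B n) j w"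
    proof (cases j)
      case (Suc i)
      show ?thesis unfolding Suc Y_def K_def B_def incr_def nat.case
        by (rule sum.cong[OF refl]) (simp only: restrict_apply' image_eqI nat.case)
    qed (simp add: Y_def K_def)
  qed
  finally show "indep_vars (\<lambda>_. borel) (case_nat W (B n)) UNIV" .
next
  show "case_nat W (\<lambda>j w. I (Suc j) w - I j w) i \<in> borel_measurable M" for i
    using W by (cases i) auto
  show "AE w in M. (\<lambda>n. case_nat W (B n) i w) \<longlonglongrightarrow> case_nat W (\<lambda>j w. I (Suc j) w - I j w) i w" for i
    using B_limit by (cases i) auto
qed

private lemma B_sum:
  "(\<Sum>k\<in>{j * 2^n..<Suc j * 2^n}. g (p n k) * (p n (Suc k) - p n k))
    = (\<Sum>i<2^n. g (t j + real i / 2^n * (t (Suc j) - t j)) * ((t (Suc j) - t j) / 2^n))"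
proof -
  have "{j * 2^n..<Suc j * 2^n} = {0 + j * 2^n..<2^n + j * 2^n}" by simp
  then have "(\<Sum>k\<in>{j * 2^n..<Suc j * 2^n}. g (p n k) * (p n (Suc k) - p n k))
    = (\<Sum>i\<in>{0..<2^n}. g (p n (i + j * 2^n)) * (p n (Suc (i + j * 2^n)) - p n (i + j * 2^n)))"
    by (simp only: sum.shift_bounds_nat_ivl)
  also have "\<dots> = (\<Sum>i<2^n. g (t j + real i / 2^n * (t (Suc j) - t j)) * ((t (Suc j) - t j) / 2^n))"
    unfolding lessThan_atLeast0
  proof (rule sum.cong[OF refl])
    fix i :: nat assume "i \<in> {0..<2^n}"
    then have i: "i < 2^n" by simp
    have "p n (i + j * 2^n) = t j + real i / 2^n * (t (Suc j) - t j)"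
      using dyadic_grid_add[OF i, of t j] by (simp add: p_def add.commute)
    moreover have "p n (Suc (i + j * 2^n)) - p n (i + j * 2^n) = (t (Suc j) - t j) / 2^n"
      using i unfolding p_def dyadic_grid_Suc by simp
    ultimately show "g (p n (i + j * 2^n)) * (p n (Suc (i + j * 2^n)) - p n (i + j * 2^n))
      = g (t j + real i / 2^n * (t (Suc j) - t j)) * ((t (Suc j) - t j) / 2^n)" by simp
  qed
  finally show ?thesis .
qed

text \<open>By convergence in mean square, mean and variance are limits of Riemann sums of
  \<open>exp (c * s)\<close> and \<open>exp (2 * c * s)\<close>. For the fourth moment a bound
  survives the limit by Fatou's lemma. It is uniform in the level because the weights are at most
  \<open>exp (|c| * t (Suc j))\<close> and \<open>fourth_moment_subdivide\<close> bounds the sum of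
  the \<open>2^n\<close> small fourth moments.\<close>

lemma levy_block_moments:
  fixes j :: nat
  defines "X \<equiv> (\<lambda>w. I (Suc j) w - I j w)"
  shows "X \<in> borel_measurable M" and "integrable M (\<lambda>w. X w^2)"
    and "expectation X = expectation (L 1) * ((exp (c * t (Suc j)) - exp (c * t j)) / c)"
    and "variance X = variance (L 1) * ((exp (2 * c * t (Suc j)) - exp (2 * c * t j)) / (2 * c))"
    and "integrable M (\<lambda>w. (X w - expectation X)^4)"
    and "expectation (\<lambda>w. (X w - expectation X)^4)
      \<le> exp (4 * \<bar>c\<bar> * t (Suc j)) * (m4 (t (Suc j) - t j) + 3 * (variance (L 1) * (t (Suc j) - t j))^2)"
proof -
  show [measurable]: "X \<in> borel_measurable M" unfolding X_def by measurable
  show X2: "integrable M (\<lambda>w. X w^2)"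
    unfolding X_def using integrable_power2_add[of "I (Suc j)" "\<lambda>w. - I j w"] S_limit(2) by simp
  define d where "d = t (Suc j) - t j"
  have d0: "0 \<le> d" using tS by (simp add: d_def)
  define J where "J = (\<lambda>n::nat. {j * 2^n..<Suc j * 2^n})"
  define a where "a = (\<lambda>n k. exp (c * p n k))"
  define e where "e = (\<lambda>n. expectation (L 1) * (\<Sum>k\<in>J n. a n k * (p n (Suc k) - p n k)))"
  define q where "q = (\<lambda>n. \<Sum>k\<in>J n. (a n k)^2 * (p n (Suc k) - p n k))"
  have B: "B n j w = (\<Sum>k\<in>J n. a n k * (L (p n (Suc k)) w - L (p n k) w))" for n w
    by (simp add: B_def incr_def J_def a_def)
  have e: "e n = expectation (L 1) * (\<Sum>k\<in>J n. a n k * (p n (Suc k) - p n k))"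
    and q: "q n = (\<Sum>k\<in>J n. (a n k)^2 * (p n (Suc k) - p n k))" for n
    by (simp_all add: e_def q_def)
  note WI = weighted_incr[of "p n" "J n" "a n" for n, OF eq_refl[OF p0[symmetric]] pS, folded B e q]
  have fin: "finite (J n)" for n by (simp add: J_def)
  note W = WI[OF fin]
  have wlim: "e \<longlonglongrightarrow> expectation (L 1) * ((exp (c * t (Suc j)) - exp (c * t j)) / c)"
    using sum_exp_dyadic[OF c, of "t j" d] unfolding e_def J_def a_def B_sum[of "\<lambda>x. exp (c * x)"] d_def
    by (intro tendsto_mult_left) simp
  have a2: "(a n k)^2 = exp (2 * c * p n k)" for n k
    by (simp add: a_def power2_eq_square flip: exp_add)
  have qlim: "q \<longlonglongrightarrow> (exp (2 * c * t (Suc j)) - exp (2 * c * t j)) / (2 * c)"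
    using sum_exp_dyadic[of "2 * c" "t j" d] c unfolding q_def J_def a2 B_sum[of "\<lambda>x. exp (2 * c * x)"] d_def
    by simp
  have L2: "(\<lambda>n. expectation (\<lambda>w. (X w - B n j w)^2)) \<longlonglongrightarrow> 0"
  proof (rule tendsto_sandwich[of "\<lambda>_. 0" _ _ "\<lambda>n. 2 * r (Suc j) n + 2 * r j n"])
    have i2: "integrable M (\<lambda>w. (I i w - S n i w)^2)" for i n
      using integrable_power2_add[of "I i" "\<lambda>w. - S n i w"] S_limit(2) S_integrable by simp
    have "expectation (\<lambda>w. (X w - B n j w)^2) \<le> 2 * r (Suc j) n + 2 * r j n" for n
    proof -
      have "(x - y)^2 \<le> 2 * x^2 + 2 * y^2" for x y :: real
      proof -
        have "0 \<le> (x + y)^2" by simp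
        then show ?thesis by (simp add: power2_diff power2_sum)
      qed
      note sq = this
      have le: "(X w - B n j w)^2 \<le> 2 * (I (Suc j) w - S n (Suc j) w)^2 + 2 * (I j w - S n j w)^2" for w
      proof -
        have "X w - B n j w = (I (Suc j) w - S n (Suc j) w) - (I j w - S n j w)"
          by (simp add: X_def B_eq)
        then show ?thesis by (simp only: sq)
      qed
      have "expectation (\<lambda>w. (X w - B n j w)^2)
        \<le> expectation (\<lambda>w. 2 * (I (Suc j) w - S n (Suc j) w)^2 + 2 * (I j w - S n j w)^2)"
      proof (rule integral_mono')
        show "integrable M (\<lambda>w. 2 * (I (Suc j) w - S n (Suc j) w)^2 + 2 * (I j w - S n j w)^2)"
          by (intro Bochner_Integration.integrable_add integrable_mult_right i2)
        show "(X w - B n j w)^2 \<le> 2 * (I (Suc j) w - S n (Suc j) w)^2 + 2 * (I j w - S n j w)^2" for w by (rule le)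
      qed auto
      also have "\<dots> = 2 * expectation (\<lambda>w. (I (Suc j) w - S n (Suc j) w)^2) + 2 * expectation (\<lambda>w. (I j w - S n j w)^2)"
        using i2 by simp
      also have "\<dots> \<le> 2 * r (Suc j) n + 2 * r j n"
        by (intro add_mono mult_left_mono S_limit(3)) auto
      finally show ?thesis .
    qed
    then show "\<forall>\<^sub>F n in sequentially. expectation (\<lambda>w. (X w - B n j w)^2) \<le> 2 * r (Suc j) n + 2 * r j n" by simp
    have "(\<lambda>n. 2 * r (Suc j) n + 2 * r j n) \<longlonglongrightarrow> 2 * 0 + 2 * 0"
      by (intro tendsto_add tendsto_mult_left summable_LIMSEQ_zero summable_r)
    then show "(\<lambda>n. 2 * r (Suc j) n + 2 * r j n) \<longlonglongrightarrow> 0" by simp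
  qed (auto intro!: always_eventually)
  note lim = L2_limit_moments[OF B_measurable \<open>X \<in> borel_measurable M\<close> W(4) X2 L2]
  have EX: "expectation X = expectation (L 1) * ((exp (c * t (Suc j)) - exp (c * t j)) / c)"
    using lim(1) wlim unfolding W(2) by (rule LIMSEQ_unique)
  then show "expectation X = expectation (L 1) * ((exp (c * t (Suc j)) - exp (c * t j)) / c)" .
  have "(\<lambda>n. variance (L 1) * q n + (e n)^2) \<longlonglongrightarrow>
      variance (L 1) * ((exp (2 * c * t (Suc j)) - exp (2 * c * t j)) / (2 * c)) + (expectation X)^2"
    unfolding EX by (intro tendsto_add tendsto_mult_left tendsto_power qlim wlim)
  with lim(2) have "expectation (\<lambda>w. X w^2)
      = variance (L 1) * ((exp (2 * c * t (Suc j)) - exp (2 * c * t j)) / (2 * c)) + (expectation X)^2"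
    unfolding W(6) by (rule LIMSEQ_unique)
  then show "variance X = variance (L 1) * ((exp (2 * c * t (Suc j)) - exp (2 * c * t j)) / (2 * c))"
    using variance_eq[OF integrable_of_power2[OF \<open>X \<in> borel_measurable M\<close> X2] X2] by simp
  have lim4: "AE w in M. (\<lambda>n. (B n j w - e n)^4) \<longlonglongrightarrow> (X w - expectation X)^4"
    using B_limit[of j] unfolding X_def[symmetric]
    by eventually_elim (intro tendsto_power tendsto_diff wlim[folded EX], simp add: X_def)
  define T where "T = t (Suc j)"
  have bnd: "expectation (\<lambda>w. (B n j w - e n)^4) \<le> exp (4 * \<bar>c\<bar> * T) * (m4 d + 3 * (variance (L 1) * d)^2)" for n
  proof -
    have ab: "a n k \<le> exp (\<bar>c\<bar> * T)" if "k \<in> J n" for k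
    proof -
      have "c * p n k \<le> \<bar>c * p n k\<bar>" by simp
      also have "\<dots> \<le> \<bar>c\<bar> * T" unfolding abs_mult T_def using p_nonneg p_le[of k "Suc j" n] that
        by (intro mult_left_mono) (auto simp: J_def)
      finally show ?thesis by (simp add: a_def)
    qed
    have pd: "p n (Suc k) - p n k = d / 2^n" if "k \<in> J n" for k
    proof -
      have "k div 2^n = j" using that by (intro div_nat_eqI) (auto simp: J_def algebra_simps)
      then show ?thesis by (simp add: p_def dyadic_grid_Suc d_def)
    qed
    have card: "card (J n) = 2^n" by (simp add: J_def)
    have m40: "0 \<le> m4 s" for s by (intro Bochner_Integration.integral_nonneg) simp
    have "(\<Sum>k\<in>J n. (a n k)^4 * m4 (p n (Suc k) - p n k)) \<le> (\<Sum>k\<in>J n. exp (\<bar>c\<bar> * T)^4 * m4 (d / 2^n))"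
      using ab m40 pd by (intro sum_mono mult_mono power_mono) (auto simp: a_def)
    also have "\<dots> = exp (\<bar>c\<bar> * T)^4 * (real (2^n) * m4 (d / real (2^n)))" by (simp add: card)
    also have "\<dots> \<le> exp (\<bar>c\<bar> * T)^4 * m4 d"
      by (intro mult_left_mono fourth_moment_subdivide d0) auto
    finally have 1: "(\<Sum>k\<in>J n. (a n k)^4 * m4 (p n (Suc k) - p n k)) \<le> exp (\<bar>c\<bar> * T)^4 * m4 d" .
    have q0: "0 \<le> q n" unfolding q_def using pS by (intro sum_nonneg) auto
    have "q n \<le> (\<Sum>k\<in>J n. exp (\<bar>c\<bar> * T)^2 * (d / 2^n))"
      unfolding q_def using ab pd d0 by (intro sum_mono mult_mono power_mono) (auto simp: a_def)
    also have "\<dots> = exp (\<bar>c\<bar> * T)^2 * d" by (simp add: card)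
    finally have "variance (L 1) * q n \<le> variance (L 1) * (exp (\<bar>c\<bar> * T)^2 * d)"
      by (intro mult_left_mono variance_positive)
    then have "(variance (L 1) * q n)^2 \<le> (variance (L 1) * (exp (\<bar>c\<bar> * T)^2 * d))^2"
      using q0 by (intro power_mono mult_nonneg_nonneg variance_positive)
    also have "\<dots> = exp (\<bar>c\<bar> * T)^4 * (variance (L 1) * d)^2"
      by (simp only: power_mult_distrib mult_ac flip: power_mult) simp
    finally have 2: "(variance (L 1) * q n)^2 \<le> exp (\<bar>c\<bar> * T)^4 * (variance (L 1) * d)^2" .
    have e4: "exp (\<bar>c\<bar> * T)^4 = exp (4 * \<bar>c\<bar> * T)" by (simp flip: exp_of_nat_mult)
    show ?thesis
      using W(7)[of n] 1 2 unfolding e4 distrib_left by linarith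
  qed
  note F = expectation_AE_limit_le[where f="\<lambda>n w. (B n j w - e n)^4" and g="\<lambda>w. (X w - expectation X)^4",
      OF W(3) _ _ _ lim4 always_eventually[OF allI[OF bnd]]]
  show "integrable M (\<lambda>w. (X w - expectation X)^4)" by (rule F(1)) auto
  have "expectation (\<lambda>w. (X w - expectation X)^4) \<le> exp (4 * \<bar>c\<bar> * T) * (m4 d + 3 * (variance (L 1) * d)^2)"
    by (rule F(2)) auto
  then show "expectation (\<lambda>w. (X w - expectation X)^4)
      \<le> exp (4 * \<bar>c\<bar> * t (Suc j)) * (m4 (t (Suc j) - t j) + 3 * (variance (L 1) * (t (Suc j) - t j))^2)"
    unfolding T_def d_def .
qed

end
end

subsection \<open>Averages of autoregressive sequences\<close>

lemma contraction_tendsto_zero: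
  fixes z b :: "nat \<Rightarrow> real"
  assumes z: "\<And>n. 0 \<le> z n" "\<And>n. z (Suc n) \<le> q * z n + b n" and q: "0 \<le> q" "q < 1"
    and b: "b \<longlonglongrightarrow> 0"
  shows "z \<longlonglongrightarrow> 0"
proof (rule LIMSEQ_I)
  fix e :: real assume e: "0 < e"
  \<comment> \<open>With this choice \<open>e / 2\<close> is the fixed point of the map sending
    \<open>x\<close> to \<open>q * x + d\<close>, so it persists through the induction while the
    initial value is damped by \<open>q^k\<close>.\<close>
  define d where "d = e * (1 - q) / 2"
  have d: "0 < d" using e q by (simp add: d_def)
  obtain N where N: "\<And>n. n \<ge> N \<Longrightarrow> b n < d"
    using order_tendstoD(2)[OF b d] by (auto simp: eventually_sequentially)
  have le: "z (N + k) \<le> q^k * z N + e / 2" for k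
  proof (induction k)
    case 0
    show ?case using e by simp
  next
    case (Suc k)
    have "z (N + Suc k) \<le> q * z (N + k) + d" using z(2)[of "N + k"] N[of "N + k"] by simp
    also have "\<dots> \<le> q * (q^k * z N + e / 2) + d" using Suc q by (intro add_right_mono mult_left_mono) auto
    also have "\<dots> = q^Suc k * z N + e / 2" by (simp add: d_def field_simps)
    finally show ?case .
  qed
  have "(\<lambda>k. q^k * z N) \<longlonglongrightarrow> 0 * z N" using q by (intro tendsto_mult_right LIMSEQ_power_zero) simp
  then have "\<forall>\<^sub>F k in sequentially. q^k * z N < e / 2" using e by (intro order_tendstoD(2)) auto
  then obtain K where K: "\<And>k. k \<ge> K \<Longrightarrow> q^k * z N < e / 2" by (auto simp: eventually_sequentially)
  show "\<exists>no. \<forall>n\<ge>no. norm (z n - 0) < e"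
  proof (intro exI allI impI)
    fix n assume n: "N + K \<le> n"
    then have "z n \<le> q^(n - N) * z N + e / 2" using le[of "n - N"] by simp
    also have "\<dots> < e"
    proof -
      have "q^(n - N) * z N < e / 2" using n by (intro K) simp
      then show ?thesis by linarith
    qed
    finally show "norm (z n - 0) < e" using z(1)[of n] by simp
  qed
qed

lemma tendsto_add_const_over_nat: "(\<lambda>n. (real n + c) / real n) \<longlonglongrightarrow> 1"
proof -
  have "(\<lambda>n. 1 + c / real n) \<longlonglongrightarrow> 1 + 0"
    by (intro tendsto_add tendsto_const tendsto_divide_0[OF tendsto_const] filterlim_at_top_imp_at_infinity filterlim_real_sequentially)
  moreover have "\<forall>\<^sub>F n in sequentially. 1 + c / real n = (real n + c) / real n"
    using eventually_gt_at_top[of 0] by eventually_elim (simp add: add_divide_distrib)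
  ultimately have "(\<lambda>n. (real n + c) / real n) \<longlonglongrightarrow> 1 + 0" by (rule Lim_transform_eventually)
  then show ?thesis by simp
qed

lemma divide_times_divide_cancel: "b \<noteq> 0 \<Longrightarrow> a / b * (b / c) = a / (c::real)"
  by simp

lemma average_term_tendsto_zero:
  fixes f :: "nat \<Rightarrow> real"
  assumes "(\<lambda>n. (\<Sum>i<n. f i) / real n) \<longlonglongrightarrow> l"
  shows "(\<lambda>n. f n / real n) \<longlonglongrightarrow> 0"
proof -
  have "(\<lambda>n. (\<Sum>i<Suc n. f i) / real (Suc n) * ((real n + 1) / real n) - (\<Sum>i<n. f i) / real n) \<longlonglongrightarrow> l * 1 - l"
    by (intro tendsto_diff tendsto_mult tendsto_add_const_over_nat LIMSEQ_Suc[OF assms] assms)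
  moreover have "\<forall>\<^sub>F n in sequentially. (\<Sum>i<Suc n. f i) / real (Suc n) * ((real n + 1) / real n) - (\<Sum>i<n. f i) / real n = f n / real n"
  \<comment> \<open>The identity includes \<open>n = 0\<close>, where both sides are
    \<open>0\<close> because division by zero gives \<open>0\<close>.\<close>
  proof (intro always_eventually allI)
    fix n
    have r: "real (Suc n) = real n + 1" and nz: "real n + 1 \<noteq> 0" by simp_all
    show "(\<Sum>i<Suc n. f i) / real (Suc n) * ((real n + 1) / real n) - (\<Sum>i<n. f i) / real n = f n / real n"
      unfolding r divide_times_divide_cancel[OF nz] unfolding sum.lessThan_Suc add_divide_distrib by simp
  qed
  ultimately have "(\<lambda>n. f n / real n) \<longlonglongrightarrow> l * 1 - l" by (rule Lim_transform_eventually)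
  then show ?thesis by simp
qed

lemma average_shift_terms:
  fixes f :: "nat \<Rightarrow> real"
  assumes "(\<lambda>n. (\<Sum>i<n. f i) / real n) \<longlonglongrightarrow> l"
  shows "(\<lambda>n. (\<Sum>i<n. f (i + h)) / real n) \<longlonglongrightarrow> l"
proof -
  have "(\<lambda>n. (\<Sum>i<n + h. f i) / real (n + h) * ((real n + real h) / real n) - (\<Sum>i<h. f i) / real n) \<longlonglongrightarrow> l * 1 - 0"
    by (intro tendsto_diff tendsto_mult tendsto_add_const_over_nat LIMSEQ_ignore_initial_segment[OF assms]
        tendsto_divide_0[OF tendsto_const] filterlim_at_top_imp_at_infinity filterlim_real_sequentially)
  moreover have "\<forall>\<^sub>F n in sequentially. (\<Sum>i<n + h. f i) / real (n + h) * ((real n + real h) / real n) - (\<Sum>i<h. f i) / real n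
      = (\<Sum>i<n. f (i + h)) / real n"
    using eventually_gt_at_top[of 0]
  proof eventually_elim
    case (elim n)
    have S: "(\<Sum>i<n + h. f i) = (\<Sum>i<h. f i) + (\<Sum>i<n. f (i + h))"
      by (induction n) (auto simp: algebra_simps)
    have r: "real (n + h) = real n + real h" and nz: "real n + real h \<noteq> 0" using elim by simp_all
    show ?case unfolding S r divide_times_divide_cancel[OF nz] unfolding add_divide_distrib by simp
  qed
  ultimately have "(\<lambda>n. (\<Sum>i<n. f (i + h)) / real n) \<longlonglongrightarrow> l * 1 - 0" by (rule Lim_transform_eventually)
  then show ?thesis by simp
qed

text \<open>Passes from sums over \<open>{..<n}\<close> to the index range of the sample statistics.
  Replacing \<open>n\<close> by \<open>n + h\<close> removes the truncated subtraction, and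
  \<open>(n + h) / n\<close> tends to \<open>1\<close>.\<close>

lemma average_truncate:
  fixes f :: "nat \<Rightarrow> real"
  assumes "(\<lambda>n. (\<Sum>i<n. f i) / real n) \<longlonglongrightarrow> l"
  shows "(\<lambda>n. (\<Sum>i=1..n - h. f i) / real n) \<longlonglongrightarrow> l"
proof (rule LIMSEQ_offset[where k=h])
  have "(\<lambda>n. (\<Sum>i<n. f (i + 1)) / real n * (1 / ((real n + real h) / real n))) \<longlonglongrightarrow> l * (1 / 1)"
    by (intro tendsto_mult tendsto_divide tendsto_const tendsto_add_const_over_nat average_shift_terms[OF assms]) simp
  moreover have "\<forall>\<^sub>F n in sequentially. (\<Sum>i<n. f (i + 1)) / real n * (1 / ((real n + real h) / real n))
      = (\<Sum>i=1..n + h - h. f i) / real (n + h)"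
    using eventually_gt_at_top[of 0]
  proof eventually_elim
    case (elim n)
    have "(\<Sum>i=1..n. f i) = (\<Sum>i<n. f (i + 1))" by (induction n) auto
    then show ?case using elim by simp
  qed
  ultimately have "(\<lambda>n. (\<Sum>i=1..n + h - h. f i) / real (n + h)) \<longlonglongrightarrow> l * (1 / 1)"
    by (rule Lim_transform_eventually)
  then show "(\<lambda>n. (\<Sum>i=1..n + h - h. f i) / real (n + h)) \<longlonglongrightarrow> l" by simp
qed

text \<open>A statement about one sequence, to be applied path by path. Solving the summed
  recursions leaves boundary terms \<open>y n / n\<close> and \<open>(y n)^2 / n\<close>.
  Convergence of the averages of \<open>(e i)^2\<close> makes \<open>(e n)^2 / n\<close> vanish in
  the limit, and the contraction \<open>|\<theta>| < 1\<close> hands this over to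
  \<open>y\<close>.\<close>

lemma autoregressive_averages:
  fixes y :: "nat \<Rightarrow> real" and \<theta> s :: real
  defines "e \<equiv> (\<lambda>i. y (Suc i) - \<theta> * y i)"
  assumes \<theta>: "\<bar>\<theta>\<bar> < 1"
    and e1: "(\<lambda>n. (\<Sum>i<n. e i) / real n) \<longlonglongrightarrow> 0"
    and e2: "(\<lambda>n. (\<Sum>i<n. (e i)^2 - s) / real n) \<longlonglongrightarrow> 0"
    and ye: "\<And>h. (\<lambda>n. (\<Sum>i<n. y i * e (i + h)) / real n) \<longlonglongrightarrow> 0"
  shows "(\<lambda>n. (\<Sum>i<n. y i) / real n) \<longlonglongrightarrow> 0"
    and "(\<lambda>n. (\<Sum>i<n. y (i + h) * y i) / real n) \<longlonglongrightarrow> \<theta>^h * (s / (1 - \<theta>^2))"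
proof -
  have inv: "(\<lambda>n. c / real n) \<longlonglongrightarrow> 0" for c
    by (intro tendsto_divide_0[OF tendsto_const] filterlim_at_top_imp_at_infinity filterlim_real_sequentially)
  have ySuc: "y (Suc i) = \<theta> * y i + e i" for i by (simp add: e_def)
  have "(\<lambda>n. ((e n)^2 - s) / real n + s / real n) \<longlonglongrightarrow> 0 + 0"
    by (intro tendsto_add inv average_term_tendsto_zero[OF e2])
  then have "(\<lambda>n. (e n)^2 / real n) \<longlonglongrightarrow> 0" by (simp add: diff_divide_distrib)
  then have "(\<lambda>n. sqrt ((e n)^2 / real n)) \<longlonglongrightarrow> sqrt 0" by (rule tendsto_real_sqrt)
  then have en: "(\<lambda>n. sqrt ((e n)^2 / real n)) \<longlonglongrightarrow> 0" by simp
  define z where "z = (\<lambda>n. \<bar>y n\<bar> / sqrt (real n))"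
  \<comment> \<open>The recursion is started at index \<open>1\<close>: by division by zero
    \<open>z 0\<close> is \<open>0\<close> whatever \<open>y 0\<close> is, and the contraction
    inequality may fail there.\<close>
  have "(\<lambda>n. z (Suc n)) \<longlonglongrightarrow> 0"
  proof (rule contraction_tendsto_zero[where q="\<bar>\<theta>\<bar>" and b="\<lambda>n. sqrt ((e (Suc n))^2 / real (Suc n))"])
    fix n
    have "z (Suc (Suc n)) \<le> \<bar>y (Suc (Suc n))\<bar> / sqrt (real (Suc n))"
      unfolding z_def by (intro divide_left_mono) auto
    also have "\<dots> \<le> (\<bar>\<theta>\<bar> * \<bar>y (Suc n)\<bar> + \<bar>e (Suc n)\<bar>) / sqrt (real (Suc n))"
      unfolding ySuc[of "Suc n"] using abs_triangle_ineq[of "\<theta> * y (Suc n)" "e (Suc n)"]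
      by (intro divide_right_mono) (auto simp: abs_mult)
    also have "\<dots> = \<bar>\<theta>\<bar> * z (Suc n) + sqrt ((e (Suc n))^2 / real (Suc n))"
      by (simp add: z_def add_divide_distrib real_sqrt_divide)
    finally show "z (Suc (Suc n)) \<le> \<bar>\<theta>\<bar> * z (Suc n) + sqrt ((e (Suc n))^2 / real (Suc n))" .
    show "0 \<le> z (Suc n)" by (simp add: z_def)
  qed (use \<theta> LIMSEQ_Suc[OF en] in auto)
  then have "z \<longlonglongrightarrow> 0" by (rule LIMSEQ_imp_Suc)
  then have "(\<lambda>n. (z n)^2) \<longlonglongrightarrow> 0^2" by (intro tendsto_power)
  then have y2: "(\<lambda>n. (y n)^2 / real n) \<longlonglongrightarrow> 0" by (simp add: z_def power_divide)
  have y1: "(\<lambda>n. y n / real n) \<longlonglongrightarrow> 0"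
  proof (rule Lim_null_comparison[OF always_eventually])
    show "(\<lambda>n. 1 / real n + (y n)^2 / real n) \<longlonglongrightarrow> 0" using tendsto_add[OF inv[of 1] y2] by simp
    have "\<bar>x\<bar> \<le> 1 + x^2" for x :: real
    proof -
      have "0 \<le> (\<bar>x\<bar> - 1)^2" by simp
      then have "2 * \<bar>x\<bar> \<le> 1 + x^2" by (simp add: power2_diff)
      then show ?thesis by simp
    qed
    then show "\<forall>n. norm (y n / real n) \<le> 1 / real n + (y n)^2 / real n"
      by (auto simp: divide_right_mono simp flip: add_divide_distrib)
  qed
  have "(\<Sum>i<n. y (Suc i)) = (\<Sum>i<n. y i) + y n - y 0" for n by (induction n) auto
  then have S1: "(1 - \<theta>) * (\<Sum>i<n. y i) = (\<Sum>i<n. e i) - y n + y 0" for n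
    by (simp add: e_def sum_subtractf algebra_simps flip: sum_distrib_left)
  have \<theta>1: "1 - \<theta> \<noteq> 0" using \<theta> by auto
  have "(\<lambda>n. ((\<Sum>i<n. e i) / real n - y n / real n + y 0 / real n) / (1 - \<theta>)) \<longlonglongrightarrow> (0 - 0 + 0) / (1 - \<theta>)"
    by (intro tendsto_divide tendsto_add tendsto_diff e1 y1 inv tendsto_const \<theta>1)
  moreover have "((\<Sum>i<n. e i) / real n - y n / real n + y 0 / real n) / (1 - \<theta>) = (\<Sum>i<n. y i) / real n" for n
  proof -
    have "((\<Sum>i<n. e i) / real n - y n / real n + y 0 / real n) / (1 - \<theta>) = ((1 - \<theta>) * (\<Sum>i<n. y i)) / real n / (1 - \<theta>)"
      unfolding S1 by (simp only: add_divide_distrib diff_divide_distrib)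
    also have "\<dots> = (\<Sum>i<n. y i) / real n" using \<theta>1 by simp
    finally show ?thesis .
  qed
  ultimately show "(\<lambda>n. (\<Sum>i<n. y i) / real n) \<longlonglongrightarrow> 0" by simp
  have \<theta>2: "1 - \<theta>^2 \<noteq> 0" using \<theta> by (simp add: abs_square_less_1[symmetric])
  have "(\<Sum>i<n. (y (Suc i))^2) = (\<Sum>i<n. (y i)^2) + (y n)^2 - (y 0)^2" for n by (induction n) auto
  moreover have "(y (Suc i))^2 = \<theta>^2 * (y i)^2 + 2 * \<theta> * (y i * e i) + ((e i)^2 - s) + s" for i
    by (simp add: ySuc power2_eq_square algebra_simps)
  then have "(\<Sum>i<n. (y (Suc i))^2) = \<theta>^2 * (\<Sum>i<n. (y i)^2) + 2 * \<theta> * (\<Sum>i<n. y i * e i) + (\<Sum>i<n. (e i)^2 - s) + real n * s" for n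
    by (simp only: sum.distrib sum_distrib_left sum_constant card_lessThan)
  ultimately have S2: "(1 - \<theta>^2) * (\<Sum>i<n. (y i)^2)
      = 2 * \<theta> * (\<Sum>i<n. y i * e i) + (\<Sum>i<n. (e i)^2 - s) + real n * s - (y n)^2 + (y 0)^2" for n
    by (simp add: left_diff_distrib algebra_simps)
  have "(\<lambda>n. (2 * \<theta> * ((\<Sum>i<n. y i * e i) / real n) + (\<Sum>i<n. (e i)^2 - s) / real n + s - (y n)^2 / real n + (y 0)^2 / real n) / (1 - \<theta>^2))
      \<longlonglongrightarrow> (2 * \<theta> * 0 + 0 + s - 0 + 0) / (1 - \<theta>^2)"
    using ye[of 0] by (intro tendsto_divide tendsto_add tendsto_diff tendsto_mult_left e2 y2 inv tendsto_const \<theta>2) simp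
  moreover have "\<forall>\<^sub>F n in sequentially. (2 * \<theta> * ((\<Sum>i<n. y i * e i) / real n) + (\<Sum>i<n. (e i)^2 - s) / real n + s - (y n)^2 / real n + (y 0)^2 / real n) / (1 - \<theta>^2)
      = (\<Sum>i<n. y i * y i) / real n"
    using eventually_gt_at_top[of 0]
  proof eventually_elim
    case (elim n)
    have "2 * \<theta> * ((\<Sum>i<n. y i * e i) / real n) + (\<Sum>i<n. (e i)^2 - s) / real n + s - (y n)^2 / real n + (y 0)^2 / real n
      = (1 - \<theta>^2) * (\<Sum>i<n. (y i)^2) / real n"
      unfolding S2 using elim by (simp add: add_divide_distrib diff_divide_distrib)
    then show ?case using \<theta>2 by (simp add: power2_eq_square)
  qed
  ultimately have "(\<lambda>n. (\<Sum>i<n. y i * y i) / real n) \<longlonglongrightarrow> (2 * \<theta> * 0 + 0 + s - 0 + 0) / (1 - \<theta>^2)"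
    by (rule Lim_transform_eventually)
  then have P0: "(\<lambda>n. (\<Sum>i<n. y i * y i) / real n) \<longlonglongrightarrow> s / (1 - \<theta>^2)" by simp
  show "(\<lambda>n. (\<Sum>i<n. y (i + h) * y i) / real n) \<longlonglongrightarrow> \<theta>^h * (s / (1 - \<theta>^2))"
  proof (induction h)
    case 0
    show ?case using P0 by simp
  next
    case (Suc h)
    have "(\<lambda>n. \<theta> * ((\<Sum>i<n. y (i + h) * y i) / real n) + (\<Sum>i<n. y i * e (i + h)) / real n)
        \<longlonglongrightarrow> \<theta> * (\<theta>^h * (s / (1 - \<theta>^2))) + 0"
      by (intro tendsto_add tendsto_mult_left Suc ye)
    moreover have "\<theta> * ((\<Sum>i<n. y (i + h) * y i) / real n) + (\<Sum>i<n. y i * e (i + h)) / real n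
        = (\<Sum>i<n. y (i + Suc h) * y i) / real n" for n
      by (simp add: ySuc sum.distrib sum_distrib_left algebra_simps flip: add_divide_distrib)
    ultimately show ?case by (simp add: mult.assoc)
  qed
qed

text \<open>The sample mean is \<open>\<mu> + m n\<close> with \<open>m n\<close> tending to
  \<open>0\<close>. Centring at it instead of at \<open>\<mu>\<close> changes the averaged products
  only by terms that contain a factor \<open>m n\<close> and a bounded average.\<close>

lemma sample_statistics_limits:
  fixes x y :: "nat \<Rightarrow> real"
  assumes x: "\<And>i. x i = \<mu> + y i"
    and y1: "(\<lambda>n. (\<Sum>i<n. y i) / real n) \<longlonglongrightarrow> 0"
    and y2: "(\<lambda>n. (\<Sum>i<n. y (i + h) * y i) / real n) \<longlonglongrightarrow> g"
  shows "(\<lambda>n. sample_mean x n) \<longlonglongrightarrow> \<mu>" and "(\<lambda>n. sample_autocov x n h) \<longlonglongrightarrow> g"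
proof -
  define m where "m = (\<lambda>n. (\<Sum>i=1..n. y i) / real n)"
  have m: "m \<longlonglongrightarrow> 0" using average_truncate[OF y1, of 0] by (simp add: m_def)
  have mean: "sample_mean x n = \<mu> + m n" if "n > 0" for n
    using that by (simp add: sample_mean_def x sum.distrib m_def add_divide_distrib)
  have "(\<lambda>n. \<mu> + m n) \<longlonglongrightarrow> \<mu> + 0" by (intro tendsto_add tendsto_const m)
  moreover have "\<forall>\<^sub>F n in sequentially. \<mu> + m n = sample_mean x n"
    using eventually_gt_at_top[of 0] by eventually_elim (simp add: mean)
  ultimately have "(\<lambda>n. sample_mean x n) \<longlonglongrightarrow> \<mu> + 0" by (rule Lim_transform_eventually)
  then show "(\<lambda>n. sample_mean x n) \<longlonglongrightarrow> \<mu>" by simp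
  have "(\<lambda>n. (\<Sum>i=1..n - h. y (i + h) * y i) / real n
      - m n * ((\<Sum>i=1..n - h. y (i + h)) / real n + (\<Sum>i=1..n - h. y i) / real n)
      + (m n)^2 * ((\<Sum>i=1..n - h. 1) / real n)) \<longlonglongrightarrow> g - 0 * (0 + 0) + 0^2 * 1"
  proof -
    have "(\<lambda>n. (real n + 0) / real n) \<longlonglongrightarrow> 1" by (rule tendsto_add_const_over_nat)
    then have "(\<lambda>n. (\<Sum>i<n. 1) / real n) \<longlonglongrightarrow> 1" by simp
    note one = average_truncate[OF this, of h]
    show ?thesis
      by (rule tendsto_add[OF tendsto_diff[OF average_truncate[OF y2] tendsto_mult[OF m
            tendsto_add[OF average_truncate[OF average_shift_terms[OF y1]] average_truncate[OF y1]]]]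
            tendsto_mult[OF tendsto_power[OF m] one]])
  qed
  moreover have "\<forall>\<^sub>F n in sequentially. (\<Sum>i=1..n - h. y (i + h) * y i) / real n
      - m n * ((\<Sum>i=1..n - h. y (i + h)) / real n + (\<Sum>i=1..n - h. y i) / real n)
      + (m n)^2 * ((\<Sum>i=1..n - h. 1) / real n) = sample_autocov x n h"
    using eventually_gt_at_top[of 0]
  proof eventually_elim
    case (elim n)
    have "(x (i + h) - sample_mean x n) * (x i - sample_mean x n)
        = y (i + h) * y i - m n * (y (i + h) + y i) + (m n)^2 * 1" for i
      by (simp add: mean[OF elim] x power2_eq_square algebra_simps)
    then have "(\<Sum>i=1..n - h. (x (i + h) - sample_mean x n) * (x i - sample_mean x n))
        = (\<Sum>i=1..n - h. y (i + h) * y i) - m n * ((\<Sum>i=1..n - h. y (i + h)) + (\<Sum>i=1..n - h. y i)) + (m n)^2 * (\<Sum>i=1..n - h. 1)"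
      by (simp only: sum.distrib sum_subtractf sum_distrib_left[symmetric])
    then show ?case
      by (simp add: sample_autocov_def add_divide_distrib diff_divide_distrib distrib_left)
  qed
  ultimately have "(\<lambda>n. sample_autocov x n h) \<longlonglongrightarrow> g - 0 * (0 + 0) + 0^2 * 1" by (rule Lim_transform_eventually)
  then show "(\<lambda>n. sample_autocov x n h) \<longlonglongrightarrow> g" by simp
qed

text \<open>Written as a functional of the whole innovation sequence: its value at time
  \<open>n\<close> is then a measurable function of the coordinates up to \<open>n\<close>, the form
  in which \<open>indep_var_past\<close> separates the past from a later innovation.\<close>

primrec ar_rec :: "real \<Rightarrow> (nat \<Rightarrow> real) \<Rightarrow> nat \<Rightarrow> real" where
  "ar_rec \<theta> x 0 = x 0"
| "ar_rec \<theta> x (Suc n) = \<theta> * ar_rec \<theta> x n + x (Suc n)"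

lemma ar_rec_restrict: "n \<le> m \<Longrightarrow> ar_rec \<theta> (restrict x {..m}) n = ar_rec \<theta> x n"
  by (induction n) auto

lemma measurable_ar_rec:
  "n \<le> m \<Longrightarrow> (\<lambda>x. ar_rec \<theta> x n) \<in> borel_measurable (PiM {..m} (\<lambda>_. borel))"
proof (induction n)
  case 0
  then show ?case by (auto intro!: measurable_component_singleton)
next
  case (Suc n)
  have "(\<lambda>x. x (Suc n)) \<in> borel_measurable (PiM {..m} (\<lambda>_. borel :: real measure))"
    using Suc.prems by (intro measurable_component_singleton) auto
  with Suc show ?case by (simp add: borel_measurable_add borel_measurable_times)
qed

context prob_space
begin

lemma indep_var_past:
  fixes X :: "nat \<Rightarrow> 'a \<Rightarrow> real" and G :: "(nat \<Rightarrow> real) \<Rightarrow> real"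
  assumes ind: "indep_vars (\<lambda>_. borel) X UNIV" and mn: "m < n"
    and G: "G \<in> borel_measurable (PiM {..m} (\<lambda>_. borel))"
  shows "indep_var borel (\<lambda>w. G (restrict (\<lambda>k. X k w) {..m})) borel (X n)"
proof -
  have "indep_var (PiM {..m} (\<lambda>_. borel)) (\<lambda>w. restrict (\<lambda>i. X i w) {..m}) (PiM {n} (\<lambda>_. borel)) (\<lambda>w. restrict (\<lambda>i. X i w) {n})"
    using mn by (intro indep_var_restrict[OF ind]) auto
  from indep_var_compose[OF this G, where ?Y2.0="\<lambda>f. f n" and ?N2.0=borel]
  show ?thesis by (simp add: comp_def measurable_component_singleton)
qed

text \<open>Fourth moments are asked of the innovations alone. For \<open>y\<close> bounded second
  moments are enough, since in the strong law \<open>y i\<close> occurs only multiplied by a later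
  innovation, which is independent of it.\<close>

lemma autoregressive_AE:
  fixes X :: "nat \<Rightarrow> 'a \<Rightarrow> real" and \<theta> s C :: real
  assumes ind: "indep_vars (\<lambda>_. borel) X UNIV" and \<theta>: "\<bar>\<theta>\<bar> < 1"
    and X0: "integrable M (\<lambda>w. X 0 w^2)"
    and X4: "\<And>i. integrable M (\<lambda>w. X (Suc i) w^4)" "\<And>i. expectation (\<lambda>w. X (Suc i) w^4) \<le> C"
    and X1: "\<And>i. expectation (X (Suc i)) = 0" and X2: "\<And>i. expectation (\<lambda>w. X (Suc i) w^2) = s"
  defines "y \<equiv> (\<lambda>w. ar_rec \<theta> (\<lambda>k. X k w))"
  shows "AE w in M. (\<lambda>n. (\<Sum>i<n. y w i) / real n) \<longlonglongrightarrow> 0 \<and>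
    (\<forall>h. (\<lambda>n. (\<Sum>i<n. y w (i + h) * y w i) / real n) \<longlonglongrightarrow> \<theta>^h * (s / (1 - \<theta>^2)))"
proof -
  have Xm[measurable]: "X i \<in> borel_measurable M" for i using ind by (simp add: indep_vars_def)
  have ym[measurable]: "(\<lambda>w. y w i) \<in> borel_measurable M" for i
    unfolding y_def by (induction i) auto
  have Xsq: "integrable M (\<lambda>w. X i w^2)" for i
    using X0 integrable_power2_of_power4[OF Xm X4(1)] by (cases i) auto
  have Xint: "integrable M (X i)" for i by (rule integrable_of_power2[OF Xm Xsq])
  have past: "indep_var borel (\<lambda>w. y w i) borel (X n)" if "i < n" for i n
    using indep_var_past[OF ind that measurable_ar_rec[of i i \<theta>]] by (simp add: y_def ar_rec_restrict)
  have ysq: "integrable M (\<lambda>w. (y w i)^2)" for i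
  proof (induction i)
    case 0
    show ?case using X0 by (simp add: y_def)
  next
    case (Suc i)
    have "integrable M (\<lambda>w. (\<theta> * y w i + X (Suc i) w)^2)"
      using Suc Xsq by (intro integrable_power2_add) (auto simp: power_mult_distrib)
    then show ?case by (simp add: y_def)
  qed
  have yint: "integrable M (\<lambda>w. y w i)" for i by (rule integrable_of_power2[OF ym ysq])
  have \<theta>2: "\<theta>^2 < 1" using \<theta> by (simp add: abs_square_less_1)
  \<comment> \<open>\<open>s / (1 - \<theta>^2)\<close> is the fixed point of the recursion for
    second moments, which multiplies by \<open>\<theta>^2\<close> and adds \<open>s\<close>. Adding
    the second moment of \<open>X 0\<close> covers the start, and the recursion keeps values below
    this sum.\<close>
  define Q where "Q = expectation (\<lambda>w. X 0 w^2) + s / (1 - \<theta>^2)"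
  have s0: "0 \<le> s" unfolding X2[of 0, symmetric] by (intro Bochner_Integration.integral_nonneg) simp
  have yQ: "expectation (\<lambda>w. (y w i)^2) \<le> Q" for i
  proof (induction i)
    case 0
    show ?case using s0 \<theta>2 by (simp add: Q_def y_def)
  next
    case (Suc i)
    have i1: "integrable M (\<lambda>w. y w i * X (Suc i) w)"
      by (rule indep_var_integrable[OF past yint Xint]) simp
    have "expectation (\<lambda>w. y w i * X (Suc i) w) = 0"
      using indep_var_lebesgue_integral[OF past[of i "Suc i"] yint Xint] X1 by simp
    moreover have "(y w (Suc i))^2 = \<theta>^2 * (y w i)^2 + 2 * \<theta> * (y w i * X (Suc i) w) + X (Suc i) w^2" for w
      by (simp add: y_def power2_eq_square algebra_simps)
    ultimately have "expectation (\<lambda>w. (y w (Suc i))^2) = \<theta>^2 * expectation (\<lambda>w. (y w i)^2) + s"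
      using ysq[of i] Xsq[of "Suc i"] i1 X2[of i] by simp
    also have "\<dots> \<le> \<theta>^2 * Q + s" using Suc by (intro add_right_mono mult_left_mono) auto
    also have "\<dots> = \<theta>^2 * expectation (\<lambda>w. X 0 w^2) + s / (1 - \<theta>^2)"
      using \<theta>2 by (simp add: Q_def field_simps)
    also have "\<dots> \<le> Q"
      unfolding Q_def using \<theta>2 by (intro add_right_mono mult_left_le_one_le Bochner_Integration.integral_nonneg) auto
    finally show ?case .
  qed
  have A: "AE w in M. (\<lambda>n. (\<Sum>i<n. X (Suc i) w) / real n) \<longlonglongrightarrow> 0"
  proof (rule orthogonal_slln[where C=s])
    fix i j :: nat assume "i < j"
    have "indep_var borel (\<lambda>w. (\<lambda>x. x (Suc i)) (restrict (\<lambda>k. X k w) {..Suc i})) borel (X (Suc j))"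
      using \<open>i < j\<close> by (intro indep_var_past[OF ind] measurable_component_singleton) auto
    then have "indep_var borel (X (Suc i)) borel (X (Suc j))" by simp
    then show "expectation (\<lambda>w. X (Suc i) w * X (Suc j) w) = 0"
      using indep_var_lebesgue_integral[OF _ Xint Xint] X1 by simp
  qed (use Xsq X2 in auto)
  have B: "AE w in M. (\<lambda>n. (\<Sum>i<n. (X (Suc i) w)^2 - s) / real n) \<longlonglongrightarrow> 0"
  proof (rule orthogonal_slln[where C=C])
    have sq: "((X (Suc i) w)^2 - s)^2 = X (Suc i) w^4 - 2 * s * X (Suc i) w^2 + s^2" for i w
      by (simp add: power2_eq_square power4_eq_xxxx algebra_simps)
    show i2: "integrable M (\<lambda>w. ((X (Suc i) w)^2 - s)^2)" for i
      unfolding sq using X4 Xsq by simp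
    show "expectation (\<lambda>w. ((X (Suc i) w)^2 - s)^2) \<le> C" for i
    proof -
      have "expectation (\<lambda>w. ((X (Suc i) w)^2 - s)^2) = expectation (\<lambda>w. X (Suc i) w^4) - s^2"
        unfolding sq using X4(1)[of i] Xsq[of "Suc i"] X2[of i] by (simp add: prob_space power2_eq_square)
      then show ?thesis using X4(2)[of i] zero_le_power2[of s] by linarith
    qed
    fix i j :: nat assume "i < j"
    have "indep_var borel (\<lambda>w. (\<lambda>x. x (Suc i)) (restrict (\<lambda>k. X k w) {..Suc i})) borel (X (Suc j))"
      using \<open>i < j\<close> by (intro indep_var_past[OF ind] measurable_component_singleton) auto
    then have "indep_var borel (X (Suc i)) borel (X (Suc j))" by simp
    then have "indep_var borel ((\<lambda>x. x^2 - s) \<circ> X (Suc i)) borel ((\<lambda>x. x^2 - s) \<circ> X (Suc j))"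
      by (rule indep_var_compose) auto
    then have "indep_var borel (\<lambda>w. X (Suc i) w^2 - s) borel (\<lambda>w. X (Suc j) w^2 - s)" by (simp add: comp_def)
    moreover have i: "integrable M (\<lambda>w. X (Suc k) w^2 - s)" and z: "expectation (\<lambda>w. X (Suc k) w^2 - s) = 0" for k
      using Xsq X2 by (auto simp: prob_space)
    ultimately show "expectation (\<lambda>w. (X (Suc i) w^2 - s) * (X (Suc j) w^2 - s)) = 0"
      by (subst indep_var_lebesgue_integral) (auto simp only: z mult_zero_left)
  qed auto
  have C: "AE w in M. (\<lambda>n. (\<Sum>i<n. y w i * X (Suc (i + h)) w) / real n) \<longlonglongrightarrow> 0" for h
  proof (rule orthogonal_slln[where C="Q * s"])
    have ind2: "indep_var borel (\<lambda>w. (y w i)^2) borel (\<lambda>w. X (Suc (i + h)) w^2)" for i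
      using indep_var_compose[OF past[of i "Suc (i + h)"], of "\<lambda>x. x^2" borel "\<lambda>x. x^2" borel] by (simp add: comp_def)
    show D2: "integrable M (\<lambda>w. (y w i * X (Suc (i + h)) w)^2)" for i
      unfolding power_mult_distrib by (rule indep_var_integrable[OF ind2 ysq Xsq])
    show "expectation (\<lambda>w. (y w i * X (Suc (i + h)) w)^2) \<le> Q * s" for i
      unfolding power_mult_distrib indep_var_lebesgue_integral[OF ind2 ysq Xsq] X2
      using yQ s0 by (intro mult_right_mono)
    fix i j :: nat assume ij: "i < j"
    \<comment> \<open>Since \<open>i < j\<close>, these three factors involve innovations of index
      at most \<open>j + h\<close> only. Their product is therefore independent of the centred
      innovation \<open>X (Suc (j + h))\<close>, which makes the expectation of the full product
      vanish.\<close>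
    let ?G = "\<lambda>x. ar_rec \<theta> x i * x (Suc (i + h)) * ar_rec \<theta> x j"
    have G: "?G \<in> borel_measurable (PiM {..j + h} (\<lambda>_. borel))"
      using ij by (intro borel_measurable_times measurable_ar_rec measurable_component_singleton) auto
    have "indep_var borel (\<lambda>w. ?G (restrict (\<lambda>k. X k w) {..j + h})) borel (X (Suc (j + h)))"
      by (rule indep_var_past[OF ind _ G]) simp
    then have ind3: "indep_var borel (\<lambda>w. y w i * X (Suc (i + h)) w * y w j) borel (X (Suc (j + h)))"
      using ij by (simp add: ar_rec_restrict y_def)
    have "integrable M (\<lambda>w. y w i * X (Suc (i + h)) w * y w j)"
      by (rule integrable_mult_of_power2[OF _ ym D2 ysq]) measurable
    from indep_var_lebesgue_integral[OF ind3 this Xint] X1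
    show "expectation (\<lambda>w. y w i * X (Suc (i + h)) w * (y w j * X (Suc (j + h)) w)) = 0"
      by (simp add: mult.assoc)
  qed measurable
  have C': "AE w in M. \<forall>h. (\<lambda>n. (\<Sum>i<n. y w i * X (Suc (i + h)) w) / real n) \<longlonglongrightarrow> 0"
    using C by (subst AE_all_countable) blast
  from A B C' show ?thesis
  proof eventually_elim
    case (elim w)
    have e: "y w (Suc i) - \<theta> * y w i = X (Suc i) w" for i by (simp add: y_def)
    note R = autoregressive_averages[OF \<theta>, of "y w" s, unfolded e, OF elim(1) elim(2) elim(3)[rule_format]]
    show ?case using R by blast
  qed
qed

end

subsection \<open>The stationary Ornstein--Uhlenbeck process\<close>

context levy_power4
begin

text \<open>The integral from \<open>n\<close> to \<open>m\<close> has a second moment of order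
  \<open>exp (- 2 * n)\<close>, summable over integer \<open>n\<close>. The limit in probability is
  thus also one in mean square, and the moments are limits of those of blocks with
  \<open>c = - 1\<close>.\<close>

lemma levy_integral_to_infinity_moments:
  assumes Z: "has_levy_integral_to_infinity M L (\<lambda>s. exp (- s)) Z"
  shows "Z \<in> borel_measurable M" and "integrable M (\<lambda>w. Z w^2)"
    and "expectation Z = expectation (L 1)" and "variance Z = variance (L 1) / 2"
proof -
  show Zm[measurable]: "Z \<in> borel_measurable M" using Z by (simp add: has_levy_integral_to_infinity_def)
  obtain I where I: "\<And>T. 0 \<le> T \<Longrightarrow> has_levy_integral M L (\<lambda>s. exp (- s)) 0 T (I T)"
    and lim: "tendsto_in_prob M I Z at_top"
    using Z by (auto simp: has_levy_integral_to_infinity_def)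
  have Im[measurable]: "I (real n) \<in> borel_measurable M" for n
    using I[of "real n"] by (simp add: has_levy_integral_def)
  define \<mu> v where "\<mu> = expectation (L 1)" and "v = variance (L 1)"
  have v0: "0 \<le> v" unfolding v_def by (rule variance_positive)
  define X where "X = (\<lambda>n. I (real n))"
  have [measurable]: "X n \<in> borel_measurable M" for n by (simp add: X_def)
  have inc: "(integrable M (\<lambda>w. (X m w - X n w)^2)) \<and>
      expectation (\<lambda>w. X m w - X n w) = \<mu> * (exp (- real n) - exp (- real m)) \<and>
      expectation (\<lambda>w. (X m w - X n w)^2) = v * ((exp (- 2 * real n) - exp (- 2 * real m)) / 2) + (\<mu> * (exp (- real n) - exp (- real m)))^2"
    if nm: "n \<le> m" for n m
  proof -
    \<comment> \<open>Block \<open>1\<close> of this grid runs from \<open>n\<close> to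
      \<open>m\<close>; afterwards the grid is constant.\<close>
    define t where "t = (\<lambda>j::nat. if j = 0 then 0 else if j = 1 then real n else real m)"
    have t: "t 0 = 0" "\<And>j. t j \<le> t (Suc j)" using nm by (auto simp: t_def)
    have It: "has_levy_integral M L (\<lambda>s. exp (- 1 * s)) 0 (t j) (I (t j))" for j
      using I[of "t j"] by (simp add: t_def)
    note B = levy_block_moments[where I="\<lambda>j. I (t j)" and j=1, OF t _ It]
    have int: "integrable M (\<lambda>w. (X m w - X n w)^2)" using B(2) by (simp add: X_def t_def)
    have m: "expectation (\<lambda>w. X m w - X n w) = \<mu> * (exp (- real n) - exp (- real m))"
      using B(3) by (simp add: X_def t_def \<mu>_def)
    have va: "variance (\<lambda>w. X m w - X n w) = v * ((exp (- 2 * real n) - exp (- 2 * real m)) / 2)"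
      using B(4) by (simp add: X_def t_def v_def diff_divide_distrib)
    have "integrable M (\<lambda>w. X m w - X n w)" by (rule integrable_of_power2[OF _ int]) measurable
    from variance_eq[OF this int] show ?thesis using int m va by simp
  qed
  have X0: "AE w in M. X 0 w = 0"
  proof -
    have "has_levy_integral M L (\<lambda>s. exp (- 1 * s)) 0 ((\<lambda>_. 0) j) (I 0)" for j :: nat
      using I[of 0] by simp
    from levy_integral_0[OF _ _ _ this] show ?thesis by (simp add: X_def)
  qed
  \<comment> \<open>\<open>inc\<close> speaks of differences only. Subtracting \<open>X 0\<close>,
    which is almost surely \<open>0\<close>, turns each \<open>X n\<close> into a difference without
    affecting the limit in probability.\<close>
  define W where "W = (\<lambda>n w. X n w - X 0 w)"
  have [measurable]: "W n \<in> borel_measurable M" for n by (simp add: W_def)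
  have Wsq: "integrable M (\<lambda>w. (W n w)^2)" for n using inc[of 0 n] by (simp add: W_def)
  define r where "r = (\<lambda>n. (v / 2 + \<mu>^2) * exp (- 2)^n)"
  have r: "summable r" unfolding r_def by (intro summable_mult summable_geometric) simp
  have e2: "exp (- 2 * real n) = exp (- 2)^n" for n by (simp add: mult.commute flip: exp_of_nat_mult)
  have Cauchy: "expectation (\<lambda>w. (W m w - W n w)^2) \<le> r n" if nm: "n \<le> m" for n m
  proof -
    have "expectation (\<lambda>w. (W m w - W n w)^2)
      = v * ((exp (- 2 * real n) - exp (- 2 * real m)) / 2) + (\<mu> * (exp (- real n) - exp (- real m)))^2"
      using inc[OF nm] by (simp add: W_def)
    also have "\<dots> \<le> v * (exp (- 2 * real n) / 2) + \<mu>^2 * exp (- real n)^2"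
      unfolding power_mult_distrib using nm v0 by (intro add_mono mult_left_mono power_mono divide_right_mono) auto
    also have "exp (- real n)^2 = exp (- 2 * real n)" by (simp flip: exp_of_nat_mult)
    finally show ?thesis unfolding e2 r_def by (simp add: algebra_simps)
  qed
  have Wlim: "tendsto_in_prob M W Z sequentially"
    unfolding tendsto_in_prob_def
  proof (intro allI impI)
    fix e :: real assume "0 < e"
    then have "((\<lambda>T. prob {w \<in> space M. e < \<bar>I T w - Z w\<bar>}) \<longlongrightarrow> 0) at_top"
      using lim by (simp add: tendsto_in_prob_def)
    from filterlim_compose[OF this filterlim_real_sequentially]
    have "(\<lambda>n. prob {w \<in> space M. e < \<bar>X n w - Z w\<bar>}) \<longlonglongrightarrow> 0" by (simp add: X_def)
    moreover have "prob {w \<in> space M. e < \<bar>X n w - Z w\<bar>} = prob {w \<in> space M. e < \<bar>W n w - Z w\<bar>}" for n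
      using X0 by (intro finite_measure_eq_AE) (auto simp: W_def elim!: eventually_mono)
    ultimately show "(\<lambda>n. prob {w \<in> space M. e < \<bar>W n w - Z w\<bar>}) \<longlonglongrightarrow> 0" by simp
  qed
  note C = tendsto_in_prob_L2_Cauchy[OF \<open>\<And>n. W n \<in> borel_measurable M\<close> Zm Wsq Wlim Cauchy r]
  show Z2: "integrable M (\<lambda>w. Z w^2)" by (rule C(2))
  have "(\<lambda>n. expectation (\<lambda>w. (Z w - W n w)^2)) \<longlonglongrightarrow> 0"
    by (rule tendsto_sandwich[OF always_eventually always_eventually tendsto_const summable_LIMSEQ_zero[OF r]])
       (use C(3) in auto)
  note Zlim = L2_limit_moments[OF \<open>\<And>n. W n \<in> borel_measurable M\<close> Zm Wsq Z2 this]
  have e1: "(\<lambda>n. exp (- real n)) \<longlonglongrightarrow> 0"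
  proof -
    have "(\<lambda>n. exp (- 1 :: real)^n) \<longlonglongrightarrow> 0" by (rule LIMSEQ_power_zero) simp
    then show ?thesis by (simp flip: exp_of_nat_mult)
  qed
  have "(\<lambda>n. \<mu> * (1 - exp (- real n))) \<longlonglongrightarrow> \<mu> * (1 - 0)" by (intro tendsto_intros e1)
  moreover have "expectation (W n) = \<mu> * (1 - exp (- real n))" for n
    using inc[of 0 n] by (simp add: W_def)
  ultimately show EZ: "expectation Z = expectation (L 1)"
    using LIMSEQ_unique[OF Zlim(1)] by (simp add: \<mu>_def)
  have "(\<lambda>n. v * ((1 - exp (- 2)^n) / 2) + (\<mu> * (1 - exp (- real n)))^2) \<longlonglongrightarrow> v * ((1 - 0) / 2) + (\<mu> * (1 - 0))^2"
    by (intro tendsto_intros e1 LIMSEQ_power_zero) auto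
  moreover have "expectation (\<lambda>w. (W n w)^2) = v * ((1 - exp (- 2)^n) / 2) + (\<mu> * (1 - exp (- real n)))^2" for n
    using inc[of 0 n] unfolding e2[symmetric] by (simp add: W_def)
  ultimately have "expectation (\<lambda>w. Z w^2) = v / 2 + \<mu>^2"
    using LIMSEQ_unique[OF Zlim(2)] by simp
  then show "variance Z = variance (L 1) / 2"
    using variance_eq[OF integrable_of_power2[OF Zm Z2] Z2] by (simp add: EZ \<mu>_def v_def)
qed

context
  fixes lam :: real and Y :: "real \<Rightarrow> 'a \<Rightarrow> real"
  assumes lam: "lam > 0" and Y: "stationary_levy_OU M L lam Y"
begin

lemma OU_measurable: "0 \<le> t \<Longrightarrow> Y t \<in> borel_measurable M"
  using Y by (simp add: stationary_levy_OU_def)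

lemma OU_indep_0:
  "indep_set (sets (vimage_algebra (space M) (Y 0) borel))
    (sigma_sets (space M) (\<Union>t\<in>{0..}. sets (vimage_algebra (space M) (L t) borel)))"
  using Y by (simp add: stationary_levy_OU_def)

lemma OU_0_moments:
  shows "integrable M (\<lambda>w. Y 0 w^2)" and "expectation (Y 0) = expectation (L 1)"
    and "variance (Y 0) = variance (L 1) / 2"
proof -
  obtain Z where Z: "has_levy_integral_to_infinity M L (\<lambda>s. exp (- s)) Z"
    and d: "distr M borel (Y 0) = distr M borel Z"
    using Y by (auto simp: stationary_levy_OU_def)
  note Zm = levy_integral_to_infinity_moments[OF Z]
  have [measurable]: "Y 0 \<in> borel_measurable M" "Z \<in> borel_measurable M" using OU_measurable Zm(1) by auto
  have E: "expectation (\<lambda>w. f (Y 0 w)) = expectation (\<lambda>w. f (Z w))"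
    if [measurable]: "f \<in> borel_measurable borel" for f :: "real \<Rightarrow> real"
    using integral_distr[of "Y 0" M borel f] integral_distr[of Z M borel f] d by simp
  show "integrable M (\<lambda>w. Y 0 w^2)"
    using integrable_distr_eq[of "Y 0" M borel "\<lambda>x. x^2"] integrable_distr_eq[of Z M borel "\<lambda>x. x^2"] d Zm(2) by simp
  show EY: "expectation (Y 0) = expectation (L 1)" using E[of "\<lambda>x. x"] Zm(3) by simp
  show "variance (Y 0) = variance (L 1) / 2"
    using E[of "\<lambda>x. (x - expectation (L 1))^2"] Zm(3,4) by (simp add: EY)
qed

lemma OU_integrals:
  obtains J where "\<And>s. 0 \<le> s \<Longrightarrow> has_levy_integral M L (\<lambda>u. exp (1 * u)) 0 (lam * s) (J s)"
    and "\<And>s. 0 \<le> s \<Longrightarrow> AE w in M. Y s w = exp (- lam * s) * (Y 0 w + J s w)"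
proof -
  have "\<forall>s. 0 \<le> s \<longrightarrow> (\<exists>I. has_levy_integral M L exp 0 (lam * s) I \<and>
      (AE w in M. Y s w = exp (- lam * s) * Y 0 w + exp (- lam * s) * I w))"
    using Y by (simp add: stationary_levy_OU_def)
  then obtain J where "\<forall>s. 0 \<le> s \<longrightarrow> has_levy_integral M L exp 0 (lam * s) (J s) \<and>
      (AE w in M. Y s w = exp (- lam * s) * Y 0 w + exp (- lam * s) * J s w)"
    by metis
  then show ?thesis by (intro that[of J]) (auto simp: distrib_left)
qed

text \<open>On the grid \<open>0, t, t + h\<close> both values are combinations of three
  uncorrelated centred variables: the starting value and the integrals over two blocks. The part
  they share has variance \<open>v / 2 + v * (exp (2 * lam * t) - 1) / 2\<close>, that is
  \<open>v / 2 * exp (2 * lam * t)\<close>, so the dependence on \<open>t\<close> cancels against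
  the prefactors.\<close>

lemma OU_covariance:
  assumes t: "0 \<le> t"
  shows "expectation (Y t) = expectation (L 1)"
    and "covariance M (Y (t + real h)) (Y t) = variance (L 1) / 2 * exp (- lam * real h)"
proof -
  obtain J where J: "\<And>s. 0 \<le> s \<Longrightarrow> has_levy_integral M L (\<lambda>u. exp (1 * u)) 0 (lam * s) (J s)"
    and YJ: "\<And>s. 0 \<le> s \<Longrightarrow> AE w in M. Y s w = exp (- lam * s) * (Y 0 w + J s w)"
    using OU_integrals by blast
  define \<mu> v where "\<mu> = expectation (L 1)" and "v = variance (L 1)"
  have *: "expectation (Y s) = \<mu> \<and> covariance M (Y (s + real h)) (Y s) = v / 2 * exp (- lam * real h)"
    if s: "0 \<le> s" for s h
  proof -
    define u where "u = s + real h"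
    define T where "T = (\<lambda>j::nat. if j = 0 then 0 else if j = 1 then s else u)"
    have T0: "0 \<le> T j" for j using s by (auto simp: T_def u_def)
    have T: "lam * T 0 = 0" "lam * T j \<le> lam * T (Suc j)" for j
      using s lam by (auto simp: T_def u_def intro!: mult_left_mono)
    define X where "X = (\<lambda>j w. J (T (Suc j)) w - J (T j) w)"
    note JT = J[OF T0]
    note B = levy_block_moments[where t="\<lambda>j. lam * T j" and c=1 and I="\<lambda>j. J (T j)", OF T one_neq_zero JT]
    have Xsq: "integrable M (\<lambda>w. X j w^2)" and Xm: "X j \<in> borel_measurable M" for j
      unfolding X_def by (rule B(2), rule B(1))
    have EX: "expectation (X j) = \<mu> * (exp (lam * T (Suc j)) - exp (lam * T j))"
      and VX: "variance (X j) = v * ((exp (2 * lam * T (Suc j)) - exp (2 * lam * T j)) / 2)" for j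
      unfolding X_def using B(3,4)[of j] by (simp_all add: \<mu>_def v_def mult.assoc)
    have ind: "indep_vars (\<lambda>_. borel) (case_nat (Y 0) X) UNIV"
      unfolding X_def
      by (rule levy_blocks_indep[where t="\<lambda>j. lam * T j" and c=1 and I="\<lambda>j. J (T j)",
          OF T one_neq_zero JT OU_measurable[OF order_refl] OU_indep_0])
    have J0: "AE w in M. J (T 0) w = 0"
      by (rule levy_integral_0[where t="\<lambda>j. lam * T j" and c=1 and I="\<lambda>j. J (T j)", OF T one_neq_zero JT])
    define V where "V = case_nat (Y 0) X"
    have Vsq: "integrable M (\<lambda>w. V j w^2)" and Vm[measurable]: "V j \<in> borel_measurable M" for j
      using Xsq Xm OU_0_moments(1) OU_measurable[of 0] by (auto simp: V_def split: nat.split)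
    have Vint: "integrable M (V j)" for j by (rule integrable_of_power2[OF Vm Vsq])
    define a where "a = (\<lambda>j w. V j w - expectation (V j))"
    have am[measurable]: "a j \<in> borel_measurable M" for j by (simp add: a_def)
    have ind_a: "indep_vars (\<lambda>_. borel) a UNIV"
      unfolding a_def by (rule indep_vars_compose2[OF ind[folded V_def], where Y="\<lambda>j x. x - expectation (V j)"]) auto
    have a0: "expectation (a j) = 0" for j using Vint by (simp add: a_def prob_space)
    have asq: "integrable M (\<lambda>w. (a j w)^2)" for j
      unfolding a_def using Vsq[of j] Vint[of j] by (simp add: power2_diff)
    have aint: "integrable M (a j)" for j by (rule integrable_of_power2[OF am asq])
    have app: "integrable M (\<lambda>w. a i w * a j w)" for i j by (rule integrable_mult_of_power2[OF am am asq asq])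
    have orth: "expectation (\<lambda>w. a i w * a j w) = 0" if "i < j" for i j
    proof -
      have "indep_var borel (\<lambda>w. (\<lambda>x. x i) (restrict (\<lambda>k. a k w) {..i})) borel (a j)"
        using that by (intro indep_var_past[OF ind_a] measurable_component_singleton) auto
      then have "indep_var borel (a i) borel (a j)" by simp
      from indep_var_lebesgue_integral[OF this aint aint] show ?thesis by (simp add: a0)
    qed
    have V0: "expectation (V 0) = \<mu>" and VS: "expectation (V (Suc j)) = \<mu> * (exp (lam * T (Suc j)) - exp (lam * T j))" for j
      using OU_0_moments(2) EX by (simp_all add: V_def \<mu>_def)
    have sq0: "expectation (\<lambda>w. a 0 w * a 0 w) = v / 2"
      using OU_0_moments(3) by (simp add: a_def V_def v_def power2_eq_square)
    have sq1: "expectation (\<lambda>w. a 1 w * a 1 w) = v * ((exp (2 * lam * s) - 1) / 2)"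
      using VX[of 0] by (simp add: a_def V_def power2_eq_square T_def)
    have Ys: "AE w in M. Y s w = \<mu> + exp (- lam * s) * (a 0 w + a 1 w)"
      using YJ[OF s] J0
    proof eventually_elim
      case (elim w)
      have "Y 0 w + J s w = a 0 w + a 1 w + \<mu> * exp (lam * s)"
        using elim(2) VS[of 0] V0 by (simp add: a_def V_def X_def T_def algebra_simps)
      then show ?case unfolding elim(1) by (simp add: algebra_simps flip: exp_add)
    qed
    have Yu: "AE w in M. Y u w = \<mu> + exp (- lam * u) * (a 0 w + a 1 w + a 2 w)"
    proof -
      have u: "0 \<le> u" using s by (simp add: u_def)
      show ?thesis
        using YJ[OF u] J0
      proof eventually_elim
        case (elim w)
        have "Y 0 w + J u w = a 0 w + a 1 w + a 2 w + \<mu> * exp (lam * u)"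
          using elim(2) VS[of 0] VS[of 1] V0 by (simp add: a_def V_def X_def T_def numeral_2_eq_2 algebra_simps)
        then show ?case unfolding elim(1) by (simp add: algebra_simps flip: exp_add)
      qed
    qed
    have [measurable]: "Y s \<in> borel_measurable M" "Y u \<in> borel_measurable M"
      using OU_measurable s by (auto simp: u_def)
    have "expectation (Y s) = expectation (\<lambda>w. \<mu> + exp (- lam * s) * (a 0 w + a 1 w))"
      using Ys by (intro integral_cong_AE) auto
    then have EYs: "expectation (Y s) = \<mu>" using aint a0 by (simp add: prob_space)
    have "expectation (Y u) = expectation (\<lambda>w. \<mu> + exp (- lam * u) * (a 0 w + a 1 w + a 2 w))"
      using Yu by (intro integral_cong_AE) auto
    then have EYu: "expectation (Y u) = \<mu>" using aint a0 by (simp add: prob_space)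
    have "covariance M (Y u) (Y s) = expectation (\<lambda>w. exp (- lam * u) * exp (- lam * s) *
        (a 0 w * a 0 w + 2 * (a 0 w * a 1 w) + a 1 w * a 1 w + a 0 w * a 2 w + a 1 w * a 2 w))"
      unfolding covariance_def EYs EYu
    proof (rule integral_cong_AE)
      show "AE w in M. (Y u w - \<mu>) * (Y s w - \<mu>) = exp (- lam * u) * exp (- lam * s) *
        (a 0 w * a 0 w + 2 * (a 0 w * a 1 w) + a 1 w * a 1 w + a 0 w * a 2 w + a 1 w * a 2 w)"
        using Ys Yu by eventually_elim (simp add: algebra_simps)
    qed measurable
    also have "\<dots> = exp (- lam * u) * exp (- lam * s) * (v / 2 + v * ((exp (2 * lam * s) - 1) / 2))"
      using app orth[of 0 1] orth[of 0 2] orth[of 1 2] sq0 sq1 by simp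
    also have "\<dots> = v / 2 * (exp (- lam * u) * exp (- lam * s) * exp (2 * lam * s))"
      by (simp add: field_simps)
    also have "exp (- lam * u) * exp (- lam * s) * exp (2 * lam * s) = exp (- lam * real h)"
      by (simp add: u_def algebra_simps flip: exp_add)
    finally show ?thesis using EYs by (simp add: u_def)
  qed
  from *[OF t, of h] show "expectation (Y t) = expectation (L 1)"
    and "covariance M (Y (t + real h)) (Y t) = variance (L 1) / 2 * exp (- lam * real h)"
    by (simp_all add: \<mu>_def v_def)
qed

lemma OU_sample_limits:
  "AE w in M. (\<lambda>n. sample_mean (\<lambda>i. Y (real i) w) n) \<longlonglongrightarrow> expectation (L 1) \<and>
    (\<forall>h. (\<lambda>n. sample_autocov (\<lambda>i. Y (real i) w) n h) \<longlonglongrightarrow> variance (L 1) / 2 * exp (- lam * real h))"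
proof -
  obtain J where J: "\<And>s. 0 \<le> s \<Longrightarrow> has_levy_integral M L (\<lambda>u. exp (1 * u)) 0 (lam * s) (J s)"
    and YJ: "\<And>s. 0 \<le> s \<Longrightarrow> AE w in M. Y s w = exp (- lam * s) * (Y 0 w + J s w)"
    using OU_integrals by blast
  define \<mu> v where "\<mu> = expectation (L 1)" and "v = variance (L 1)"
  define \<theta> where "\<theta> = exp (- lam)"
  \<comment> \<open>The variance of the scaled block \<open>exp (- lam * (i + 1)) * X i\<close>, the
    same for every \<open>i\<close>. Division by \<open>1 - \<theta>^2\<close> leaves
    \<open>v / 2\<close>.\<close>
  define s where "s = v * ((1 - \<theta>^2) / 2)"
  have \<theta>: "\<bar>\<theta>\<bar> < 1" using lam by (simp add: \<theta>_def)
  have T: "lam * real 0 = 0" "lam * real j \<le> lam * real (Suc j)" for j using lam by auto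
  define X where "X = (\<lambda>j w. J (real (Suc j)) w - J (real j) w)"
  note JT = J[OF of_nat_0_le_iff]
  note B = levy_block_moments[where t="\<lambda>j. lam * real j" and c=1 and I="\<lambda>j. J (real j)", OF T one_neq_zero JT]
  have ind: "indep_vars (\<lambda>_. borel) (case_nat (Y 0) X) UNIV"
    unfolding X_def
    by (rule levy_blocks_indep[where t="\<lambda>j. lam * real j" and c=1 and I="\<lambda>j. J (real j)",
        OF T one_neq_zero JT OU_measurable[OF order_refl] OU_indep_0])
  have J0: "AE w in M. J (real 0) w = 0"
    by (rule levy_integral_0[where t="\<lambda>j. lam * real j" and c=1 and I="\<lambda>j. J (real j)", OF T one_neq_zero JT])
  have Xsq: "integrable M (\<lambda>w. X j w^2)" and Xm: "X j \<in> borel_measurable M" for j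
    unfolding X_def by (rule B(2), rule B(1))
  have EX: "expectation (X j) = \<mu> * (exp (lam * real (Suc j)) - exp (lam * real j))"
    and VX: "variance (X j) = v * ((exp (2 * lam * real (Suc j)) - exp (2 * lam * real j)) / 2)" for j
    unfolding X_def using B(3,4)[of j] by (simp_all add: \<mu>_def v_def mult.assoc)
  have X4: "integrable M (\<lambda>w. (X j w - expectation (X j))^4)"
    and X4le: "expectation (\<lambda>w. (X j w - expectation (X j))^4) \<le> exp (4 * (lam * real (Suc j))) * (m4 lam + 3 * (v * lam)^2)" for j
  proof -
    have "lam * real (Suc j) - lam * real j = lam" by (simp add: algebra_simps)
    with B(5,6)[of j] show "integrable M (\<lambda>w. (X j w - expectation (X j))^4)"
      "expectation (\<lambda>w. (X j w - expectation (X j))^4) \<le> exp (4 * (lam * real (Suc j))) * (m4 lam + 3 * (v * lam)^2)"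
      unfolding X_def v_def by simp_all
  qed
  \<comment> \<open>The factor \<open>exp (- lam * real (Suc i))\<close> is the one in front of the
    integral in the formula for \<open>Y (real (Suc i))\<close>. Its fourth power cancels the growth
    \<open>exp (4 * (lam * real (Suc i)))\<close> of the bound in \<open>levy_block_moments\<close>,
    so the fourth moments of the innovations are bounded uniformly.\<close>
  define V where "V = (\<lambda>j w. case j of 0 \<Rightarrow> Y 0 w - \<mu> | Suc i \<Rightarrow> exp (- lam * real (Suc i)) * (X i w - expectation (X i)))"
  have "indep_vars (\<lambda>_. borel) (\<lambda>j w. (\<lambda>j x. case j of 0 \<Rightarrow> x - \<mu> | Suc i \<Rightarrow> exp (- lam * real (Suc i)) * (x - expectation (X i))) j (case_nat (Y 0) X j w)) UNIV"
    by (rule indep_vars_compose2[OF ind]) (auto split: nat.split)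
  also have "(\<lambda>j w. (\<lambda>j x. case j of 0 \<Rightarrow> x - \<mu> | Suc i \<Rightarrow> exp (- lam * real (Suc i)) * (x - expectation (X i))) j (case_nat (Y 0) X j w)) = V"
    by (auto simp: V_def fun_eq_iff split: nat.split)
  finally have indV: "indep_vars (\<lambda>_. borel) V UNIV" .
  have L: "AE w in M. (\<lambda>n. (\<Sum>i<n. ar_rec \<theta> (\<lambda>k. V k w) i) / real n) \<longlonglongrightarrow> 0 \<and>
    (\<forall>h. (\<lambda>n. (\<Sum>i<n. ar_rec \<theta> (\<lambda>k. V k w) (i + h) * ar_rec \<theta> (\<lambda>k. V k w) i) / real n) \<longlonglongrightarrow> \<theta>^h * (s / (1 - \<theta>^2)))"
  proof (rule autoregressive_AE[OF indV \<theta>, where C="m4 lam + 3 * (v * lam)^2"])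
    have "integrable M (\<lambda>w. (Y 0 w)^2)" by (rule OU_0_moments(1))
    moreover have "integrable M (Y 0)" by (rule integrable_of_power2[OF OU_measurable[OF order_refl] OU_0_moments(1)])
    ultimately show "integrable M (\<lambda>w. V 0 w^2)" by (simp add: V_def power2_diff)
    fix i
    have Vi: "V (Suc i) = (\<lambda>w. exp (- lam * real (Suc i)) * (X i w - expectation (X i)))" by (simp add: V_def)
    show "integrable M (\<lambda>w. V (Suc i) w^4)" unfolding Vi power_mult_distrib by (intro integrable_mult_right X4)
    have "expectation (\<lambda>w. V (Suc i) w^4) = exp (- lam * real (Suc i))^4 * expectation (\<lambda>w. (X i w - expectation (X i))^4)"
      unfolding Vi power_mult_distrib by simp
    also have "\<dots> \<le> exp (- lam * real (Suc i))^4 * (exp (4 * (lam * real (Suc i))) * (m4 lam + 3 * (v * lam)^2))"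
      by (intro mult_left_mono X4le) simp
    also have "\<dots> = (exp (- lam * real (Suc i))^4 * exp (4 * (lam * real (Suc i)))) * (m4 lam + 3 * (v * lam)^2)"
      by (simp only: mult.assoc)
    also have "exp (- lam * real (Suc i))^4 * exp (4 * (lam * real (Suc i))) = 1"
      by (simp del: of_nat_Suc flip: exp_of_nat_mult exp_add)
    finally show "expectation (\<lambda>w. V (Suc i) w^4) \<le> m4 lam + 3 * (v * lam)^2" by simp
    have "integrable M (X i)" by (rule integrable_of_power2[OF Xm Xsq])
    then show "expectation (V (Suc i)) = 0" unfolding Vi by (simp add: prob_space)
    have "expectation (\<lambda>w. V (Suc i) w^2) = exp (- lam * real (Suc i))^2 * variance (X i)"
      unfolding Vi power_mult_distrib by simp
    also have "\<dots> = v * ((exp (- lam * real (Suc i))^2 * exp (2 * lam * real (Suc i)) - exp (- lam * real (Suc i))^2 * exp (2 * lam * real i)) / 2)"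
      unfolding VX by (simp add: right_diff_distrib)
    also have "exp (- lam * real (Suc i))^2 * exp (2 * lam * real (Suc i)) = 1"
      by (simp del: of_nat_Suc flip: exp_of_nat_mult exp_add)
    also have "exp (- lam * real (Suc i))^2 * exp (2 * lam * real i) = \<theta>^2"
      by (simp add: \<theta>_def algebra_simps flip: exp_of_nat_mult exp_add)
    finally show "expectation (\<lambda>w. V (Suc i) w^2) = s" by (simp add: s_def)
  qed
  have "AE w in M. \<forall>i. Y (real i) w = exp (- lam * real i) * (Y 0 w + J (real i) w)"
    by (subst AE_all_countable) (intro allI YJ, simp)
  with J0 L show ?thesis
  proof eventually_elim
    case (elim w)
    define y where "y = ar_rec \<theta> (\<lambda>k. V k w)"
    \<comment> \<open>On the almost sure event where the solution formula holds at all integer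
      times, \<open>Y\<close> and \<open>\<mu> + y\<close> satisfy the same recursion: centring the
      innovation subtracts \<open>\<mu> * (1 - \<theta>)\<close>, which is what shifting by
      \<open>\<mu>\<close> requires.\<close>
    have x: "Y (real i) w = \<mu> + y i" for i
    proof (induction i)
      case 0
      show ?case by (simp add: y_def V_def)
    next
      case (Suc i)
      have e: "exp (- lam * real (Suc i)) * exp (lam * real (Suc i)) = 1"
        "exp (- lam * real (Suc i)) * exp (lam * real i) = \<theta>"
        "exp (- lam * real (Suc i)) = \<theta> * exp (- lam * real i)"
        by (simp_all add: \<theta>_def algebra_simps flip: exp_add)
      have "y (Suc i) = \<theta> * y i + exp (- lam * real (Suc i)) * (X i w - expectation (X i))"
        by (simp add: y_def V_def)
      also have "\<dots> = \<theta> * (Y (real i) w - \<mu>) + exp (- lam * real (Suc i)) * X i w - \<mu> * (1 - \<theta>)"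
      proof -
        have "exp (- lam * real (Suc i)) * expectation (X i) = \<mu> * (exp (- lam * real (Suc i)) * exp (lam * real (Suc i)) - exp (- lam * real (Suc i)) * exp (lam * real i))"
          unfolding EX by (simp only: right_diff_distrib mult_ac)
        also have "\<dots> = \<mu> * (1 - \<theta>)" unfolding e(1,2) ..
        finally show ?thesis using Suc by (simp add: right_diff_distrib)
      qed
      also have "\<dots> = \<theta> * Y (real i) w + exp (- lam * real (Suc i)) * X i w - \<mu>"
        by (simp only: algebra_simps)
      also have "\<theta> * Y (real i) w = exp (- lam * real (Suc i)) * (Y 0 w + J (real i) w)"
        unfolding e(3) using elim(3) by (simp only: mult.assoc)
      also have "exp (- lam * real (Suc i)) * (Y 0 w + J (real i) w) + exp (- lam * real (Suc i)) * X i w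
          = Y (real (Suc i)) w"
        unfolding elim(3)[rule_format, of "Suc i"] X_def by (simp only: distrib_left[symmetric]) simp
      finally show ?case by simp
    qed
    have \<theta>2: "1 - \<theta>^2 \<noteq> 0" using \<theta> by (simp add: abs_square_less_1[symmetric])
    have g: "\<theta>^h * (s / (1 - \<theta>^2)) = v / 2 * exp (- lam * real h)" for h
    proof -
      have "s = v / 2 * (1 - \<theta>^2)" by (simp add: s_def)
      then have "s / (1 - \<theta>^2) = v / 2" by (simp only: nonzero_mult_div_cancel_right[OF \<theta>2])
      moreover have "\<theta>^h = exp (- lam * real h)" by (simp add: \<theta>_def mult.commute flip: exp_of_nat_mult)
      ultimately show ?thesis by (simp only: mult.commute)
    qed
    note S = sample_statistics_limits[of "\<lambda>i. Y (real i) w", OF x]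
    have y1: "(\<lambda>n. (\<Sum>i<n. y i) / real n) \<longlonglongrightarrow> 0"
      and y2: "(\<lambda>n. (\<Sum>i<n. y (i + h) * y i) / real n) \<longlonglongrightarrow> v / 2 * exp (- lam * real h)" for h
      using elim(2) unfolding g y_def by blast+
    show ?case using S[OF y1 y2] by (simp add: \<mu>_def v_def)
  qed
qed

end
end

theorem theorem3p3:
  fixes M :: "'a measure" and L Y :: "real \<Rightarrow> 'a \<Rightarrow> real" and F :: "real measure"
    and K \<mu> \<sigma> lam :: real and d :: nat
  assumes L: "levy_process M L"
    and F: "levy_measure M L F"
    and K: "K > 0"
    and exp_moments: "\<And>v::real. \<bar>v\<bar> \<le> K \<Longrightarrow> (\<integral>\<^sup>+x\<in>{x. \<bar>x\<bar> > 1}. ennreal (exp (v * x)) \<partial>F) < \<infinity>"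
    and mu: "\<mu> = prob_space.expectation M (L 1)"
    and sigma: "\<sigma>\<^sup>2 = prob_space.variance M (L 1)"
    and lam: "lam > 0"
    and Y: "stationary_levy_OU M L lam Y"
  shows "let \<gamma> = (\<lambda>h::nat. \<sigma>\<^sup>2 / 2 * exp (- lam * real h));
             \<rho> = (\<lambda>h::nat. exp (- lam * real h));
             obs = (\<lambda>\<omega> (i::nat). Y (real i) \<omega>)
         in
           (\<forall>t\<ge>0. \<forall>h. covariance M (Y (t + real h)) (Y t) = \<gamma> h \<and>
                      (\<sigma>\<^sup>2 > 0 \<longrightarrow> correlation M (Y (t + real h)) (Y t) = \<rho> h)) \<and>
           (AE \<omega> in M. (\<lambda>n. sample_mean (obs \<omega>) n) \<longlonglongrightarrow> \<mu>) \<and>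
           (AE \<omega> in M. (\<lambda>n. (1 / real n) * (\<Sum>i=1..n. (obs \<omega> i - sample_mean (obs \<omega>) n)\<^sup>2)) \<longlonglongrightarrow> \<sigma>\<^sup>2 / 2) \<and>
           (AE \<omega> in M. \<forall>h\<in>{1..d}. (\<lambda>n. sample_autocov (obs \<omega>) n h) \<longlonglongrightarrow> \<gamma> h) \<and>
           (\<sigma>\<^sup>2 > 0 \<longrightarrow> (AE \<omega> in M. \<forall>h\<in>{1..d}. (\<lambda>n. sample_autocorr (obs \<omega>) n h) \<longlonglongrightarrow> \<rho> h))"
proof -
  interpret prob_space M using L by (simp add: levy_process_def)
  interpret levy_power4 M L
    by unfold_locales (use L levy_power4_integrable[OF L F K exp_moments] in auto)
  note OU = OU_covariance(2)[OF lam Y, folded sigma] OU_sample_limits[OF lam Y, folded sigma mu]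
  have corr: "correlation M (Y (t + real h)) (Y t) = exp (- lam * real h)" if "0 \<le> t" "\<sigma>\<^sup>2 > 0" for t h
  proof -
    \<comment> \<open>The variance is the covariance at lag \<open>0\<close>. It is the same at both
      times, so the two square roots in the correlation multiply to
      \<open>\<sigma>\<^sup>2 / 2\<close>.\<close>
    have var: "variance (Y u) = \<sigma>\<^sup>2 / 2" if "0 \<le> u" for u
      using OU(1)[OF that, of 0] by (simp add: covariance_def power2_eq_square)
    have "0 \<le> t + real h" using that by simp
    then show ?thesis
      unfolding correlation_def var[OF that(1)] var[OF \<open>0 \<le> t + real h\<close>] OU(1)[OF that(1)] real_sqrt_mult_self
      using that by simp
  qed
  have A: "AE w in M. (\<lambda>n. sample_mean (\<lambda>i. Y (real i) w) n) \<longlonglongrightarrow> \<mu>"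
    using OU(2) by eventually_elim blast
  have B: "AE w in M. \<forall>h\<in>{1..d}. (\<lambda>n. sample_autocov (\<lambda>i. Y (real i) w) n h) \<longlonglongrightarrow> \<sigma>\<^sup>2 / 2 * exp (- lam * real h)"
    using OU(2) by eventually_elim blast
  \<comment> \<open>This is the autocovariance at lag \<open>0\<close>, which lies outside
    \<open>{1..d}\<close>; \<open>OU_sample_limits\<close> covers every lag.\<close>
  have C: "AE w in M. (\<lambda>n. (1 / real n) * (\<Sum>i=1..n. (Y (real i) w - sample_mean (\<lambda>i. Y (real i) w) n)\<^sup>2)) \<longlonglongrightarrow> \<sigma>\<^sup>2 / 2"
    using OU(2)
  proof eventually_elim
    case (elim w)
    then have "(\<lambda>n. sample_autocov (\<lambda>i. Y (real i) w) n 0) \<longlonglongrightarrow> \<sigma>\<^sup>2 / 2 * exp (- lam * real 0)" by blast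
    then show ?case by (simp add: sample_autocov_def power2_eq_square)
  qed
  \<comment> \<open>A positive variance keeps the limit of the denominator, the lag \<open>0\<close>
    autocovariance, away from zero.\<close>
  have D: "AE w in M. \<forall>h\<in>{1..d}. (\<lambda>n. sample_autocorr (\<lambda>i. Y (real i) w) n h) \<longlonglongrightarrow> exp (- lam * real h)"
    if \<sigma>: "\<sigma>\<^sup>2 > 0"
    using OU(2)
  proof eventually_elim
    case (elim w)
    have "(\<lambda>n. sample_autocov (\<lambda>i. Y (real i) w) n h / sample_autocov (\<lambda>i. Y (real i) w) n 0)
        \<longlonglongrightarrow> (\<sigma>\<^sup>2 / 2 * exp (- lam * real h)) / (\<sigma>\<^sup>2 / 2 * exp (- lam * real 0))" for h
    proof (rule tendsto_divide)
      show "\<sigma>\<^sup>2 / 2 * exp (- lam * real 0) \<noteq> 0" using \<sigma> by simp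
    qed (use elim in blast)+
    then show ?case using \<sigma> by (simp add: sample_autocorr_def)
  qed
  show ?thesis
    unfolding Let_def using OU(1) corr A B C D by blast
qed

end
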